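(* Let $M$ be a hyperbolic once-punctured torus bundle with fundamental group $\Gamma$ and holonomy $\rho:\Gamma\to\mathrm{PSO}(3,1)\subset\mathrm{PGL}(4,\mathbb{R})$. Lift the representation $\rho$ to $\tilde\rho:\Gamma\to\mathrm{SO}(3,1)$. If the twisted Alexander polynomial of $\tilde\rho\otimes\tilde\rho$ has $1$ as a root with multiplicity $4$, then $M$ is infinitesimally projectively rigid rel cusp.
   Context: A hyperbolic once-punctured torus bundle $M$ is a fiber bundle over $S^1$ with fiber a once-punctured torus $F$ and monodromy $\phi\in \mathrm{SL}(2,\mathbb{Z})$, $|\mathrm{tr}\,\phi|>2$; it carries a unique complete hyperbolic structure. With $F_2=\langle a,b\rangle=\pi_1(F)$ free of rank 2, and $\phi$ also denoting the automorphism of $F_2$ representing the monodromy, $\Gamma=\pi_1(M)=\langle a,b,x\mid xax^{-1}=\phi(a),\ xbx^{-1}=\phi(b)\rangle$, where $x$ is a meridian of the boundary torus. $\mathrm{SO}(3,1)$ is the special orthogonal group of the form $x_1y_1+x_2y_2+x_3y_3-x_4y_4$ on $\mathbb{R}^4$, and $\mathrm{PSO}(3,1)$ is the projectivization of its identity component $\mathrm{SO}^0(3,1)$. The holonomy $\rho$ is the discrete faithful representation $\Gamma\to\mathrm{PSO}(3,1)$ of the complete hyperbolic structure. $\tilde\rho\otimes\tilde\rho$ is the representation of $\Gamma$ on $\mathbb{R}^4\otimes\mathbb{R}^4\cong\mathbb{R}^{16}$ given by $g\mapsto\tilde\rho(g)\otimes\tilde\rho(g)$ (Kronecker product). Infinitesimally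 projectively rigid rel cusp: viewing $M$ as a compact manifold with torus boundary $\partial M$, the map $i^*:H^1(M;\mathfrak{sl}(4,\mathbb{R})_{\mathrm{Ad}\rho})\to H^1(\partial M;\mathfrak{sl}(4,\mathbb{R})_{\mathrm{Ad}\rho})$ induced by the inclusion $\partial M\subset M$ (twisted cohomology) is injective, where $\mathfrak{sl}(4,\mathbb{R})_{\mathrm{Ad}\rho}$ is $\mathfrak{sl}(4,\mathbb{R})$ with $\Gamma$-action $gX=\rho(g)X\rho(g)^{-1}$. Twisted Alexander polynomial: let $\Gamma=\langle a_1,\dots,a_n\mid r_1,\dots,r_{n-1}\rangle$ be a deficiency-one presentation, $\sigma:\Gamma\to\mathrm{GL}(l,K)$ a representation over a field $K$, and $\alpha:\Gamma\to\langle t\rangle\cong\mathbb{Z}$ a surjective homomorphism. Let $\Phi:\mathbb{Z}F_n\to \mathrm{M}(l,K[t,t^{-1}])$ be the ring homomorphism obtained from $\mathbb{Z}F_n\to\mathbb{Z}\Gamma$ followed by $\sigma\otimes\alpha$ (so $g\mapsto \alpha(g)\sigma(g)$). The twisted Alexander matrix is the $(n-1)\times n$ block matrix with $(i,j)$ block $\Phi(\partial r_i/\partial a_j)$, where $\partial/\partial a_j:F_n\to\mathbb{Z}F_n$ is the Fox derivative, determined by $\partial(uv)/\partial a_j=\partial u/\partial a_j+u\,\partial v/\partial a_j$ and $\partial a_i/\partial a_j=\delta_{ij}$. Choosing $k$ with $\det\Phi(1-a_k)\neq0$ and letting $\mathcal{A}_{\sigma,\alpha,k}$ be this matrix with its $k$-th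 block column removed, viewed as an $l(n-1)\times l(n-1)$ matrix, the twisted Alexander polynomial is $\Delta_{\sigma,\alpha}(t)=\det\mathcal{A}_{\sigma,\alpha,k}/\det\Phi(1-a_k)$. It does not depend on $k$ and is well defined up to multiplication by nonzero elements of $K$ and by powers $t^{ls}$, $s\in\mathbb{Z}$. Here it is taken for the presentation of $\Gamma$ above, $\sigma=\tilde\rho\otimes\tilde\rho$, and $\alpha:\Gamma\to\Gamma/F_2\cong\langle t\rangle$ with $\alpha(F_2)=1$, $\alpha(x)=t$. *)

theory Defs
  imports
    "HOL-Analysis.Analysis"
    "HOL-Algebra.Elementary_Groups"
    "HOL-Library.Poly_Mapping"
    "HOL-Computational_Algebra.Fraction_Field"
begin

section \<open>Free groups\<close>

text \<open>
  A letter \<open>(g, True)\<close> stands for the generator \<open>g\<close>, a letter \<open>(g, False)\<close> for its inverse.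
  The free group on a type is written additively, because \<^class>\<open>group_add\<close> is the library's
  class of (not necessarily commutative) groups; with this choice the type
  \<open>'g free_group \<Rightarrow>\<^sub>0 int\<close> of Poly_Mapping, with its convolution product, is the integral
  group ring.
\<close>

inductive cancels :: "('g \<times> bool) list \<Rightarrow> ('g \<times> bool) list \<Rightarrow> bool" where
  "cancels (u @ [(g, e), (g, \<not> e)] @ v) (u @ v)"

definition word_eq :: "('g \<times> bool) list \<Rightarrow> ('g \<times> bool) list \<Rightarrow> bool" where
  "word_eq = equivclp cancels"

lemma word_eq_refl [simp]: "word_eq u u"
  by (simp add: word_eq_def)

lemma word_eq_sym: "word_eq u v \<Longrightarrow> word_eq v u"
  by (auto simp: word_eq_def intro: equivclp_sym)

lemma word_eq_trans: "word_eq u v \<Longrightarrow> word_eq v w \<Longrightarrow> word_eq u w"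
  by (auto simp: word_eq_def intro: equivclp_trans)

lemma word_eq_cancel: "word_eq (u @ [(g, e), (g, \<not> e)] @ v) (u @ v)"
  unfolding word_eq_def by (intro r_into_equivclp cancels.intros)

lemma word_eq_lift:
  assumes "word_eq u v"
    and step: "\<And>u g e v. f (u @ [(g, e), (g, \<not> e)] @ v) = f (u @ v)"
  shows "f u = f v"
  using assms(1) unfolding word_eq_def
proof (induction rule: equivclp_induct)
  case base
  show ?case by simp
next
  case (step y z)
  then show ?case using assms(2) by (auto elim!: cancels.cases)
qed

lemma word_eq_map:
  assumes "word_eq u v"
    and step: "\<And>u g e v. word_eq (f (u @ [(g, e), (g, \<not> e)] @ v)) (f (u @ v))"
  shows "word_eq (f u) (f v)"
  using assms(1) unfolding word_eq_def
proof (induction rule: equivclp_induct)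
  case base
  show ?case by simp
next
  case (step y z)
  have "word_eq (f y) (f z)"
    using step(2) assms(2) by (auto elim!: cancels.cases intro: word_eq_sym)
  then show ?case using step(3) by (metis word_eq_def word_eq_trans)
qed

quotient_type 'g free_group = "('g \<times> bool) list" / word_eq
  by (intro equivpI reflpI sympI transpI)
     (auto intro: word_eq_sym word_eq_trans)

definition inv_word :: "('g \<times> bool) list \<Rightarrow> ('g \<times> bool) list" where
  "inv_word w = rev (map (\<lambda>(g, e). (g, \<not> e)) w)"

lemma word_eq_append:
  assumes "word_eq u u'" "word_eq v v'"
  shows "word_eq (u @ v) (u' @ v')"
proof -
  have "word_eq (u @ v) (u' @ v)"
    using assms(1) by (rule word_eq_map) (metis append.assoc word_eq_cancel)
  moreover have "word_eq (u' @ v) (u' @ v')"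
    using assms(2) by (rule word_eq_map) (metis append.assoc word_eq_cancel)
  ultimately show ?thesis by (rule word_eq_trans)
qed

lemma word_eq_inv_word:
  assumes "word_eq u u'"
  shows "word_eq (inv_word u) (inv_word u')"
  using assms
proof (rule word_eq_map)
  fix u v :: "('a \<times> bool) list" and g e
  show "word_eq (inv_word (u @ [(g, e), (g, \<not> e)] @ v)) (inv_word (u @ v))"
    using word_eq_cancel[of "inv_word v" g e "inv_word u"] by (simp add: inv_word_def)
qed

lemma word_eq_left_inverse: "word_eq (inv_word w @ w) []"
proof (induction w)
  case (Cons a w)
  obtain g e where a: "a = (g, e)" by force
  have "word_eq (inv_word (a # w) @ a # w) (inv_word w @ w)"
    using word_eq_cancel[of "inv_word w" g "\<not> e" w] by (simp add: inv_word_def a)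
  then show ?case using Cons word_eq_trans by blast
qed (simp add: inv_word_def)

instantiation free_group :: (type) group_add
begin

lift_definition zero_free_group :: "'a free_group" is "[]" .

lift_definition plus_free_group :: "'a free_group \<Rightarrow> 'a free_group \<Rightarrow> 'a free_group" is "(@)"
  by (rule word_eq_append)

lift_definition uminus_free_group :: "'a free_group \<Rightarrow> 'a free_group" is inv_word
  by (rule word_eq_inv_word)

definition minus_free_group :: "'a free_group \<Rightarrow> 'a free_group \<Rightarrow> 'a free_group" where
  "minus_free_group u v = u + - v"

instance
proof
  fix u v w :: "'a free_group"
  show "u + v + w = u + (v + w)" by transfer simp
  show "0 + u = u" by transfer simp
  show "u + 0 = u" by transfer simp
  show "- u + u = 0" by transfer (rule word_eq_left_inverse)
  show "u + - v = u - v" by (simp add: minus_free_group_def)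
qed

end

lift_definition gen :: "'g \<Rightarrow> 'g free_group" is "\<lambda>g. [(g, True)]" .

text \<open>The homomorphism out of the free group prescribed by the images of the generators.\<close>

lift_definition free_lift :: "('g \<Rightarrow> 'h::group_add) \<Rightarrow> 'g free_group \<Rightarrow> 'h" is
  "\<lambda>f w. sum_list (map (\<lambda>(g, e). if e then f g else - f g) w)"
  by (erule word_eq_lift) (auto simp: add.assoc[symmetric])

lemma free_lift_gen [simp]: "free_lift f (gen g) = f g"
  by transfer simp

lemma free_lift_zero [simp]: "free_lift f 0 = 0"
  by transfer simp

lemma free_lift_add: "free_lift f (u + v) = free_lift f u + free_lift f v"
  by transfer simp

text \<open>The free group in the form used by HOL-Algebra.\<close>

definition Free :: "'g free_group monoid" where
  "Free = \<lparr>carrier = UNIV, monoid.mult = (+), one = 0\<rparr>"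

lemma group_Free: "group Free"
  by (rule groupI) (auto simp: Free_def add.assoc intro: exI[of _ "- _"] left_minus)


section \<open>Fox calculus\<close>

text \<open>
  The recursion follows \<open>\<partial>(g w) = \<partial>g + g \<partial>w\<close> and \<open>\<partial>(g\<^sup>-\<^sup>1 w) = - g\<^sup>-\<^sup>1 \<partial>g + g\<^sup>-\<^sup>1 \<partial>w\<close>; the two
  determining properties of the Fox derivative are proved as \<open>fox_gen\<close> and \<open>fox_add\<close>.
\<close>

abbreviation group_ring_elem :: "'g free_group \<Rightarrow> 'g free_group \<Rightarrow>\<^sub>0 int" where
  "group_ring_elem u \<equiv> Poly_Mapping.single u 1"

fun fox_word :: "'g \<Rightarrow> ('g \<times> bool) list \<Rightarrow> 'g free_group \<Rightarrow>\<^sub>0 int" where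
  "fox_word j [] = 0"
| "fox_word j ((g, True) # w) =
     (if g = j then 1 else 0) + group_ring_elem (gen g) * fox_word j w"
| "fox_word j ((g, False) # w) =
     - group_ring_elem (- gen g) * (if g = j then 1 else 0)
       + group_ring_elem (- gen g) * fox_word j w"

lemma gen_cancel_ring:
  "group_ring_elem (gen g) * (group_ring_elem (- gen g) * c) = c"
  "group_ring_elem (- gen g) * (group_ring_elem (gen g) * c) = c"
  "group_ring_elem (gen g) * group_ring_elem (- gen g) = 1"
  by (simp_all add: mult.assoc[symmetric] mult_single)

lemma fox_word_cong:
  assumes "fox_word j v = fox_word j v'"
  shows "fox_word j (u @ v) = fox_word j (u @ v')"
proof (induction u)
  case (Cons a u)
  then show ?case by (cases a; cases "snd a") auto
qed (simp add: assms)

lift_definition fox :: "'g \<Rightarrow> 'g free_group \<Rightarrow> 'g free_group \<Rightarrow>\<^sub>0 int" is fox_word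
proof -
  fix j :: 'g and u v :: "('g \<times> bool) list"
  assume "word_eq u v"
  then show "fox_word j u = fox_word j v"
  proof (rule word_eq_lift)
    fix u v :: "('g \<times> bool) list" and g e
    have "fox_word j ([(g, e), (g, \<not> e)] @ v) = fox_word j v"
      by (cases e) (simp_all add: algebra_simps gen_cancel_ring)
    then show "fox_word j (u @ [(g, e), (g, \<not> e)] @ v) = fox_word j (u @ v)"
      by (rule fox_word_cong)
  qed
qed

lemma fox_gen: "fox j (gen g) = (if g = j then 1 else 0)"
  by transfer simp

lemma abs_free_group_Cons:
  "abs_free_group ((g, e) # w) = (if e then gen g else - gen g) + abs_free_group w"
proof (cases e)
  case True
  then show ?thesis by (simp add: gen.abs_eq plus_free_group.abs_eq)
next
  case False
  then show ?thesis
    by (simp add: gen.abs_eq plus_free_group.abs_eq uminus_free_group.abs_eq inv_word_def)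
qed

lemma fox_word_append:
  "fox_word j (u @ v) = fox_word j u + group_ring_elem (abs_free_group u) * fox_word j v"
proof (induction u)
  case Nil
  have "abs_free_group [] = (0 :: 'a free_group)" by (simp add: zero_free_group_def)
  then show ?case by simp
next
  case (Cons a u)
  obtain g e where a: "a = (g, e)" by force
  have *: "group_ring_elem (x + y) = group_ring_elem x * group_ring_elem y"
    for x y :: "'a free_group"
    by (simp add: mult_single)
  show ?case
    using Cons
    by (cases e) (simp_all add: a abs_free_group_Cons * distrib_left add.assoc mult.assoc)
qed

lemma fox_add: "fox j (u + v) = fox j u + group_ring_elem u * fox j v"
proof -
  obtain p q where "u = abs_free_group p" "v = abs_free_group q"
    by (metis Quotient_free_group Quotient_abs_rep)
  then show ?thesis
    by (simp add: fox.abs_eq plus_free_group.abs_eq fox_word_append)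
qed


section \<open>Presented groups and twisted Alexander polynomials\<close>

definition normal_closure :: "('a, 'b) monoid_scheme \<Rightarrow> 'a set \<Rightarrow> 'a set" where
  "normal_closure G R =
     generate G {g \<otimes>\<^bsub>G\<^esub> r \<otimes>\<^bsub>G\<^esub> inv\<^bsub>G\<^esub> g | g r. g \<in> carrier G \<and> r \<in> R}"

text \<open>Generators are indexed by the type \<open>'g\<close>, relators by the type \<open>'r\<close>.\<close>

definition presented_group :: "('r \<Rightarrow> 'g free_group) \<Rightarrow> 'g free_group set monoid" where
  "presented_group rel = Free Mod normal_closure Free (range rel)"

definition cls :: "('r \<Rightarrow> 'g free_group) \<Rightarrow> 'g free_group \<Rightarrow> 'g free_group set" where
  "cls rel u = normal_closure Free (range rel) #>\<^bsub>Free\<^esub> u"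

text \<open>
  Laurent polynomials over \<open>'k\<close> are taken inside the field of rational functions
  \<open>'k poly fract\<close>, in which the quotient defining the twisted Alexander polynomial lives.
\<close>

definition const :: "'k::field \<Rightarrow> 'k poly fract" where
  "const c = Fract [:c:] 1"

definition tvar :: "'k::field poly fract" where
  "tvar = Fract [:0, 1:] 1"

definition alexander_hom ::
  "('r \<Rightarrow> 'g free_group) \<Rightarrow> ('g free_group set \<Rightarrow> 'k::field ^ 'l ^ 'l) \<Rightarrow>
   ('g free_group set \<Rightarrow> int) \<Rightarrow> ('g free_group \<Rightarrow>\<^sub>0 int) \<Rightarrow> 'k poly fract ^ 'l ^ 'l" where
  "alexander_hom rel \<sigma> \<alpha> c =
     (\<chi> i j. \<Sum>g\<in>Poly_Mapping.keys c.
        of_int (Poly_Mapping.lookup c g) * tvar powi \<alpha> (cls rel g) * const (\<sigma> (cls rel g) $ i $ j))"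

text \<open>
  The block columns that remain after the removal of the one indexed by \<open>k\<close> are listed by a
  bijection \<open>c\<close> from the index type of the relators; such a \<open>c\<close> exists only in deficiency one.
  The predicate holds of all representatives of the twisted Alexander polynomial, that is, of
  all \<open>\<Delta>\<close> equal to it up to a nonzero constant \<open>u\<close> and a power of \<open>t\<^sup>l\<close> with \<open>l = CARD('l)\<close>.
\<close>

definition twisted_alexander_matrix ::
  "('r::finite \<Rightarrow> 'g free_group) \<Rightarrow> ('g free_group set \<Rightarrow> 'k::field ^ 'l ^ 'l) \<Rightarrow>
   ('g free_group set \<Rightarrow> int) \<Rightarrow> ('r \<Rightarrow> 'g) \<Rightarrow> 'k poly fract ^ ('r \<times> 'l) ^ ('r \<times> 'l)" where
  "twisted_alexander_matrix rel \<sigma> \<alpha> c =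
     (\<chi> p q. alexander_hom rel \<sigma> \<alpha> (fox (c (fst q)) (rel (fst p))) $ snd p $ snd q)"

definition is_twisted_alexander_polynomial ::
  "('r::finite \<Rightarrow> 'g free_group) \<Rightarrow> ('g free_group set \<Rightarrow> 'k::field ^ 'l ^ 'l) \<Rightarrow>
   ('g free_group set \<Rightarrow> int) \<Rightarrow> 'k poly fract \<Rightarrow> bool" where
  "is_twisted_alexander_polynomial rel \<sigma> \<alpha> \<Delta> \<longleftrightarrow>
     (\<exists>k c u s.
        bij_betw c UNIV (UNIV - {k}) \<and>
        det (alexander_hom rel \<sigma> \<alpha> (1 - group_ring_elem (gen k))) \<noteq> 0 \<and>
        u \<noteq> 0 \<and>
        \<Delta> = const u * tvar powi (int CARD('l) * s) *
            (det (twisted_alexander_matrix rel \<sigma> \<alpha> c) /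
             det (alexander_hom rel \<sigma> \<alpha> (1 - group_ring_elem (gen k)))))"

definition root_with_multiplicity :: "'k::field poly fract \<Rightarrow> 'k \<Rightarrow> nat \<Rightarrow> bool" where
  "root_with_multiplicity f c m \<longleftrightarrow>
     (\<exists>p q. poly p c \<noteq> 0 \<and> poly q c \<noteq> 0 \<and> f = Fract ([:- c, 1:] ^ m * p) q)"


section \<open>Group cohomology in degree one\<close>

text \<open>\<open>V\<close> is an additive subgroup of the type \<open>'v\<close>, on which \<open>G\<close> acts by \<open>act\<close>.\<close>

definition cocycles ::
  "('a, 'b) monoid_scheme \<Rightarrow> 'v::ab_group_add set \<Rightarrow> ('a \<Rightarrow> 'v \<Rightarrow> 'v) \<Rightarrow> ('a \<Rightarrow> 'v) set" where
  "cocycles G V act =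
     {z \<in> carrier G \<rightarrow>\<^sub>E V. \<forall>g\<in>carrier G. \<forall>h\<in>carrier G. z (g \<otimes>\<^bsub>G\<^esub> h) = z g + act g (z h)}"

definition coboundaries ::
  "('a, 'b) monoid_scheme \<Rightarrow> 'v::ab_group_add set \<Rightarrow> ('a \<Rightarrow> 'v \<Rightarrow> 'v) \<Rightarrow> ('a \<Rightarrow> 'v) set" where
  "coboundaries G V act = {\<lambda>g\<in>carrier G. act g v - v | v. v \<in> V}"

definition cocycle_group ::
  "('a, 'b) monoid_scheme \<Rightarrow> 'v::ab_group_add set \<Rightarrow> ('a \<Rightarrow> 'v \<Rightarrow> 'v) \<Rightarrow> ('a \<Rightarrow> 'v) monoid" where
  "cocycle_group G V act =
     \<lparr>carrier = cocycles G V act,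
      monoid.mult = (\<lambda>y z. \<lambda>g\<in>carrier G. y g + z g),
      one = (\<lambda>g\<in>carrier G. 0)\<rparr>"

definition H1 ::
  "('a, 'b) monoid_scheme \<Rightarrow> 'v::ab_group_add set \<Rightarrow> ('a \<Rightarrow> 'v \<Rightarrow> 'v) \<Rightarrow> ('a \<Rightarrow> 'v) set monoid" where
  "H1 G V act = cocycle_group G V act Mod coboundaries G V act"

text \<open>
  For \<open>C\<close> a class in the first cohomology of \<open>G\<close>, all \<open>z \<in> C\<close> have restrictions to \<open>P\<close> in one
  and the same coset, which is therefore the union below.
\<close>

definition H1_restriction ::
  "('a, 'b) monoid_scheme \<Rightarrow> 'v::ab_group_add set \<Rightarrow> ('a \<Rightarrow> 'v \<Rightarrow> 'v) \<Rightarrow>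
   ('a \<Rightarrow> 'v) set \<Rightarrow> ('a \<Rightarrow> 'v) set" where
  "H1_restriction P V act C =
     (\<Union>z\<in>C. coboundaries P V act #>\<^bsub>cocycle_group P V act\<^esub> restrict z (carrier P))"


section \<open>The groups SO(3,1), PGL(4) and PSO(3,1)\<close>

definition lorentz_form :: "real ^ 4 \<Rightarrow> real ^ 4 \<Rightarrow> real" where
  "lorentz_form x y = x $ 1 * y $ 1 + x $ 2 * y $ 2 + x $ 3 * y $ 3 - x $ 4 * y $ 4"

definition SO31 :: "(real ^ 4 ^ 4) set" where
  "SO31 = {A. det A = 1 \<and> (\<forall>x y. lorentz_form (A *v x) (A *v y) = lorentz_form x y)}"

definition SO31_0 :: "(real ^ 4 ^ 4) set" where
  "SO31_0 = connected_component_set SO31 (mat 1)"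

definition GL4 :: "(real ^ 4 ^ 4) monoid" where
  "GL4 = \<lparr>carrier = {A. invertible A}, monoid.mult = (**), one = mat 1\<rparr>"

definition scalars :: "(real ^ 4 ^ 4) set" where
  "scalars = {mat c | c. c \<noteq> 0}"

definition PGL4 :: "(real ^ 4 ^ 4) set monoid" where
  "PGL4 = GL4 Mod scalars"

definition proj :: "real ^ 4 ^ 4 \<Rightarrow> (real ^ 4 ^ 4) set" where
  "proj A = scalars #>\<^bsub>GL4\<^esub> A"

definition PSO31 :: "(real ^ 4 ^ 4) set set" where
  "PSO31 = proj ` SO31_0"

definition sl4 :: "(real ^ 4 ^ 4) set" where
  "sl4 = {X. trace X = 0}"

text \<open>Independence of the representative \<open>A\<close> is \<open>Ad_proj\<close>.\<close>

definition Ad :: "(real ^ 4 ^ 4) set \<Rightarrow> real ^ 4 ^ 4 \<Rightarrow> real ^ 4 ^ 4" where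
  "Ad p X = (let A = (SOME A. A \<in> p) in A ** X ** matrix_inv A)"

lemma proj_eq: "proj A = {c *\<^sub>R A | c. c \<noteq> 0}"
proof -
  have "mat c ** A = c *\<^sub>R A" for c
    by (simp add: vec_eq_iff matrix_matrix_mult_def mat_def if_distrib[of "\<lambda>x. x * _"] sum.delta'
        cong: if_cong)
  then show ?thesis
    by (auto simp: proj_def r_coset_def scalars_def GL4_def)
qed

lemma matrix_inv_eqI:
  fixes A B :: "'a::semiring_1 ^ 'n ^ 'n"
  assumes "A ** B = mat 1" "B ** A = mat 1"
  shows "matrix_inv A = B"
proof -
  have "A ** matrix_inv A = mat 1 \<and> matrix_inv A ** A = mat 1"
    unfolding matrix_inv_def by (rule someI[of _ B]) (simp add: assms)
  then show ?thesis
    by (metis assms(2) matrix_mul_assoc matrix_mul_lid matrix_mul_rid)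
qed

lemma scaleR_matrix_mult: "(c *\<^sub>R A) ** B = c *\<^sub>R (A ** B)"
  for A B :: "real ^ 'n ^ 'n"
  by (simp add: vec_eq_iff matrix_matrix_mult_def sum_distrib_left mult.assoc)

lemma matrix_mult_scaleR: "A ** (c *\<^sub>R B) = c *\<^sub>R (A ** B)"
  for A B :: "real ^ 'n ^ 'n"
  by (simp add: vec_eq_iff matrix_matrix_mult_def sum_distrib_left mult.left_commute)

lemma Ad_proj:
  assumes "invertible A"
  shows "Ad (proj A) X = A ** X ** matrix_inv A"
proof -
  have "(SOME B. B \<in> proj A) \<in> proj A"
    by (rule someI[of _ A]) (auto simp: proj_eq intro!: exI[of _ 1])
  then obtain c where c: "c \<noteq> 0" "(SOME B. B \<in> proj A) = c *\<^sub>R A"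
    by (auto simp: proj_eq)
  obtain A' where A': "A ** A' = mat 1" "A' ** A = mat 1"
    using assms by (auto simp: invertible_def)
  have "matrix_inv A = A'"
    using A' by (rule matrix_inv_eqI)
  moreover have "matrix_inv (c *\<^sub>R A) = (1 / c) *\<^sub>R A'"
    by (rule matrix_inv_eqI) (use c A' in \<open>simp_all add: scaleR_matrix_mult matrix_mult_scaleR\<close>)
  ultimately have "matrix_inv (c *\<^sub>R A) = (1 / c) *\<^sub>R matrix_inv A"
    by simp
  then show ?thesis
    using c by (simp add: Ad_def scaleR_matrix_mult matrix_mult_scaleR)
qed

text \<open>The Kronecker product; the index type \<open>'m \<times> 'n\<close> indexes a basis of the tensor product.\<close>

definition kron :: "'a::times ^ 'm ^ 'm \<Rightarrow> 'a ^ 'n ^ 'n \<Rightarrow> 'a ^ ('m \<times> 'n) ^ ('m \<times> 'n)" where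
  "kron A B = (\<chi> p q. A $ fst p $ fst q * B $ snd p $ snd q)"


section \<open>Once-punctured torus bundles\<close>

datatype fiber_gen = Gen_a | Gen_b

instance fiber_gen :: finite
proof
  have "UNIV = {Gen_a, Gen_b}" using fiber_gen.exhaust by auto
  then show "finite (UNIV :: fiber_gen set)" by (metis finite.emptyI finite_insert)
qed

text \<open>
  The generators of the group of the bundle are \<open>Some Gen_a\<close>, \<open>Some Gen_b\<close> and \<open>None\<close>, the
  last one for the stable letter \<open>x\<close>.
\<close>

abbreviation gen_x :: "fiber_gen option free_group" where
  "gen_x \<equiv> gen None"

definition fiber_incl :: "fiber_gen free_group \<Rightarrow> fiber_gen option free_group" where
  "fiber_incl = free_lift (\<lambda>g. gen (Some g))"

definition exponent_sum :: "'g \<Rightarrow> 'g free_group \<Rightarrow> int" where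
  "exponent_sum g = free_lift (\<lambda>h. if h = g then 1 else 0)"

definition abelianization_matrix ::
  "(fiber_gen free_group \<Rightarrow> fiber_gen free_group) \<Rightarrow> int ^ fiber_gen ^ fiber_gen" where
  "abelianization_matrix \<phi> = (\<chi> i j. exponent_sum i (\<phi> (gen j)))"

text \<open>
  Automorphisms of the fiber group that represent a hyperbolic monodromy in SL(2,Z).
\<close>

definition hyperbolic_monodromy :: "(fiber_gen free_group \<Rightarrow> fiber_gen free_group) \<Rightarrow> bool" where
  "hyperbolic_monodromy \<phi> \<longleftrightarrow>
     \<phi> \<in> iso Free Free \<and>
     det (abelianization_matrix \<phi>) = 1 \<and>
     \<bar>trace (abelianization_matrix \<phi>)\<bar> > 2"

text \<open>The loops around the puncture are the conjugates of the commutator of the generators.\<close>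

definition puncture_loop :: "fiber_gen free_group \<Rightarrow> fiber_gen free_group" where
  "puncture_loop w = w + (gen Gen_a + gen Gen_b - gen Gen_a - gen Gen_b) - w"

definition bundle_relator ::
  "(fiber_gen free_group \<Rightarrow> fiber_gen free_group) \<Rightarrow> fiber_gen \<Rightarrow> fiber_gen option free_group" where
  "bundle_relator \<phi> g = gen_x + gen (Some g) - gen_x - fiber_incl (\<phi> (gen g))"

type_synonym bundle_elem = "fiber_gen option free_group set"

definition bundle_group ::
  "(fiber_gen free_group \<Rightarrow> fiber_gen free_group) \<Rightarrow> bundle_elem monoid" where
  "bundle_group \<phi> = presented_group (bundle_relator \<phi>)"

abbreviation bundle_cls ::
  "(fiber_gen free_group \<Rightarrow> fiber_gen free_group) \<Rightarrow> fiber_gen option free_group \<Rightarrow> bundle_elem" where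
  "bundle_cls \<phi> \<equiv> cls (bundle_relator \<phi>)"

text \<open>
  The stable letter \<open>x\<close> lies on the boundary torus exactly if the monodromy fixes some loop
  \<open>puncture_loop w\<close>, that is, if \<open>x\<close> commutes with it. The fundamental group of the torus is
  then generated by \<open>x\<close> (a meridian) and this loop.
\<close>

definition boundary_group ::
  "(fiber_gen free_group \<Rightarrow> fiber_gen free_group) \<Rightarrow> fiber_gen free_group \<Rightarrow> bundle_elem monoid" where
  "boundary_group \<phi> w =
     subgroup_generated (bundle_group \<phi>)
       {bundle_cls \<phi> gen_x, bundle_cls \<phi> (fiber_incl (puncture_loop w))}"

text \<open>
  The bundle is hyperbolic, and by Mostow-Prasad rigidity the discrete faithful representations
  into PSO(3,1) are, up to conjugation by isometries, the holonomy of its unique complete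
  hyperbolic structure; hence the predicate below. Discreteness refers
  to the topology that PSO(3,1) gets from the isomorphism with the identity component of
  SO(3,1) given by \<open>proj\<close>.
\<close>

definition holonomy ::
  "(fiber_gen free_group \<Rightarrow> fiber_gen free_group) \<Rightarrow> (bundle_elem \<Rightarrow> (real ^ 4 ^ 4) set) \<Rightarrow> bool" where
  "holonomy \<phi> \<rho> \<longleftrightarrow>
     \<rho> \<in> hom (bundle_group \<phi>) PGL4 \<and>
     \<rho> ` carrier (bundle_group \<phi>) \<subseteq> PSO31 \<and>
     inj_on \<rho> (carrier (bundle_group \<phi>)) \<and>
     discrete {A \<in> SO31_0. proj A \<in> \<rho> ` carrier (bundle_group \<phi>)}"

definition fibration_class ::
  "(fiber_gen free_group \<Rightarrow> fiber_gen free_group) \<Rightarrow> (bundle_elem \<Rightarrow> int) \<Rightarrow> bool" where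
  "fibration_class \<phi> \<alpha> \<longleftrightarrow>
     \<alpha> \<in> hom (bundle_group \<phi>) integer_group \<and>
     (\<forall>u. \<alpha> (bundle_cls \<phi> (fiber_incl u)) = 0) \<and>
     \<alpha> (bundle_cls \<phi> gen_x) = 1"

definition lifts_to_SO31 ::
  "(fiber_gen free_group \<Rightarrow> fiber_gen free_group) \<Rightarrow> (bundle_elem \<Rightarrow> (real ^ 4 ^ 4) set) \<Rightarrow>
   (bundle_elem \<Rightarrow> real ^ 4 ^ 4) \<Rightarrow> bool" where
  "lifts_to_SO31 \<phi> \<rho> \<rho>t \<longleftrightarrow>
     \<rho>t \<in> hom (bundle_group \<phi>) (GL4\<lparr>carrier := SO31\<rparr>) \<and>
     (\<forall>g\<in>carrier (bundle_group \<phi>). proj (\<rho>t g) = \<rho> g)"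

text \<open>
  The bundle and its boundary torus are aspherical, so that their twisted first cohomology is
  the group cohomology of their fundamental groups, and the inclusion induces the restriction.
\<close>

definition infinitesimally_projectively_rigid_rel_cusp ::
  "(fiber_gen free_group \<Rightarrow> fiber_gen free_group) \<Rightarrow> fiber_gen free_group \<Rightarrow>
   (bundle_elem \<Rightarrow> (real ^ 4 ^ 4) set) \<Rightarrow> bool" where
  "infinitesimally_projectively_rigid_rel_cusp \<phi> w \<rho> \<longleftrightarrow>
     inj_on (H1_restriction (boundary_group \<phi> w) sl4 (\<lambda>g. Ad (\<rho> g)))
       (carrier (H1 (bundle_group \<phi>) sl4 (\<lambda>g. Ad (\<rho> g))))"

end

theory Submission
  imports Defs
begin

text \<open>
  Let \<open>F\<close> be the fiber group, \<open>x\<close> the meridian, \<open>c\<close> the loop around the puncture fixed by the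
  monodromy and \<open>V\<close> the space of all \<open>4 \<times> 4\<close> matrices with the adjoint action, which the Lorentz
  form identifies with the tensor square of the standard representation.

  The meridian acts on the \<open>32\<close>-dimensional space \<open>Z\<close> of \<open>V\<close>-valued cocycles of the free group \<open>F\<close>,
  and the numerator of the twisted Alexander polynomial is the characteristic polynomial of this
  action, while the denominator has degree at most \<open>16\<close>. So the hypothesis bounds the generalized
  eigenspace \<open>E\<close> of \<open>Z\<close> for the eigenvalue \<open>1\<close> by \<open>dim E \<le> 4 + 16 = 20\<close>.

  By discreteness \<open>x\<close> and \<open>c\<close> are parabolic with independent translations, and only scalars commute with
  the image of \<open>F\<close>. Hence \<open>x\<close> acts unipotently on \<open>V\<close>, the centralizer of \<open>c\<close> in \<open>V\<close>
  has dimension at least \<open>6\<close>, and the kernel \<open>K\<close> of the evaluation \<open>Z \<rightarrow> V\<close> at \<open>c\<close> has dimension at most \<open>17\<close>.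
  A complement of \<open>E\<close> has dimension at least \<open>12\<close> and lies in \<open>K\<close>, so that \<open>dim (E \<inter> K) \<le> 5\<close>;
  but the coboundaries of the centralizer of \<open>c\<close> already span \<open>5\<close> dimensions of \<open>E \<inter> K\<close>. A cocycle of the
  bundle group that vanishes on the boundary torus restricts to an element of \<open>E \<inter> K\<close>, hence to
  a coboundary on \<open>F\<close>, and therefore is a coboundary.
\<close>

section \<open>Determinants and generalized kernels\<close>

text \<open>A complement of \<open>E\<close> lies in \<open>K\<close> because the monodromy fixes
  the loop: evaluation there intertwines the action of the meridian on cocycles with its action on
  \<open>V\<close>, which is unipotent. The bound 17 comes from duality: a functional vanishing on
  all values at the loop is invariant under the fiber group, hence a multiple of the trace, so
  evaluation has rank at least 15 on 32 dimensions. The bound 6 is the centralizer of a unipotent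
  matrix with Jordan blocks 3 and 1; only scalars are lost on passing to coboundaries. Generalized
  eigenspaces are not formed. For \<open>S\<close> the action minus the identity, the range of
  \<open>S^16\<close> serves as the complement and the kernel of \<open>S^8\<close> on
  \<open>K\<close> as \<open>E \<inter> K\<close>; the multiplicity of the eigenvalue bounds the
  kernel of \<open>S^16\<close> through four squarings of the matrix. The given lift may leave the
  identity component, but its signs cancel in the tensor square. Passing between all matrices and
  those of trace zero costs only scalars, on which the adjoint action is trivial.\<close>

lemma det_hom:
  fixes h :: "'a::comm_ring_1 \<Rightarrow> 'b::comm_ring_1"
  assumes add: "\<And>x y. h (x + y) = h x + h y" and mult: "\<And>x y. h (x * y) = h x * h y"
    and one: "h 1 = 1"
  shows "h (det A) = det (\<chi> i j. h (A $ i $ j))"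
proof -
  have zero: "h 0 = 0" using add[of 0 0] by simp
  have minus: "h (- 1) = - 1" using add[of 1 "- 1"] zero one by (simp add: eq_neg_iff_add_eq_0 add.commute)
  have sum: "h (sum f S) = (\<Sum>x\<in>S. h (f x))" for f :: "('c \<Rightarrow> 'c) \<Rightarrow> 'a" and S
    by (induction S rule: infinite_finite_induct) (simp_all add: add zero)
  have prod: "h (prod f S) = (\<Prod>x\<in>S. h (f x))" for f :: "'c \<Rightarrow> 'a" and S
    by (induction S rule: infinite_finite_induct) (simp_all add: mult one)
  have sign: "h (of_int (sign p)) = of_int (sign p)" for p :: "'c \<Rightarrow> 'c"
    using one minus by (simp add: sign_def)
  show ?thesis by (simp add: det_def sum mult prod sign)
qed

text \<open>The orthogonal complement of the kernel inside \<open>S\<close> has the complementary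
  dimension and is mapped isomorphically onto the image.\<close>

lemma rank_nullity:
  fixes f :: "'a::euclidean_space \<Rightarrow> 'b::euclidean_space"
  assumes f: "linear f" and S: "subspace S"
  shows "dim (f ` S) + dim {x \<in> S. f x = 0} = dim S"
proof -
  define K where "K = {x \<in> S. f x = 0}"
  define C where "C = {y \<in> S. \<forall>x\<in>K. orthogonal x y}"
  have K: "subspace K"
    using S f by (auto simp: K_def subspace_def linear_0 linear_add linear_scale)
  have C: "subspace C"
    using S by (auto simp: C_def subspace_def orthogonal_def inner_simps)
  have dim: "dim C + dim K = dim S"
    unfolding C_def by (rule dim_subspace_orthogonal_to_vectors[OF K S]) (auto simp: K_def)
  have inj: "inj_on f C"
  proof (rule inj_onI)
    fix x y assume xy: "x \<in> C" "y \<in> C" "f x = f y"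
    then have "x - y \<in> C" using C by (simp add: subspace_diff)
    moreover have "x - y \<in> K"
      using xy f S by (simp add: K_def C_def subspace_diff linear_diff)
    ultimately have "(x - y) \<bullet> (x - y) = 0" unfolding C_def orthogonal_def by blast
    then show "x = y" by simp
  qed
  have "f ` S \<subseteq> f ` C"
  proof
    fix y assume "y \<in> f ` S"
    then obtain x where x: "x \<in> S" "y = f x" by blast
    obtain a b where ab: "a \<in> span K" "\<And>w. w \<in> span K \<Longrightarrow> orthogonal b w" "x = a + b"
      using orthogonal_subspace_decomp_exists[of K x] by blast
    have a: "a \<in> K" using ab(1) K by (metis span_eq_iff)
    then have "b \<in> S" using ab(3) x S by (metis K_def add_diff_cancel_left' mem_Collect_eq subspace_diff)
    moreover have "orthogonal u b" if "u \<in> K" for u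
      using that ab(2)[of u] by (simp add: span_base orthogonal_commute)
    ultimately have "b \<in> C" by (simp add: C_def)
    moreover have "f b = y" using a ab(3) x f by (simp add: K_def linear_add)
    ultimately show "y \<in> f ` C" by blast
  qed
  then have "f ` S = f ` C" by (auto simp: C_def)
  moreover have "dim (f ` C) = dim C"
    by (rule dim_image_eq[OF f]) (use inj C in \<open>metis span_eq_iff\<close>)
  ultimately show ?thesis using dim by (simp add: K_def)
qed

lemma matrix_diff_rdistrib: "(A - B) ** C = A ** C - B ** C" for A B :: "'a::ring_1 ^ 'n ^ 'm"
  by (simp add: vec_eq_iff matrix_matrix_mult_def sum_subtractf left_diff_distrib)

lemma matrix_diff_ldistrib: "A ** (B - C) = A ** B - A ** C" for A :: "'a::ring_1 ^ 'n ^ 'm"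
  by (simp add: vec_eq_iff matrix_matrix_mult_def sum_subtractf right_diff_distrib)

lemma pcompose_power: "(p ^ n) \<circ>\<^sub>p q = (p \<circ>\<^sub>p q) ^ n"
  by (induction n) (simp_all add: pcompose_mult pcompose_1)

section \<open>Algebraic and geometric multiplicity of the eigenvalue zero\<close>

definition charpoly :: "real ^ 'n ^ 'n \<Rightarrow> real poly" where
  "charpoly M = det (\<chi> i j. [:- M $ i $ j, if i = j then 1 else 0:])"

lemma poly_charpoly: "poly (charpoly M) s = det (mat s - M)"
proof -
  have "poly (charpoly M) s = det (\<chi> i j. poly [:- M $ i $ j, if i = j then 1 else 0:] s)"
    unfolding charpoly_def by (subst det_hom[where h = "\<lambda>p. poly p s"]) simp_all
  also have "(\<chi> i j. poly [:- M $ i $ j, if i = j then 1 else 0:] s) = mat s - M"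
    by (simp add: vec_eq_iff mat_def)
  finally show ?thesis .
qed

lemma order_0_X_power: "Polynomial.order 0 ([:0, 1 :: 'a::idom:] ^ n) = n"
  using order_power_n_n[of "0 :: 'a" n] by simp

lemma order_pcompose_square:
  fixes p :: "real poly"
  assumes "p \<noteq> 0"
  shows "Polynomial.order 0 (p \<circ>\<^sub>p [:0, 0, 1:]) = 2 * Polynomial.order 0 p"
proof -
  obtain q where q: "p = [:0, 1:] ^ Polynomial.order 0 p * q" "\<not> [:0, 1:] dvd q"
    using order_decomp[OF assms, of 0] by auto
  have q0: "poly q 0 \<noteq> 0" using q(2) poly_eq_0_iff_dvd[of q 0] by simp
  have "p \<circ>\<^sub>p [:0, 0, 1:] = [:0, 0, 1:] ^ Polynomial.order 0 p * (q \<circ>\<^sub>p [:0, 0, 1:])"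
    by (subst q(1)) (simp add: pcompose_mult pcompose_power pcompose_pCons)
  also have "[:0, 0, 1::real:] = [:- 0, 1:] ^ 2" by (simp add: power2_eq_square)
  finally have eq: "p \<circ>\<^sub>p [:0, 0, 1:] = [:- 0, 1:] ^ (2 * Polynomial.order 0 p) * (q \<circ>\<^sub>p [:0, 0, 1:])"
    by (simp add: power_mult power2_eq_square)
  have nz: "poly (q \<circ>\<^sub>p [:0, 0, 1:]) 0 \<noteq> 0" using q0 by (simp add: poly_pcompose)
  then have "q \<circ>\<^sub>p [:0, 0, 1:] \<noteq> 0" by auto
  then show ?thesis
    unfolding eq by (subst order_mult) (auto simp: order_0_X_power order_0I nz)
qed

lemma order_pcompose_uminus:
  fixes p :: "real poly"
  assumes "p \<noteq> 0"
  shows "Polynomial.order 0 (p \<circ>\<^sub>p [:0, - 1:]) = Polynomial.order 0 p"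
proof -
  obtain q where q: "p = [:0, 1:] ^ Polynomial.order 0 p * q" "\<not> [:0, 1:] dvd q"
    using order_decomp[OF assms, of 0] by auto
  have q0: "poly q 0 \<noteq> 0" using q(2) poly_eq_0_iff_dvd[of q 0] by simp
  have "p \<circ>\<^sub>p [:0, - 1:] = [:0, - 1:] ^ Polynomial.order 0 p * (q \<circ>\<^sub>p [:0, - 1:])"
    by (subst q(1)) (simp add: pcompose_mult pcompose_power pcompose_pCons)
  also have "[:0, - 1::real:] ^ Polynomial.order 0 p =
      smult ((- 1) ^ Polynomial.order 0 p) ([:0, 1:] ^ Polynomial.order 0 p)"
    by (subst smult_power[symmetric]) simp
  finally have eq: "p \<circ>\<^sub>p [:0, - 1:] = [:- 0, 1:] ^ Polynomial.order 0 p * smult ((- 1) ^ Polynomial.order 0 p) (q \<circ>\<^sub>p [:0, - 1:])"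
    by simp
  have nz: "poly (smult ((- 1) ^ Polynomial.order 0 p) (q \<circ>\<^sub>p [:0, - 1:])) 0 \<noteq> 0"
    using q0 by (simp add: poly_pcompose)
  then have "smult ((- 1) ^ Polynomial.order 0 p) (q \<circ>\<^sub>p [:0, - 1:]) \<noteq> 0" by fastforce
  then show ?thesis
    unfolding eq by (subst order_mult) (use assms in \<open>auto simp: order_0_X_power order_0I nz pcompose_eq_0_iff simp del: poly_smult\<close>)
qed

lemma mat_matrix_mult: "mat c ** A = c *\<^sub>R A" "A ** mat c = c *\<^sub>R A" for A :: "real ^ 'n ^ 'n"
  by (simp_all add: vec_eq_iff matrix_matrix_mult_def mat_def if_distrib[of "\<lambda>x. x * _"]
      if_distrib[of "\<lambda>x. _ * x"] sum.delta sum.delta' cong: if_cong)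

lemma det_uminus: "det (- A) = (- 1) ^ CARD('n) * det A" for A :: "real ^ 'n ^ 'n"
proof -
  have "- A = (\<chi> i. (- 1) *s (A $ i))" by (simp add: vec_eq_iff)
  then have "det (- A) = det (\<chi> i. (- 1) *s (A $ i))" by (rule arg_cong)
  also have "\<dots> = (- 1) ^ CARD('n) * det A" by (subst det_rows_mul) simp
  finally show ?thesis .
qed

text \<open>From \<open>y\<^sup>2 - M\<^sup>2 = (y - M) (y + M)\<close>.\<close>

lemma charpoly_square:
  "charpoly (M ** M) \<circ>\<^sub>p [:0, 0, 1:] =
     smult ((- 1) ^ CARD('n)) (charpoly M * (charpoly M \<circ>\<^sub>p [:0, - 1:]))"
  for M :: "real ^ 'n ^ 'n"
proof (rule poly_ext)
  fix s
  have "mat (s * s) - M ** M = (mat s - M) ** - (mat (- s) - M)"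
    by (simp add: matrix_diff_ldistrib matrix_diff_rdistrib mat_matrix_mult)
      (simp add: vec_eq_iff mat_def algebra_simps)
  then show "poly (charpoly (M ** M) \<circ>\<^sub>p [:0, 0, 1:]) s =
      poly (smult ((- 1) ^ CARD('n)) (charpoly M * (charpoly M \<circ>\<^sub>p [:0, - 1:]))) s"
    by (simp add: poly_pcompose poly_charpoly det_mul det_uminus del: minus_diff_eq)
qed

text \<open>Substituting y^2 doubles the order at zero and substituting -y keeps it, so
  \<open>charpoly_square\<close> has twice the order in question on either side. Repeated squaring
  reaches high powers of \<open>M\<close> without any normal form.\<close>

lemma order_charpoly_square:
  assumes "charpoly M \<noteq> 0"
  shows "charpoly (M ** M) \<noteq> 0" "Polynomial.order 0 (charpoly (M ** M)) = Polynomial.order 0 (charpoly M)"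
proof -
  let ?p = "charpoly M" and ?q = "charpoly (M ** M)"
  have "?p \<circ>\<^sub>p [:0, - 1:] \<noteq> 0" using assms by (simp add: pcompose_eq_0_iff)
  then have nz: "?p * (?p \<circ>\<^sub>p [:0, - 1:]) \<noteq> 0" using assms by simp
  then show q: "?q \<noteq> 0" using charpoly_square[of M] by (metis pcompose_0 power_eq_0_iff smult_eq_0_iff neg_equal_0_iff_equal zero_neq_one)
  have "2 * Polynomial.order 0 ?q = Polynomial.order 0 (?q \<circ>\<^sub>p [:0, 0, 1:])"
    by (simp add: order_pcompose_square[OF q])
  also have "\<dots> = Polynomial.order 0 (?p * (?p \<circ>\<^sub>p [:0, - 1:]))"
    unfolding charpoly_square by (simp add: order_smult)
  also have "\<dots> = 2 * Polynomial.order 0 ?p"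
    by (simp add: order_mult[OF nz] order_pcompose_uminus[OF assms])
  finally show "Polynomial.order 0 ?q = Polynomial.order 0 ?p" by simp
qed

text \<open>In a basis extending one of the kernel, every kernel column of y - M is y times a
  constant column and contributes a factor y to the determinant.\<close>

lemma dim_kernel_le_order:
  fixes M :: "real ^ 'n ^ 'n"
  assumes "charpoly M \<noteq> 0"
  shows "dim {v. M *v v = 0} \<le> Polynomial.order 0 (charpoly M)"
proof -
  let ?K = "{v. M *v v = 0}"
  obtain B where B: "B \<subseteq> ?K" "independent B" "card B = dim ?K"
    using basis_exists[of ?K] by metis
  obtain B' where B': "B \<subseteq> B'" "independent B'" "span B' = UNIV"
    using maximal_independent_subset_extend[OF subset_UNIV B(2)] by (metis top.extremum_unique)
  have finB': "finite B'" using B'(2) by (rule independent_imp_finite)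
  have "card B' = CARD('n)"
    using B'(2,3) by (metis DIM_cart DIM_real dim_UNIV dim_span dim_eq_card_independent mult.right_neutral)
  then obtain f :: "'n \<Rightarrow> real ^ 'n" where f: "bij_betw f UNIV B'"
    using finite_same_card_bij[of "UNIV :: 'n set" B'] finB' by auto
  define Q :: "real ^ 'n ^ 'n" where "Q = (\<chi> i j. f j $ i)"
  have col: "column j Q = f j" for j by (simp add: Q_def column_def vec_eq_iff)
  have "columns Q = B'" using f by (auto simp: columns_def col bij_betw_def)
  then have "det Q \<noteq> 0"
    using B'(3) by (simp add: invertible_det_nz[symmetric] invertible_right_inverse
        matrix_right_invertible_span_columns span_vec_eq)
  define J where "J = {j. f j \<in> B}"
  have cardJ: "card J = card B"
  proof -
    have "bij_betw f J B"
      using f B'(1) by (auto simp: bij_betw_def J_def inj_on_def)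
    then show ?thesis by (rule bij_betw_same_card)
  qed
  let ?x = "[:0, 1 :: real:]"
  \<comment> \<open>This is (y - M) Q with the factor y taken out of the columns in
    \<open>J\<close>.\<close>
  define N where "N = (\<chi> i j. if j \<in> J then [:f j $ i:] else [:- (M *v f j) $ i, f j $ i:])"
  have "charpoly M * [:det Q:] = det (\<chi> i j. (if j \<in> J then ?x else 1) * N $ i $ j)" (is "_ = det ?R")
  proof (rule poly_ext)
    fix s
    have Q: "((mat s - M) ** Q) $ i $ j = s * f j $ i - (M *v f j) $ i" for i j
    proof -
      have "((mat s - M) ** Q) $ i $ j = ((mat s - M) *v f j) $ i"
        by (simp add: matrix_matrix_mult_def matrix_vector_mult_def Q_def)
      then show ?thesis
        by (simp add: matrix_vector_mult_diff_rdistrib mat_def matrix_vector_mult_def if_distrib[of "\<lambda>x. x * _"]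
            sum_subtractf left_diff_distrib sum.delta' cong: if_cong)
    qed
    have z: "M *v f j = 0" if "j \<in> J" for j using that B(1) by (auto simp: J_def)
    have "poly (charpoly M * [:det Q:]) s = det ((mat s - M) ** Q)"
      by (simp add: poly_charpoly det_mul)
    also have "(mat s - M) ** Q = (\<chi> i j. poly (?R $ i $ j) s)"
      by (simp add: vec_eq_iff Q N_def z)
    also have "det \<dots> = poly (det ?R) s"
      by (rule det_hom[symmetric, where h = "\<lambda>p. poly p s"]) simp_all
    finally show "poly (charpoly M * [:det Q:]) s = poly (det ?R) s" .
  qed
  also have "?R = transpose (\<chi> j. (if j \<in> J then ?x else 1) *s (\<chi> i. N $ i $ j))"
    by (simp add: vec_eq_iff transpose_def)
  also have "det \<dots> = ?x ^ card J * det (\<chi> j i. N $ i $ j)"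
    by (simp add: det_transpose det_rows_mul prod.If_cases)
  finally have "[:- 0, 1:] ^ card J dvd charpoly M * [:det Q:]" by simp
  moreover have "charpoly M * [:det Q:] \<noteq> 0" using assms \<open>det Q \<noteq> 0\<close> by simp
  ultimately have "card J \<le> Polynomial.order 0 (charpoly M * [:det Q:])"
    by (metis order_divides)
  also have "\<dots> = Polynomial.order 0 (charpoly M)"
    using \<open>det Q \<noteq> 0\<close> by (simp add: order_smult mult.commute[of "charpoly M"])
  finally show ?thesis using cardJ B(3) by simp
qed

section \<open>Free and presented groups\<close>

lemma free_group_induct [case_names zero pos neg]:
  assumes "P 0" and "\<And>g u. P u \<Longrightarrow> P (gen g + u)" and "\<And>g u. P u \<Longrightarrow> P (- gen g + u)"
  shows "P u"
proof -
  obtain w where u: "u = abs_free_group w" by (metis Quotient_free_group Quotient_abs_rep)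
  have "P (abs_free_group w)"
  proof (induction w)
    case Nil
    then show ?case using assms(1) by (simp add: zero_free_group_def)
  next
    case (Cons a w)
    then show ?case using assms(2,3) by (cases a) (auto simp: abs_free_group_Cons)
  qed
  then show ?thesis by (simp add: u)
qed

lemma additive_group_add:
  fixes h :: "'a::group_add \<Rightarrow> 'b::group_add"
  assumes "\<And>u v. h (u + v) = h u + h v"
  shows "h 0 = 0" "h (- u) = - h u" "h (u - v) = h u - h v"
proof -
  show 0: "h 0 = 0" using assms[of 0 0] by (metis add.right_neutral add_left_cancel)
  show 1: "h (- u) = - h u" for u using assms[of "- u" u] 0 by (simp add: eq_neg_iff_add_eq_0)
  show "h (u - v) = h u - h v" using assms[of u "- v"] 1[of v] by simp
qed

lemmas free_lift_simps = free_lift_add additive_group_add[of "free_lift f" for f, OF free_lift_add]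

lemma inv_Free: "inv\<^bsub>Free\<^esub> u = - u"
proof -
  interpret group Free by (rule group_Free)
  show ?thesis by (rule inv_equality) (auto simp: Free_def)
qed

lemma Free_simps [simp]: "carrier Free = UNIV" "u \<otimes>\<^bsub>Free\<^esub> v = u + v" "\<one>\<^bsub>Free\<^esub> = 0"
  by (simp_all add: Free_def)

lemma normal_normal_closure: "normal_closure Free R \<lhd> Free"
proof -
  interpret group Free by (rule group_Free)
  show ?thesis unfolding normal_closure_def
  proof (rule normal_generateI)
    fix h g :: "'a free_group"
    assume "h \<in> {g \<otimes>\<^bsub>Free\<^esub> r \<otimes>\<^bsub>Free\<^esub> inv\<^bsub>Free\<^esub> g |g r. g \<in> carrier Free \<and> r \<in> R}"
    then obtain k r where "h = k + r + - k" "r \<in> R" by (auto simp: inv_Free)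
    then have "g \<otimes>\<^bsub>Free\<^esub> h \<otimes>\<^bsub>Free\<^esub> inv\<^bsub>Free\<^esub> g = (g + k) + r + - (g + k)"
      by (simp only: inv_Free Free_simps minus_add add.assoc)
    then show "g \<otimes>\<^bsub>Free\<^esub> h \<otimes>\<^bsub>Free\<^esub> inv\<^bsub>Free\<^esub> g \<in>
        {g \<otimes>\<^bsub>Free\<^esub> r \<otimes>\<^bsub>Free\<^esub> inv\<^bsub>Free\<^esub> g |g r. g \<in> carrier Free \<and> r \<in> R}"
      using \<open>r \<in> R\<close> unfolding inv_Free Free_simps by blast
  qed simp
qed

lemma relator_in_normal_closure: "r \<in> R \<Longrightarrow> r \<in> normal_closure Free R"
  unfolding normal_closure_def by (rule generate.incl) (force simp: inv_Free intro: exI[of _ 0])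

text \<open>Serves to tell words apart in a presented group: a nonzero value of such an
  \<open>h\<close> certifies that a word represents a nontrivial element.\<close>

lemma normal_closure_kernel:
  fixes h :: "'g free_group \<Rightarrow> 'h::group_add"
  assumes h: "\<And>u v. h (u + v) = h u + h v" and R: "\<And>r. r \<in> R \<Longrightarrow> h r = 0"
    and u: "u \<in> normal_closure Free R"
  shows "h u = 0"
  using u unfolding normal_closure_def
  by (induction rule: generate.induct)
    (auto simp: inv_Free h R additive_group_add[of h, OF h])

lemma carrier_presented_group: "carrier (presented_group rel) = range (cls rel)"
  by (auto simp: presented_group_def cls_def FactGroup_def RCOSETS_def)

lemma group_presented_group: "group (presented_group rel)"
  unfolding presented_group_def by (rule normal.factorgroup_is_group[OF normal_normal_closure])

lemma cls_in_carrier [simp]: "cls rel u \<in> carrier (presented_group rel)"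
  by (simp add: carrier_presented_group)

lemma cls_mult: "cls rel u \<otimes>\<^bsub>presented_group rel\<^esub> cls rel v = cls rel (u + v)"
  using normal.rcos_sum[OF normal_normal_closure, of u v "range rel"]
  by (simp add: presented_group_def FactGroup_def cls_def)

lemma cls_zero: "cls rel 0 = \<one>\<^bsub>presented_group rel\<^esub>"
  using group_presented_group[of rel] cls_mult[of rel 0 0]
  by (metis add.right_neutral cls_in_carrier group.l_cancel_one)

lemma cls_eq_iff: "cls rel u = cls rel v \<longleftrightarrow> u - v \<in> normal_closure Free (range rel)"
proof -
  interpret N: normal "normal_closure Free (range rel)" Free by (rule normal_normal_closure)
  show ?thesis
    using N.rcos_self[of u, OF _ N.is_subgroup] N.repr_independence[of u _ v, OF _ _ N.is_subgroup]
      N.rcos_module[of v u] N.group_axioms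
    unfolding cls_def by (auto simp: inv_Free)
qed

lemma cls_relator: "cls rel (rel r) = \<one>\<^bsub>presented_group rel\<^esub>"
  unfolding cls_zero[symmetric] cls_eq_iff by (simp add: relator_in_normal_closure)

text \<open>Permutations under composition, written additively, are a target for
  \<open>free_lift\<close>, so that free groups can be tested through their actions on sets.\<close>

typedef 'a bijection = "{f :: 'a \<Rightarrow> 'a. bij f}"
  morphisms apply_bijection Bijection
  by (rule exI[of _ id]) simp

setup_lifting type_definition_bijection

instantiation bijection :: (type) group_add
begin

lift_definition zero_bijection :: "'a bijection" is id by simp

lift_definition plus_bijection :: "'a bijection \<Rightarrow> 'a bijection \<Rightarrow> 'a bijection" is "\<lambda>f g. f \<circ> g"
  by (rule bij_comp)

lift_definition uminus_bijection :: "'a bijection \<Rightarrow> 'a bijection" is "inv_into UNIV"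
  by (rule bij_imp_bij_inv)

definition minus_bijection :: "'a bijection \<Rightarrow> 'a bijection \<Rightarrow> 'a bijection" where
  "minus_bijection f g = f + - g"

instance
proof
  fix f g h :: "'a bijection"
  show "f + g + h = f + (g + h)" by transfer (simp add: comp_assoc)
  show "0 + f = f" by transfer simp
  show "f + 0 = f" by transfer simp
  show "- f + f = 0" by transfer (simp add: bij_is_inj)
  show "f + - g = f - g" by (simp add: minus_bijection_def)
qed

end

lemma apply_bijection_simps [simp]:
  "apply_bijection 0 x = x"
  "apply_bijection (f + g) x = apply_bijection f (apply_bijection g x)"
  by (transfer; simp)+

lemma apply_Bijection: "bij f \<Longrightarrow> apply_bijection (Bijection f) = f"
  by (simp add: Bijection_inverse)

lemma uminus_Bijection:
  assumes "\<And>x. f (g x) = x" "\<And>x. g (f x) = x"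
  shows "- Bijection f = Bijection g"
proof -
  have "bij f" "bij g" using assms by (metis bijI')+
  then have "Bijection f + Bijection g = 0"
    by (intro apply_bijection_inject[THEN iffD1] ext) (simp add: apply_Bijection assms)
  then show ?thesis by (metis minus_unique)
qed

lemma fiber_incl_add: "fiber_incl (u + v) = fiber_incl u + fiber_incl v"
  by (simp add: fiber_incl_def free_lift_add)

lemma fiber_incl_gen [simp]: "fiber_incl (gen g) = gen (Some g)"
  by (simp add: fiber_incl_def)

lemmas fiber_incl_simps = fiber_incl_add additive_group_add[of fiber_incl, OF fiber_incl_add]

text \<open>The bundle group acts on the fiber group, the fiber by left translations and the stable
  letter by \<open>\<phi>\<close>; an element of the fiber is recovered as the image of 0 under its
  translation.\<close>

lemma bundle_fiber_injective:
  assumes \<phi>: "\<phi> \<in> iso Free Free"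
    and eq: "bundle_cls \<phi> (fiber_incl u) = bundle_cls \<phi> (fiber_incl v)"
  shows "u = v"
proof -
  have add: "\<phi> (u + v) = \<phi> u + \<phi> v" for u v using \<phi> by (auto simp: iso_def hom_def)
  have bij: "bij \<phi>" using \<phi> by (simp add: iso_def)
  define f where "f z = (case z of None \<Rightarrow> Bijection \<phi> | Some g \<Rightarrow> Bijection ((+) (gen g)))" for z
  define act where "act = free_lift f"
  have act_add: "act (u + v) = act u + act v" for u v by (simp add: act_def free_lift_add)
  have trans: "bij ((+) w)" for w :: "fiber_gen free_group"
    by (rule bij_betw_byWitness[where f' = "(+) (- w)"]) (auto simp: add.assoc[symmetric])
  have act_gen: "act (gen (Some g)) = Bijection ((+) (gen g))" for g
    by (simp add: act_def f_def)
  have act_x: "act gen_x = Bijection \<phi>" by (simp add: act_def f_def)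
  have fiber: "act (fiber_incl w) = Bijection ((+) w)" for w
  proof (induction w rule: free_group_induct)
    case zero
    have "Bijection ((+) 0) = (0 :: fiber_gen free_group bijection)"
      by (intro apply_bijection_inject[THEN iffD1] ext) (simp add: apply_Bijection trans)
    then show ?case by (simp only: fiber_incl_simps act_def free_lift_simps)
  next
    case (pos g w)
    then show ?case
      by (intro apply_bijection_inject[THEN iffD1] ext,
        simp add: fiber_incl_simps act_add act_gen apply_Bijection trans, simp add: add.assoc)
  next
    case (neg g w)
    have "- Bijection ((+) (gen g)) = Bijection ((+) (- gen g))"
      by (rule uminus_Bijection) (simp_all add: add.assoc[symmetric])
    with neg show ?case
      by (intro apply_bijection_inject[THEN iffD1] ext,
        simp add: fiber_incl_simps act_add additive_group_add[of act, OF act_add] act_gen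
          apply_Bijection trans, simp add: add.assoc)
  qed
  \<comment> \<open>The relator says that translation by a generator followed by
    \<open>\<phi>\<close> is \<open>\<phi>\<close> followed by translation by the image of the
    generator, which is the homomorphism property.\<close>
  have rel: "act (bundle_relator \<phi> g) = 0" for g
  proof -
    have "act (gen_x + gen (Some g)) = act (fiber_incl (\<phi> (gen g)) + gen_x)"
      by (intro apply_bijection_inject[THEN iffD1] ext)
        (simp add: act_add fiber act_gen act_x apply_Bijection trans bij add)
    then show ?thesis
      unfolding bundle_relator_def
      by (simp add: act_add additive_group_add[of act, OF act_add])
  qed
  have "fiber_incl u - fiber_incl v \<in> normal_closure Free (range (bundle_relator \<phi>))"
    using eq by (simp add: cls_eq_iff)
  then have "act (fiber_incl u - fiber_incl v) = 0"
    by (rule normal_closure_kernel[OF act_add, rotated]) (auto simp: rel)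
  then have "Bijection ((+) u) = Bijection ((+) v)"
    by (simp add: additive_group_add[of act, OF act_add] fiber)
  then have "(+) u = (+) v" by (metis apply_Bijection trans)
  then show ?thesis by (metis add.right_neutral)
qed

definition nmul :: "nat \<Rightarrow> 'a::monoid_add \<Rightarrow> 'a" where
  "nmul n u = ((+) u ^^ n) 0"

lemma nmul_simps [simp]: "nmul 0 u = 0" "nmul (Suc n) u = u + nmul n u"
  by (simp_all add: nmul_def)

lemma nmul_hom:
  fixes h :: "'a::group_add \<Rightarrow> 'b::group_add"
  assumes "\<And>u v. h (u + v) = h u + h v"
  shows "h (nmul n u) = nmul n (h u)"
  by (induction n) (simp_all add: assms additive_group_add[of h, OF assms])

lemma nmul_conj: "nmul n (w + u - w) = w + nmul n u - w" for u w :: "'a::group_add"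
  by (induction n) (simp_all add: diff_conv_add_uminus add.assoc del: add_uminus_conv_diff)

text \<open>The commutator has infinite order already in the Heisenberg group, here acting on pairs.\<close>

lemma nmul_commutator_nonzero:
  assumes "n > 0"
  shows "nmul n (gen Gen_a + gen Gen_b - gen Gen_a - gen Gen_b) \<noteq> 0"
proof
  define h :: "fiber_gen free_group \<Rightarrow> (int \<times> int) bijection" where
    "h = free_lift (\<lambda>g. case g of Gen_a \<Rightarrow> Bijection (\<lambda>(x, y). (x, y + x))
      | Gen_b \<Rightarrow> Bijection (\<lambda>(x, y). (x + 1, y)))"
  have h: "h (u + v) = h u + h v" for u v by (simp add: h_def free_lift_add)
  have bij: "bij (\<lambda>(x, y). (x, y + x :: int))" "bij (\<lambda>(x, y). (x + 1 :: int, y :: int))"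
      "bij (\<lambda>(x, y). (x, y - x :: int))" "bij (\<lambda>(x, y). (x - 1 :: int, y :: int))"
    by (rule bij_betw_byWitness[where f' = "\<lambda>(x, y). (x, y - x)"], auto)
       (rule bij_betw_byWitness[where f' = "\<lambda>(x, y). (x - 1, y)"], auto,
        rule bij_betw_byWitness[where f' = "\<lambda>(x, y). (x, y + x)"], auto,
        rule bij_betw_byWitness[where f' = "\<lambda>(x, y). (x + 1, y)"], auto)
  let ?c = "gen Gen_a + gen Gen_b - gen Gen_a - gen Gen_b"
  have "- Bijection (\<lambda>(x, y). (x, y + x :: int)) = Bijection (\<lambda>(x, y). (x, y - x))"
    "- Bijection (\<lambda>(x, y). (x + 1 :: int, y :: int)) = Bijection (\<lambda>(x, y). (x - 1, y))"
    by (rule uminus_Bijection; auto)+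
  then have c: "apply_bijection (h ?c) (x, y) = (x, y + 1)" for x y
    unfolding diff_conv_add_uminus h additive_group_add[of h, OF h]
    by (simp add: h_def apply_Bijection bij)
  have "apply_bijection (nmul n (h ?c)) (0, 0) = (0, int n)"
    by (induction n) (simp_all add: c)
  moreover assume "nmul n ?c = 0"
  then have "nmul n (h ?c) = 0" by (metis nmul_hom[of h, OF h] additive_group_add(1)[of h, OF h])
  ultimately show False using assms by simp
qed

text \<open>The free group of rank two is not metabelian: its image in SL(2,Z), acting on pairs.\<close>

lemma commutators_not_commuting:
  fixes a b :: "fiber_gen free_group"
  defines "a \<equiv> gen Gen_a" and "b \<equiv> gen Gen_b"
  shows "(a + b - a - b) + (- a - b + a + b) \<noteq> (- a - b + a + b) + (a + b - a - b)"
proof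
  define h :: "fiber_gen free_group \<Rightarrow> (int \<times> int) bijection" where
    "h = free_lift (\<lambda>g. case g of Gen_a \<Rightarrow> Bijection (\<lambda>(x, y). (x + y, y))
      | Gen_b \<Rightarrow> Bijection (\<lambda>(x, y). (x, y + x)))"
  have h: "h (u + v) = h u + h v" for u v by (simp add: h_def free_lift_add)
  have bij: "bij (\<lambda>(x, y). (x, y + x :: int))" "bij (\<lambda>(x, y). (x + y :: int, y))"
      "bij (\<lambda>(x, y). (x, y - x :: int))" "bij (\<lambda>(x, y). (x - y :: int, y))"
    by (rule bij_betw_byWitness[where f' = "\<lambda>(x, y). (x, y - x)"], auto)
       (rule bij_betw_byWitness[where f' = "\<lambda>(x, y). (x - y, y)"], auto,
        rule bij_betw_byWitness[where f' = "\<lambda>(x, y). (x, y + x)"], auto,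
        rule bij_betw_byWitness[where f' = "\<lambda>(x, y). (x + y, y)"], auto)
  have minus: "- Bijection (\<lambda>(x, y). (x, y + x :: int)) = Bijection (\<lambda>(x, y). (x, y - x))"
    "- Bijection (\<lambda>(x, y). (x + y :: int, y :: int)) = Bijection (\<lambda>(x, y). (x - y, y))"
    by (rule uminus_Bijection; auto)+
  assume "(a + b - a - b) + (- a - b + a + b) = (- a - b + a + b) + (a + b - a - b)"
  then have "apply_bijection (h ((a + b - a - b) + (- a - b + a + b))) (0, 1) =
      apply_bijection (h ((- a - b + a + b) + (a + b - a - b))) (0, 1)" by simp
  then show False
    unfolding diff_conv_add_uminus h additive_group_add[of h, OF h]
    by (simp add: h_def a_def b_def apply_Bijection bij minus)
qed

section \<open>The Lorentz group\<close>

lemma vector_4 [simp]: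
  "(vector [a, b, c, d] :: 'a::zero ^ 4) $ 1 = a"
  "(vector [a, b, c, d] :: 'a ^ 4) $ 2 = b"
  "(vector [a, b, c, d] :: 'a ^ 4) $ 3 = c"
  "(vector [a, b, c, d] :: 'a ^ 4) $ 4 = d"
  by (simp_all add: vector_def)

lemmas matrix_4_simps = vec_eq_iff forall_4 matrix_matrix_mult_def matrix_vector_mult_def sum_4
  transpose_def mat_def

definition lorentz_matrix :: "real ^ 4 ^ 4" where
  "lorentz_matrix = vector [vector [1, 0, 0, 0], vector [0, 1, 0, 0], vector [0, 0, 1, 0], vector [0, 0, 0, - 1]]"

lemma lorentz_matrix_square: "lorentz_matrix ** lorentz_matrix = mat 1"
  by (simp add: lorentz_matrix_def matrix_4_simps)

lemma lorentz_matrix_transpose: "transpose lorentz_matrix = lorentz_matrix"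
  by (simp add: lorentz_matrix_def matrix_4_simps)

lemma lorentz_form_matrix: "lorentz_form x y = x \<bullet> (lorentz_matrix *v y)"
  by (simp add: lorentz_form_def lorentz_matrix_def inner_vec_def matrix_4_simps)

lemma SO31_iff: "A \<in> SO31 \<longleftrightarrow> det A = 1 \<and> transpose A ** lorentz_matrix ** A = lorentz_matrix"
proof -
  have "(A *v x) \<bullet> z = x \<bullet> (transpose A *v z)" for x z
    by (metis dot_lmul_matrix inner_commute transpose_matrix_vector)
  then have "lorentz_form (A *v x) (A *v y) = x \<bullet> ((transpose A ** lorentz_matrix ** A) *v y)" for x y
    by (simp add: lorentz_form_matrix matrix_vector_mul_assoc[symmetric])
  moreover have "M = N" if "\<And>x y. x \<bullet> (M *v y) = x \<bullet> (N *v y)" for M N :: "real ^ 4 ^ 4"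
    using that by (metis matrix_eq vector_eq_ldot)
  ultimately show ?thesis
    unfolding SO31_def by (auto simp: lorentz_form_matrix)
qed

lemma SO31_inverse:
  assumes "A \<in> SO31"
  shows "lorentz_matrix ** transpose A ** lorentz_matrix ** A = mat 1"
    "A ** (lorentz_matrix ** transpose A ** lorentz_matrix) = mat 1"
proof -
  show 1: "lorentz_matrix ** transpose A ** lorentz_matrix ** A = mat 1"
    using assms arg_cong[of _ _ "(**) lorentz_matrix"]
    by (simp add: SO31_iff lorentz_matrix_square matrix_mul_assoc[symmetric])
  then show "A ** (lorentz_matrix ** transpose A ** lorentz_matrix) = mat 1"
    by (simp add: matrix_left_right_inverse)
qed

lemma SO31_transpose:
  assumes "A \<in> SO31"
  shows "A ** lorentz_matrix ** transpose A = lorentz_matrix"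
proof -
  have "A ** (lorentz_matrix ** transpose A ** lorentz_matrix) ** lorentz_matrix = lorentz_matrix"
    using SO31_inverse(2)[OF assms] by simp
  then show ?thesis by (simp add: matrix_mul_assoc[symmetric] lorentz_matrix_square)
qed

lemma SO31_mult: "A \<in> SO31 \<Longrightarrow> B \<in> SO31 \<Longrightarrow> A ** B \<in> SO31"
  by (simp add: SO31_def det_mul matrix_vector_mul_assoc[symmetric])

lemma SO31_row:
  assumes "A \<in> SO31"
  shows "(A $ 4 $ 1)\<^sup>2 + (A $ 4 $ 2)\<^sup>2 + (A $ 4 $ 3)\<^sup>2 = (A $ 4 $ 4)\<^sup>2 - 1"
  using arg_cong[OF SO31_transpose[OF assms], of "\<lambda>B. B $ 4 $ 4"]
  by (simp add: lorentz_matrix_def matrix_4_simps power2_eq_square)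

lemma SO31_column:
  assumes "A \<in> SO31"
  shows "(A $ 1 $ j)\<^sup>2 + (A $ 2 $ j)\<^sup>2 + (A $ 3 $ j)\<^sup>2 = (A $ 4 $ j)\<^sup>2 + (if j = 4 then - 1 else 1)"
proof -
  have "(transpose A ** lorentz_matrix ** A) $ j $ j = lorentz_matrix $ j $ j"
    using assms by (simp add: SO31_iff)
  then show ?thesis
    using exhaust_4[of j] by (auto simp: lorentz_matrix_def matrix_4_simps power2_eq_square)
qed

text \<open>The normalization of a column bounds its entries by its last one, up to a constant, and
  the normalization of the last row absorbs that constant. So the entry at (4,4) controls the size
  of the whole matrix.\<close>

lemma SO31_entry_le:
  assumes "A \<in> SO31"
  shows "\<bar>A $ i $ j\<bar> \<le> \<bar>A $ 4 $ 4\<bar>"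
proof -
  have 1: "(A $ 4 $ j)\<^sup>2 + (if j = 4 then - 1 else 1) \<le> (A $ 4 $ 4)\<^sup>2"
    using SO31_row[OF assms] exhaust_4[of j] by (auto; smt (verit) zero_le_power2)
  have 4: "(A $ 4 $ j)\<^sup>2 \<le> (A $ 4 $ 4)\<^sup>2"
    using SO31_row[OF assms] exhaust_4[of j] by (auto; smt (verit) zero_le_power2)
  have "(A $ i $ j)\<^sup>2 \<le> (A $ 4 $ 4)\<^sup>2"
    using SO31_column[OF assms, of j] 1 4 exhaust_4[of i] by (auto; smt (verit) zero_le_power2)
  then show ?thesis by (simp add: abs_le_square_iff)
qed

lemma SO31_entry44: "A \<in> SO31 \<Longrightarrow> 1 \<le> \<bar>A $ 4 $ 4\<bar>"
  using SO31_row[of A] abs_square_less_1[of "A $ 4 $ 4"] by (smt (verit) zero_le_power2)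

text \<open>By the Cauchy-Schwarz inequality the spatial terms are dominated by
  \<open>A $ 4 $ 4 * y $ 4\<close>, strictly so because the spatial part of the last row has squared
  length \<open>(A $ 4 $ 4)\<^sup>2 - 1\<close>.\<close>

lemma SO31_future:
  assumes A: "A \<in> SO31" "A $ 4 $ 4 > 0"
    and y: "(y $ 1)\<^sup>2 + (y $ 2)\<^sup>2 + (y $ 3)\<^sup>2 \<le> (y $ 4)\<^sup>2" "y $ 4 > 0"
  shows "(A *v y) $ 4 > 0"
proof -
  let ?s = "A $ 4 $ 1 * y $ 1 + A $ 4 $ 2 * y $ 2 + A $ 4 $ 3 * y $ 3"
  have lagrange: "((a::real)*x + b*y + c*z)\<^sup>2 \<le> (a\<^sup>2 + b\<^sup>2 + c\<^sup>2) * (x\<^sup>2 + y\<^sup>2 + z\<^sup>2)" for a b c x y z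
  proof -
    have "(a\<^sup>2 + b\<^sup>2 + c\<^sup>2) * (x\<^sup>2 + y\<^sup>2 + z\<^sup>2) - (a*x + b*y + c*z)\<^sup>2 =
        (a*y - b*x)\<^sup>2 + (a*z - c*x)\<^sup>2 + (b*z - c*y)\<^sup>2"
      by (simp add: power2_eq_square algebra_simps)
    then show ?thesis by (smt (verit) zero_le_power2)
  qed
  have "?s\<^sup>2 \<le> ((A $ 4 $ 4)\<^sup>2 - 1) * ((y $ 1)\<^sup>2 + (y $ 2)\<^sup>2 + (y $ 3)\<^sup>2)"
    unfolding SO31_row[OF A(1), symmetric] by (rule lagrange)
  also have "\<dots> \<le> ((A $ 4 $ 4)\<^sup>2 - 1) * (y $ 4)\<^sup>2"
    using y(1) SO31_row[OF A(1)] by (intro mult_left_mono) (smt (verit) zero_le_power2)+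
  also have "\<dots> < (A $ 4 $ 4 * y $ 4)\<^sup>2"
    using y(2) by (simp add: power_mult_distrib algebra_simps)
  finally have "\<bar>?s\<bar>\<^sup>2 < (A $ 4 $ 4 * y $ 4)\<^sup>2" by (simp only: power2_abs)
  then have "\<bar>?s\<bar> < A $ 4 $ 4 * y $ 4"
    by (rule power2_less_imp_less) (use A(2) y(2) in simp)
  then show ?thesis by (simp add: matrix_vector_mult_def sum_4)
qed

lemma SO31_mult_44:
  assumes "A \<in> SO31" "A $ 4 $ 4 > 0" "B \<in> SO31" "B $ 4 $ 4 > 0"
  shows "(A ** B) $ 4 $ 4 > 0"
proof -
  have "(A *v column 4 B) $ 4 > 0"
    using SO31_column[OF assms(3), of 4] assms by (intro SO31_future) (simp_all add: column_def)
  then show ?thesis by (simp add: matrix_vector_mult_def matrix_matrix_mult_def column_def)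
qed

lemma mat_1_SO31: "mat 1 \<in> SO31" by (simp add: SO31_def)

text \<open>The entry at (4,4) is continuous and on the whole group avoids the open interval from -1
  to 1, so on the identity component it keeps the sign it has at the identity.\<close>

lemma SO31_0_future:
  assumes "A \<in> SO31_0"
  shows "A \<in> SO31" "A $ 4 $ 4 > 0"
proof -
  show A: "A \<in> SO31"
    using assms connected_component_subset unfolding SO31_0_def by blast
  have conn: "connected ((\<lambda>A. A $ 4 $ 4) ` SO31_0)"
    unfolding SO31_0_def
    by (intro connected_continuous_image continuous_intros connected_connected_component)
  have "1 \<in> (\<lambda>A. A $ 4 $ 4) ` SO31_0"
    by (rule image_eqI[of _ _ "mat 1"]) (auto simp: SO31_0_def mat_1_SO31 mat_def[where k = "1::real", THEN arg_cong, of "\<lambda>A. A $ 4 $ 4"])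
  moreover have "A $ 4 $ 4 \<in> (\<lambda>A. A $ 4 $ 4) ` SO31_0" using assms by blast
  ultimately have "0 \<in> (\<lambda>A. A $ 4 $ 4) ` SO31_0" if "A $ 4 $ 4 \<le> 0"
    using connectedD_interval[OF conn, of "A $ 4 $ 4" 1 0] that by simp
  then show "A $ 4 $ 4 > 0"
    using SO31_entry44 connected_component_subset unfolding SO31_0_def by fastforce
qed

lemma matrix_add_rdistrib: "(A + B) ** C = A ** C + B ** C" for A B :: "'a::semiring_1 ^ 'n ^ 'm"
  by (simp add: vec_eq_iff matrix_matrix_mult_def sum.distrib distrib_right)

lemma norm_matrix_mult_le: "norm (A ** B) \<le> norm A * norm B" for A :: "real ^ 'n ^ 'm" and B :: "real ^ 'k ^ 'n"
proof -
  have e: "((A ** B) $ i $ j)\<^sup>2 \<le> (norm (A $ i))\<^sup>2 * (norm (column j B))\<^sup>2" for i j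
  proof -
    have "(A ** B) $ i $ j = A $ i \<bullet> column j B"
      by (simp add: matrix_matrix_mult_def inner_vec_def column_def)
    then show ?thesis
      by (metis Cauchy_Schwarz_ineq power2_norm_eq_inner)
  qed
  have n: "(norm M)\<^sup>2 = (\<Sum>i\<in>UNIV. \<Sum>j\<in>UNIV. (M $ i $ j)\<^sup>2)" for M :: "real ^ 'a ^ 'b"
    by (simp add: power2_norm_eq_inner inner_vec_def) (simp add: power2_eq_square)
  have c: "(\<Sum>j\<in>UNIV. (norm (column j B))\<^sup>2) = (norm B)\<^sup>2"
    unfolding n by (subst sum.swap) (simp add: power2_norm_eq_inner inner_vec_def column_def, simp add: power2_eq_square)
  have r: "(\<Sum>i\<in>UNIV. (norm (A $ i))\<^sup>2) = (norm A)\<^sup>2"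
    unfolding n by (simp add: power2_norm_eq_inner inner_vec_def) (simp add: power2_eq_square)
  have "(norm (A ** B))\<^sup>2 \<le> (\<Sum>i\<in>UNIV. \<Sum>j\<in>UNIV. (norm (A $ i))\<^sup>2 * (norm (column j B))\<^sup>2)"
    unfolding n by (intro sum_mono e)
  also have "\<dots> = (norm A * norm B)\<^sup>2"
    by (simp add: sum_product[symmetric] c r power_mult_distrib)
  finally show ?thesis by (rule power2_le_imp_le) simp
qed

text \<open>Two nearby elements of \<open>S\<close> differ by an element of \<open>D\<close> near
  the identity, hence coincide; the bound on \<open>S\<close> makes the required closeness
  uniform.\<close>

lemma discrete_bounded_finite:
  assumes D: "D \<subseteq> SO31" "mat 1 isolated_in D"
    and closed: "\<And>A B. A \<in> D \<Longrightarrow> B \<in> D \<Longrightarrow> lorentz_matrix ** transpose A ** lorentz_matrix ** B \<in> D"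
    and S: "S \<subseteq> D" "bounded S"
  shows "finite S"
proof -
  obtain e where e: "e > 0" "\<And>A. A \<in> D \<Longrightarrow> dist (mat 1) A < e \<Longrightarrow> A = mat 1"
    using D(2) unfolding isolated_in_dist_Ex_iff by blast
  obtain b where b: "b > 0" "\<And>A. A \<in> S \<Longrightarrow> norm A \<le> b"
    using S(2) bounded_pos by blast
  let ?J = lorentz_matrix
  \<comment> \<open>A bound for the inverses of the elements of \<open>S\<close>; the summand 1
    makes it positive.\<close>
  define c where "c = norm ?J * b * norm ?J + 1"
  have c: "c > 0" using b(1) by (simp add: c_def add_nonneg_pos)
  have transpose: "norm (transpose A) = norm A" for A :: "real ^ 4 ^ 4"
  proof -
    have "inner (transpose A) (transpose A) = inner A A"
      by (simp add: inner_vec_def transpose_def) (rule sum.swap)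
    then show ?thesis by (simp add: norm_eq_sqrt_inner)
  qed
  have "A = B" if AB: "A \<in> S" "B \<in> S" "dist A B < e / c" for A B
  proof -
    let ?A' = "?J ** transpose A ** ?J"
    have AD: "A \<in> D" "B \<in> D" "A \<in> SO31" using AB S D by auto
    have "norm ?A' \<le> norm (?J ** transpose A) * norm ?J" by (rule norm_matrix_mult_le)
    also have "\<dots> \<le> norm ?J * norm A * norm ?J"
      using norm_matrix_mult_le[of ?J "transpose A"] by (intro mult_right_mono) (simp_all add: transpose)
    also have "\<dots> \<le> norm ?J * b * norm ?J"
      by (intro mult_right_mono mult_left_mono b AB) auto
    finally have nA: "norm ?A' \<le> c" by (simp add: c_def)
    have "mat 1 - ?A' ** B = ?A' ** (A - B)"
      by (simp only: matrix_diff_ldistrib SO31_inverse(1)[OF AD(3)])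
    then have "dist (mat 1) (?A' ** B) \<le> norm ?A' * norm (A - B)"
      by (simp add: dist_norm norm_matrix_mult_le)
    also have "\<dots> \<le> c * norm (A - B)" by (intro mult_right_mono nA) auto
    also have "\<dots> < e" using AB(3) c by (simp add: dist_norm field_simps)
    finally have "?A' ** B = mat 1" using e(2) closed[OF AD(1,2)] by blast
    then have "A ** ?A' ** B = A" by (simp only: matrix_mul_assoc[symmetric] matrix_mul_rid)
    then show "A = B" by (simp only: SO31_inverse(2)[OF AD(3)] matrix_mul_lid)
  qed
  then have "uniform_discrete S" unfolding uniform_discrete_def using e(1) c by (intro exI[of _ "e / c"]) auto
  then show ?thesis using S(2) uniform_discrete_finite_iff by blast
qed

text \<open>On directions in the closed future cone \<open>A\<close> acts as a continuous self-map
  of a ball, hyperbolic space with its sphere at infinity in the projective model, and Brouwer's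
  theorem gives an invariant direction.\<close>

lemma future_eigenvector:
  assumes A: "A \<in> SO31" "A $ 4 $ 4 > 0"
  obtains y l where "y $ 4 = 1" "(y $ 1)\<^sup>2 + (y $ 2)\<^sup>2 + (y $ 3)\<^sup>2 \<le> 1" "l > 0" "A *v y = l *\<^sub>R y"
proof -
  define K where "K = {y :: real ^ 4. y $ 4 = 1 \<and> (y $ 1)\<^sup>2 + (y $ 2)\<^sup>2 + (y $ 3)\<^sup>2 \<le> 1}"
  have K: "K = cball (axis 4 1) 1 \<inter> {y. y $ 4 = 1}"
  proof -
    have "dist (axis 4 1) y = sqrt ((y $ 1)\<^sup>2 + (y $ 2)\<^sup>2 + (y $ 3)\<^sup>2 + (1 - y $ 4)\<^sup>2)" for y :: "real ^ 4"
      by (simp add: dist_vec_def L2_set_def sum_4 axis_def dist_real_def power2_abs)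
    then show ?thesis by (auto simp: K_def)
  qed
  have pos: "(A *v y) $ 4 > 0" if "y \<in> K" for y
    using that by (intro SO31_future[OF A]) (auto simp: K_def)
  define f where "f y = (1 / (A *v y) $ 4) *\<^sub>R (A *v y)" for y
  have "closed {y :: real ^ 4. y $ 4 = 1}" by (intro closed_Collect_eq continuous_intros)
  then have "compact K" unfolding K by (intro compact_Int_closed compact_cball)
  moreover have "convex {y :: real ^ 4. y $ 4 = 1}" by (simp add: convex_def)
  then have "convex K" unfolding K by (intro convex_Int convex_cball)
  moreover have "axis 4 1 \<in> K" by (simp add: K_def axis_def)
  then have "K \<noteq> {}" by blast
  moreover have "continuous_on K f"
  proof -
    have "continuous_on K ((*v) A)" by (simp add: linear_continuous_on)
    then show ?thesis unfolding f_def by (intro continuous_intros) (use pos in force)+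
  qed
  moreover have "f \<in> K \<rightarrow> K"
  proof
    fix y assume y: "y \<in> K"
    have "lorentz_form (A *v y) (A *v y) = lorentz_form y y" using A(1) by (simp add: SO31_def)
    moreover have "lorentz_form y y \<le> 0"
      using y by (simp add: lorentz_form_def K_def power2_eq_square)
    ultimately have "((A *v y) $ 1)\<^sup>2 + ((A *v y) $ 2)\<^sup>2 + ((A *v y) $ 3)\<^sup>2 \<le> ((A *v y) $ 4)\<^sup>2"
      by (simp add: lorentz_form_def power2_eq_square)
    then show "f y \<in> K"
      using pos[OF y] by (simp add: K_def f_def power_divide divide_simps add_divide_distrib[symmetric])
  qed
  ultimately obtain y where y: "y \<in> K" "f y = y" by (rule brouwer)
  have "A *v y = (A *v y) $ 4 *\<^sub>R f y" using pos[OF y(1)] by (simp add: f_def)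
  then show thesis using that[of y "(A *v y) $ 4"] y pos by (simp add: K_def)
qed

text \<open>The image of the time axis has the same pairing with \<open>y\<close> as the axis
  itself. Cauchy-Schwarz turns this into a bound for the entry at (4,4) that depends on
  \<open>y\<close> alone: stabilizers of points of hyperbolic space are bounded.\<close>

lemma timelike_fixed_bound:
  assumes A: "A \<in> SO31" "A $ 4 $ 4 > 0"
    and y: "y $ 4 = 1" "(y $ 1)\<^sup>2 + (y $ 2)\<^sup>2 + (y $ 3)\<^sup>2 = r\<^sup>2" "0 \<le> r" "r < 1" and fixed: "A *v y = y"
  shows "\<bar>A $ i $ j\<bar> \<le> 1 / (1 - r)"
proof -
  let ?s = "A $ 1 $ 4 * y $ 1 + A $ 2 $ 4 * y $ 2 + A $ 3 $ 4 * y $ 3"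
  have "lorentz_form (A *v axis 4 1) (A *v y) = lorentz_form (axis 4 1) y"
    using A(1) by (simp add: SO31_def)
  then have "lorentz_form (A *v axis 4 1) y = lorentz_form (axis 4 1) y" by (simp only: fixed)
  then have s: "?s = A $ 4 $ 4 - 1"
    using y(1) by (simp add: lorentz_form_def matrix_vector_mult_def sum_4 axis_def)
  have "?s\<^sup>2 \<le> ((A $ 1 $ 4)\<^sup>2 + (A $ 2 $ 4)\<^sup>2 + (A $ 3 $ 4)\<^sup>2) * ((y $ 1)\<^sup>2 + (y $ 2)\<^sup>2 + (y $ 3)\<^sup>2)"
  proof -
    have "((A $ 1 $ 4)\<^sup>2 + (A $ 2 $ 4)\<^sup>2 + (A $ 3 $ 4)\<^sup>2) * ((y $ 1)\<^sup>2 + (y $ 2)\<^sup>2 + (y $ 3)\<^sup>2) - ?s\<^sup>2 =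
        (A $ 1 $ 4 * y $ 2 - A $ 2 $ 4 * y $ 1)\<^sup>2 + (A $ 1 $ 4 * y $ 3 - A $ 3 $ 4 * y $ 1)\<^sup>2 +
        (A $ 2 $ 4 * y $ 3 - A $ 3 $ 4 * y $ 2)\<^sup>2"
      by (simp add: power2_eq_square algebra_simps)
    then show ?thesis by (smt (verit) zero_le_power2)
  qed
  also have "\<dots> = ((A $ 4 $ 4)\<^sup>2 - 1) * r\<^sup>2" using SO31_column[OF A(1), of 4] y(2) by simp
  also have "\<dots> \<le> (A $ 4 $ 4 * r)\<^sup>2" by (simp add: power_mult_distrib algebra_simps)
  finally have "?s \<le> A $ 4 $ 4 * r"
    by (rule power2_le_imp_le) (use A(2) y(3) in simp)
  then have "A $ 4 $ 4 * (1 - r) \<le> 1" using s by (simp add: algebra_simps)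
  then have "A $ 4 $ 4 \<le> 1 / (1 - r)" using y(4) by (simp add: field_simps)
  then show ?thesis using SO31_entry_le[OF A(1), of i j] A(2) by simp
qed

text \<open>The Gram matrix of a basis \<open>v, e, f, u\<close> with \<open>v, u\<close> null, \<open>\<langle>v, u\<rangle> = 1\<close>
  and \<open>e, f\<close> orthonormal and orthogonal to both.\<close>

definition null_gram :: "real ^ 4 ^ 4" where
  "null_gram = vector [vector [0, 0, 0, 1], vector [0, 1, 0, 0], vector [0, 0, 1, 0], vector [1, 0, 0, 0]]"

section \<open>Null frames and the stabilizer of a null line\<close>

definition null_frame :: "real ^ 4 ^ 4 \<Rightarrow> bool" where
  "null_frame P \<longleftrightarrow> transpose P ** lorentz_matrix ** P = null_gram"

definition frame_inverse :: "real ^ 4 ^ 4 \<Rightarrow> real ^ 4 ^ 4" where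
  "frame_inverse P = null_gram ** transpose P ** lorentz_matrix"

lemma null_gram_square: "null_gram ** null_gram = mat 1"
  by (simp add: null_gram_def matrix_4_simps)

lemma frame_inverse:
  assumes "null_frame P"
  shows "frame_inverse P ** P = mat 1" "P ** frame_inverse P = mat 1"
proof -
  show "frame_inverse P ** P = mat 1"
    using assms by (simp add: frame_inverse_def null_frame_def null_gram_square matrix_mul_assoc[symmetric])
  then show "P ** frame_inverse P = mat 1" by (simp add: matrix_left_right_inverse)
qed

lemma unit_vector_orthonormal_completion:
  fixes a b c :: real
  assumes "a\<^sup>2 + b\<^sup>2 + c\<^sup>2 = 1"
  obtains e1 e2 e3 f1 f2 f3 where
    "e1\<^sup>2 + e2\<^sup>2 + e3\<^sup>2 = 1" "f1\<^sup>2 + f2\<^sup>2 + f3\<^sup>2 = 1" "e1 * f1 + e2 * f2 + e3 * f3 = 0"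
    "a * e1 + b * e2 + c * e3 = 0" "a * f1 + b * f2 + c * f3 = 0"
proof (cases "a = 0 \<and> b = 0")
  case True
  then show thesis by (intro that[of 1 0 0 0 1 0]) auto
next
  case False
  define s where "s = sqrt (a\<^sup>2 + b\<^sup>2)"
  have "a\<^sup>2 + b\<^sup>2 > 0" using False by (simp add: sum_power2_gt_zero_iff)
  then have s: "s\<^sup>2 = a\<^sup>2 + b\<^sup>2" "s > 0" by (simp_all add: s_def)
  have c: "c\<^sup>2 = 1 - s\<^sup>2" using assms s by simp
  \<comment> \<open>A horizontal unit vector orthogonal to the given one, and the cross product of
    the two.\<close>
  show thesis
  proof (rule that[of "- b / s" "a / s" 0 "a * c / s" "b * c / s" "- s"])
    show "(- b / s)\<^sup>2 + (a / s)\<^sup>2 + 0\<^sup>2 = 1"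
      using s False by (simp add: power_divide add_divide_distrib[symmetric] add.commute[of "b\<^sup>2"])
    have "(a * c / s)\<^sup>2 + (b * c / s)\<^sup>2 = c\<^sup>2 * ((a\<^sup>2 + b\<^sup>2) / s\<^sup>2)"
      using s(2) by (simp add: power2_eq_square field_simps)
    also have "\<dots> = c\<^sup>2" using s(2) by (simp add: s(1)[symmetric])
    finally show "(a * c / s)\<^sup>2 + (b * c / s)\<^sup>2 + (- s)\<^sup>2 = 1" by (simp add: c)
    show "- b / s * (a * c / s) + a / s * (b * c / s) + 0 * - s = 0" by simp
    show "a * (- b / s) + b * (a / s) + c * 0 = 0" by simp
    have "a * (a * c / s) + b * (b * c / s) = c * ((a\<^sup>2 + b\<^sup>2) / s)"
      using s(2) by (simp add: power2_eq_square field_simps)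
    also have "\<dots> = c * s" using s(2) by (simp only: s(1)[symmetric]) (simp add: power2_eq_square)
    finally show "a * (a * c / s) + b * (b * c / s) + c * - s = 0" by simp
  qed
qed

lemma null_frame_exists:
  assumes "v $ 4 = 1" "(v $ 1)\<^sup>2 + (v $ 2)\<^sup>2 + (v $ 3)\<^sup>2 = (1::real)"
  obtains P where "null_frame P" "P *v axis 1 1 = v"
proof -
  obtain e1 e2 e3 f1 f2 f3 where ef:
    "e1\<^sup>2 + e2\<^sup>2 + e3\<^sup>2 = 1" "f1\<^sup>2 + f2\<^sup>2 + f3\<^sup>2 = 1" "e1 * f1 + e2 * f2 + e3 * f3 = 0"
    "v $ 1 * e1 + v $ 2 * e2 + v $ 3 * e3 = 0" "v $ 1 * f1 + v $ 2 * f2 + v $ 3 * f3 = 0"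
    using unit_vector_orthonormal_completion[OF assms(2)] by blast
  then have ef': "f1 * e1 + f2 * e2 + f3 * e3 = 0" "e1 * v $ 1 + e2 * v $ 2 + e3 * v $ 3 = 0"
    "f1 * v $ 1 + f2 * v $ 2 + f3 * v $ 3 = 0"
    by (simp_all add: mult.commute)
  \<comment> \<open>The last column is half the time reflection of \<open>v\<close>: again a null
    vector, and its pairing with \<open>v\<close> is 1/2 + 1/2.\<close>
  define P :: "real ^ 4 ^ 4" where "P = vector [vector [v $ 1, e1, f1, v $ 1 / 2],
    vector [v $ 2, e2, f2, v $ 2 / 2], vector [v $ 3, e3, f3, v $ 3 / 2], vector [1, 0, 0, - 1 / 2]]"
  show thesis
  proof
    show "null_frame P"
      unfolding null_frame_def P_def lorentz_matrix_def null_gram_def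
      using ef ef' assms(2) by (simp add: matrix_4_simps power2_eq_square)
    show "P *v axis 1 1 = v" using assms(1) by (simp add: P_def matrix_4_simps axis_def)
  qed
qed

text \<open>The matrices fixing the null line of the first frame vector: dilation \<open>l\<close>, rotation \<open>z\<close>,
  translation \<open>w\<close>.\<close>

definition par :: "real \<Rightarrow> complex \<Rightarrow> complex \<Rightarrow> real ^ 4 ^ 4" where
  "par l z w = vector
     [vector [l, - l * (Re z * Re w + Im z * Im w), - l * (Re z * Im w - Im z * Re w), - l * ((Re w)\<^sup>2 + (Im w)\<^sup>2) / 2],
      vector [0, Re z, - Im z, Re w],
      vector [0, Im z, Re z, Im w],
      vector [0, 0, 0, 1 / l]]"

text \<open>The law for composing the maps \<zeta> \<mapsto> l (z \<zeta> + w) of the complex plane,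
  the plane at infinity seen from the fixed null line.\<close>

lemma par_mult:
  assumes "l \<noteq> 0" "l' \<noteq> 0" "cmod z = 1"
  shows "par l z w ** par l' z' w' = par (l * l') (z * z') (z * w' + w / of_real l')"
proof -
  define u where "u = w / of_real l'"
  have w: "w = of_real l' * u" using assms(2) by (simp add: u_def)
  have z: "Re z * Re z + Im z * Im z = 1"
    using assms(3) cmod_power2[of z] by (simp add: power2_eq_square)
  show ?thesis
    unfolding u_def[symmetric] unfolding w par_def using assms(1,2)
    by (simp add: matrix_4_simps power2_eq_square) (intro conjI, use z in algebra, use z in algebra, simp add: divide_simps, use z in algebra)
qed

lemma par_inject:
  assumes "par l z w = par l' z' w'"
  shows "l = l'" "z = z'" "w = w'"
  using assms by (auto simp: par_def matrix_4_simps complex_eq_iff)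

lemma par_1: "par 1 1 0 = mat 1"
  by (simp add: par_def matrix_4_simps)

lemma det_4:
  "det (A::'a::comm_ring_1^4^4) =
    A$1$1 * A$2$2 * A$3$3 * A$4$4 +
    A$1$1 * A$2$3 * A$3$4 * A$4$2 +
    A$1$1 * A$2$4 * A$3$2 * A$4$3 +
    A$1$2 * A$2$1 * A$3$4 * A$4$3 +
    A$1$2 * A$2$3 * A$3$1 * A$4$4 +
    A$1$2 * A$2$4 * A$3$3 * A$4$1 +
    A$1$3 * A$2$1 * A$3$2 * A$4$4 +
    A$1$3 * A$2$2 * A$3$4 * A$4$1 +
    A$1$3 * A$2$4 * A$3$1 * A$4$2 +
    A$1$4 * A$2$1 * A$3$3 * A$4$2 +
    A$1$4 * A$2$2 * A$3$1 * A$4$3 +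
    A$1$4 * A$2$3 * A$3$2 * A$4$1 -
    A$1$1 * A$2$2 * A$3$4 * A$4$3 -
    A$1$1 * A$2$3 * A$3$2 * A$4$4 -
    A$1$1 * A$2$4 * A$3$3 * A$4$2 -
    A$1$2 * A$2$1 * A$3$3 * A$4$4 -
    A$1$2 * A$2$3 * A$3$4 * A$4$1 -
    A$1$2 * A$2$4 * A$3$1 * A$4$3 -
    A$1$3 * A$2$1 * A$3$4 * A$4$2 -
    A$1$3 * A$2$2 * A$3$1 * A$4$4 -
    A$1$3 * A$2$4 * A$3$2 * A$4$1 -
    A$1$4 * A$2$1 * A$3$2 * A$4$3 -
    A$1$4 * A$2$2 * A$3$3 * A$4$1 -
    A$1$4 * A$2$3 * A$3$1 * A$4$2"
proof -
  have f1234: "finite {2::4, 3, 4}" "1 \<notin> {2::4, 3, 4}" by auto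
  have f234: "finite {3::4, 4}" "2 \<notin> {3::4, 4}" by auto
  have f34: "finite {4::4}" "3 \<notin> {4::4}" by auto
  show ?thesis
    unfolding det_def UNIV_4
    unfolding sum_over_permutations_insert[OF f1234]
    unfolding sum_over_permutations_insert[OF f234]
    unfolding sum_over_permutations_insert[OF f34]
    unfolding permutes_sing
    by (simp add: sign_swap_id permutation_swap_id permutation_compose sign_compose sign_id swap_id_eq algebra_simps)
qed

text \<open>Once the null line is preserved, the Gram relations of the first column clear the last
  row, those of the middle columns together with the determinant leave a rotation, and those of the
  last column fix the first row.\<close>

lemma stabilizer_par:
  assumes gram: "transpose M ** null_gram ** M = null_gram" and det: "det M = 1"
    and col: "M $ 2 $ 1 = 0" "M $ 3 $ 1 = 0" "M $ 4 $ 1 = 0"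
  obtains z w where "M $ 1 $ 1 \<noteq> 0" "cmod z = 1" "M = par (M $ 1 $ 1) z w"
proof -
  have g: "(transpose M ** null_gram ** M) $ i $ j = null_gram $ i $ j" for i j
    by (simp only: gram)
  have 14: "M $ 1 $ 1 * M $ 4 $ 4 = 1"
    using g[of 1 4] col by (simp add: matrix_4_simps null_gram_def)
  then have l: "M $ 1 $ 1 \<noteq> 0" "M $ 4 $ 4 = 1 / M $ 1 $ 1" by (auto simp: eq_divide_eq mult.commute)
  have 4: "M $ 4 $ 2 = 0" "M $ 4 $ 3 = 0"
    using g[of 1 2] g[of 1 3] col l(1) by (simp_all add: matrix_4_simps null_gram_def)
  define a b p q where "a = M $ 2 $ 2" and "b = M $ 3 $ 2" and "p = M $ 2 $ 4" and "q = M $ 3 $ 4"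
  have ab: "a * a + b * b = 1"
    using g[of 2 2] 4 by (simp add: matrix_4_simps null_gram_def a_def b_def)
  have cd: "a * M $ 2 $ 3 + b * M $ 3 $ 3 = 0"
    using g[of 2 3] 4 by (simp add: matrix_4_simps null_gram_def a_def b_def)
  have "M $ 1 $ 1 * M $ 4 $ 4 * (a * M $ 3 $ 3 - b * M $ 2 $ 3) = 1"
    using det col 4 by (simp add: det_4 a_def b_def algebra_simps)
  \<comment> \<open>Orthogonality alone would allow a reflection of the middle plane; the
    determinant excludes it.\<close>
  then have dt: "a * M $ 3 $ 3 - b * M $ 2 $ 3 = 1" by (simp add: 14)
  have "M $ 3 $ 3 = (a * a + b * b) * M $ 3 $ 3" by (simp add: ab)
  also have "\<dots> = a * (a * M $ 3 $ 3 - b * M $ 2 $ 3) + b * (a * M $ 2 $ 3 + b * M $ 3 $ 3)"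
    by (simp add: algebra_simps)
  finally have 33: "M $ 3 $ 3 = a" by (simp add: dt cd)
  have "M $ 2 $ 3 = (a * a + b * b) * M $ 2 $ 3" by (simp add: ab)
  also have "\<dots> = a * (a * M $ 2 $ 3 + b * M $ 3 $ 3) - b * (a * M $ 3 $ 3 - b * M $ 2 $ 3)"
    by (simp add: algebra_simps)
  finally have 23: "M $ 2 $ 3 = - b" by (simp add: dt cd)
  have "M $ 1 $ 2 * M $ 4 $ 4 + a * p + b * q = 0"
    using g[of 2 4] 4 by (simp add: matrix_4_simps null_gram_def a_def b_def p_def q_def)
  then have 12: "M $ 1 $ 2 = - M $ 1 $ 1 * (a * p + b * q)"
    using l by (simp add: field_simps)
  have "M $ 1 $ 3 * M $ 4 $ 4 - b * p + a * q = 0"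
    using g[of 3 4] 4 by (simp add: matrix_4_simps null_gram_def p_def q_def 23 33)
  then have 13: "M $ 1 $ 3 = - M $ 1 $ 1 * (a * q - b * p)"
    using l by (simp add: field_simps)
  have "2 * (M $ 1 $ 4 * M $ 4 $ 4) + p\<^sup>2 + q\<^sup>2 = 0"
    using g[of 4 4] by (simp add: matrix_4_simps null_gram_def p_def q_def power2_eq_square)
  then have 14: "M $ 1 $ 4 = - M $ 1 $ 1 * (p\<^sup>2 + q\<^sup>2) / 2"
    using l by (simp add: field_simps)
  show thesis
  proof
    show "M $ 1 $ 1 \<noteq> 0" by (rule l)
    show "cmod (Complex a b) = 1" using ab by (simp add: cmod_def power2_eq_square)
    show "M = par (M $ 1 $ 1) (Complex a b) (Complex p q)"
      using col 4 l 12 13 14 23 33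
      by (simp add: par_def vec_eq_iff forall_4 a_def b_def p_def q_def)
  qed
qed

lemma par_gram: "transpose (par 1 1 w) ** null_gram ** par 1 1 w = null_gram"
  by (simp add: par_def null_gram_def matrix_4_simps power2_eq_square)

lemma null_frame_translate: "null_frame P \<Longrightarrow> null_frame (P ** par 1 1 w)"
  using par_gram[of w] by (simp add: null_frame_def matrix_transpose_mul matrix_mul_assoc[symmetric])
    (metis matrix_mul_assoc)

lemma frame_conjugate:
  assumes P: "null_frame P" and A: "A \<in> SO31"
  defines "M \<equiv> frame_inverse P ** A ** P"
  shows "A ** P = P ** M" "transpose M ** null_gram ** M = null_gram" "det M = 1"
proof -
  show AP: "A ** P = P ** M" by (simp add: M_def matrix_mul_assoc frame_inverse[OF P])
  have "transpose M ** null_gram ** M = transpose (P ** M) ** lorentz_matrix ** (P ** M)"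
    using P by (simp add: null_frame_def matrix_transpose_mul matrix_mul_assoc[symmetric])
      (simp add: matrix_mul_assoc)
  also have "\<dots> = transpose P ** (transpose A ** lorentz_matrix ** A) ** P"
    by (simp add: AP[symmetric] matrix_transpose_mul matrix_mul_assoc)
  also have "\<dots> = null_gram" using A P by (simp add: SO31_iff null_frame_def)
  finally show "transpose M ** null_gram ** M = null_gram" .
  have "det (frame_inverse P) * det P = 1"
    using frame_inverse[OF P] by (metis det_I det_mul)
  then show "det M = 1" using A by (simp add: M_def det_mul SO31_iff)
qed

text \<open>The eigenvalue \<open>l\<close> of the split matrix is simple, as the others have
  modulus 1 or 1/l, so \<open>M\<close> preserves its eigenline. Comparing translation parts then
  leaves none in \<open>M\<close>.\<close>

lemma commute_split_par:
  assumes gram: "transpose M ** null_gram ** M = null_gram" and det: "det M = 1"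
    and l: "l > 0" "l \<noteq> 1" "cmod z = 1" and comm: "par l z 0 ** M = M ** par l z 0"
  obtains m z' where "m \<noteq> 0" "cmod z' = 1" "M = par m z' 0"
proof -
  have c: "(par l z 0 ** M) $ i $ j = (M ** par l z 0) $ i $ j" for i j by (simp only: comm)
  have 1: "(Re z - l) * M $ 2 $ 1 = Im z * M $ 3 $ 1" "(Re z - l) * M $ 3 $ 1 = - Im z * M $ 2 $ 1"
    "M $ 4 $ 1 / l = M $ 4 $ 1 * l"
    using c[of 2 1] c[of 3 1] c[of 4 1] by (simp_all add: par_def matrix_4_simps algebra_simps)
  have "z \<noteq> of_real l" using l by auto
  then have "(Re z - l)\<^sup>2 + (Im z)\<^sup>2 \<noteq> 0" by (auto simp: complex_eq_iff sum_power2_eq_zero_iff)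
  moreover have "((Re z - l)\<^sup>2 + (Im z)\<^sup>2) * M $ 2 $ 1 = 0" "((Re z - l)\<^sup>2 + (Im z)\<^sup>2) * M $ 3 $ 1 = 0"
    using 1(1,2) by algebra+
  ultimately have "M $ 2 $ 1 = 0" "M $ 3 $ 1 = 0" by auto
  moreover have "M $ 4 $ 1 = 0"
  proof (rule ccontr)
    assume "M $ 4 $ 1 \<noteq> 0"
    then have "l * l = 1" using 1(3) l(1) by (simp add: field_simps)
    then show False using l(1,2) by (simp add: square_eq_1_iff)
  qed
  ultimately obtain z' w' where *: "M $ 1 $ 1 \<noteq> 0" "cmod z' = 1" "M = par (M $ 1 $ 1) z' w'"
    using stabilizer_par[OF gram det] by metis
  have "par l z 0 ** par (M $ 1 $ 1) z' w' = par (M $ 1 $ 1) z' w' ** par l z 0"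
    using comm *(3) by metis
  then have "z * w' = w' / of_real l"
    using par_mult[of l "M $ 1 $ 1" z 0 z' w'] par_mult[of "M $ 1 $ 1" l z' w' z 0] * l
    by (auto dest: par_inject(3))
  moreover have "z \<noteq> 1 / of_real l"
  proof
    assume "z = 1 / of_real l"
    then have "cmod z = 1 / l" using l(1) by (simp add: norm_divide)
    then show False using l by simp
  qed
  ultimately have "w' = 0" using l(1) by (auto simp: field_simps)
  then show thesis using that * by metis
qed

text \<open>The nilpotent part of the translation makes \<open>M\<close> preserve the same null
  line, and comparing translation parts gives z' = 1/m, of modulus one. The sign of \<open>m\<close>
  stays open; the time orientation settles it where the lemma is applied.\<close>

lemma commute_translation_par:
  assumes gram: "transpose M ** null_gram ** M = null_gram" and det: "det M = 1"
    and w: "w \<noteq> 0" and comm: "par 1 1 w ** M = M ** par 1 1 w"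
  obtains m z' w' where "z' = of_real m" "m = 1 \<or> m = - 1" "M = par m z' w'"
proof -
  have c: "(par 1 1 w ** M) $ i $ j = (M ** par 1 1 w) $ i $ j" for i j by (simp only: comm)
  have 4: "M $ 4 $ 1 = 0"
    using c[of 2 1] c[of 3 1] w by (auto simp: par_def matrix_4_simps complex_eq_iff)
  have "(transpose M ** null_gram ** M) $ 1 $ 1 = null_gram $ 1 $ 1" by (simp only: gram)
  then have "(M $ 2 $ 1)\<^sup>2 + (M $ 3 $ 1)\<^sup>2 = 0"
    using 4 by (simp add: matrix_4_simps null_gram_def power2_eq_square)
  then have "M $ 2 $ 1 = 0" "M $ 3 $ 1 = 0" by (auto simp: sum_power2_eq_zero_iff)
  then obtain z' w' where *: "M $ 1 $ 1 \<noteq> 0" "cmod z' = 1" "M = par (M $ 1 $ 1) z' w'"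
    using stabilizer_par[OF gram det] 4 by metis
  have "par 1 1 w ** par (M $ 1 $ 1) z' w' = par (M $ 1 $ 1) z' w' ** par 1 1 w"
    using comm *(3) by metis
  then have "w / of_real (M $ 1 $ 1) = z' * w"
    using par_mult[of 1 "M $ 1 $ 1" 1 w z' w'] par_mult[of "M $ 1 $ 1" 1 z' w' 1 w] *
    by (auto dest: par_inject(3))
  then have z: "z' = 1 / of_real (M $ 1 $ 1)" using w *(1) by (auto simp: field_simps)
  then have "cmod z' * \<bar>M $ 1 $ 1\<bar> = 1" using *(1) by (simp add: norm_divide)
  then have "\<bar>M $ 1 $ 1\<bar> = 1" using *(2) by simp
  then have m: "M $ 1 $ 1 = 1 \<or> M $ 1 $ 1 = - 1" by linarith
  then have "z' = of_real (M $ 1 $ 1)" using z by auto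
  then show thesis using that m *(3) by metis
qed

section \<open>Commuting isometries in discrete groups\<close>

lemma bounded_entries:
  fixes S :: "(real ^ 'n ^ 'm) set"
  assumes "\<And>A i j. A \<in> S \<Longrightarrow> \<bar>A $ i $ j\<bar> \<le> B"
  shows "bounded S"
proof (rule boundedI)
  fix A assume A: "A \<in> S"
  have "norm A \<le> (\<Sum>i\<in>UNIV. norm (A $ i))" by (simp add: norm_vec_def L2_set_le_sum)
  also have "\<dots> \<le> (\<Sum>i\<in>(UNIV :: 'm set). \<Sum>j\<in>(UNIV :: 'n set). B)"
    using A assms by (intro sum_mono order.trans[OF norm_le_l1_cart]) auto
  finally show "norm A \<le> (\<Sum>i\<in>(UNIV :: 'm set). \<Sum>j\<in>(UNIV :: 'n set). B)" .
qed

lemma matrix_left_cancel: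
  fixes A B :: "real ^ 'k ^ 'n"
  assumes "L ** M = mat 1" "M ** A = M ** B"
  shows "A = B"
  using arg_cong[OF assms(2), of "(**) L"] by (simp add: matrix_mul_assoc assms(1))

lemma bounded_frame:
  assumes P: "null_frame P" and Q: "bounded (range Q)" and F: "\<And>k. F k ** P = P ** Q k"
  shows "bounded (range F)"
proof -
  have "F k = P ** Q k ** frame_inverse P" for k
    using F[of k] by (metis frame_inverse(2)[OF P] matrix_mul_assoc matrix_mul_rid)
  then have "range F = (\<lambda>M. P ** M ** frame_inverse P) ` range Q" by auto
  moreover have "linear (\<lambda>M. P ** M ** frame_inverse P)"
    by (auto intro!: linearI
        simp: matrix_add_ldistrib matrix_add_rdistrib matrix_mult_scaleR scaleR_matrix_mult)
  ultimately show ?thesis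
    using Q bounded_linear_image by (metis linear_conv_bounded_linear)
qed

lemma bounded_split_par:
  assumes "\<And>k. cmod (z k) = 1" "\<And>k. l k \<noteq> 0" "\<And>k. \<bar>ln \<bar>l k\<bar>\<bar> \<le> B"
  shows "bounded (range (\<lambda>k. par (l k) (z k) 0))"
proof (rule bounded_entries)
  fix A i j assume "A \<in> range (\<lambda>k. par (l k) (z k) 0)"
  then obtain k where A: "A = par (l k) (z k) 0" by blast
  have B: "0 \<le> B" using assms(3)[of k] by linarith
  have "\<bar>l k\<bar> = exp (ln \<bar>l k\<bar>)" "\<bar>1 / l k\<bar> = exp (- ln \<bar>l k\<bar>)"
    using assms(2)[of k] by (simp_all add: exp_minus inverse_eq_divide)
  then have "\<bar>l k\<bar> \<le> exp B" "\<bar>1 / l k\<bar> \<le> exp B"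
    using assms(3)[of k] by (metis abs_le_D1 exp_le_cancel_iff) (metis \<open>\<bar>1 / l k\<bar> = exp (- ln \<bar>l k\<bar>)\<close> abs_le_D2 assms(3) exp_le_cancel_iff)
  moreover have "\<bar>Re (z k)\<bar> \<le> exp B" "\<bar>Im (z k)\<bar> \<le> exp B"
    using abs_Re_le_cmod[of "z k"] abs_Im_le_cmod[of "z k"] assms(1)[of k] B one_le_exp_iff[of B] by linarith+
  ultimately show "\<bar>A $ i $ j\<bar> \<le> exp B"
    using exhaust_4[of i] exhaust_4[of j] by (auto simp: A par_def)
qed

lemma bounded_translation_par:
  assumes "\<And>k. cmod (w k) \<le> B"
  shows "bounded (range (\<lambda>k. par 1 1 (w k)))"
proof (rule bounded_entries)
  fix A i j assume "A \<in> range (\<lambda>k. par 1 1 (w k))"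
  then obtain k where A: "A = par 1 1 (w k)" by blast
  have B: "0 \<le> B" using assms[of k] norm_ge_zero[of "w k"] by linarith
  have "(cmod (w k))\<^sup>2 \<le> B\<^sup>2" using assms[of k] by (simp add: power_mono)
  then have "(Re (w k))\<^sup>2 + (Im (w k))\<^sup>2 \<le> B\<^sup>2" by (simp add: cmod_power2)
  then have "\<bar>((Re (w k))\<^sup>2 + (Im (w k))\<^sup>2) / 2\<bar> \<le> 1 + B + B\<^sup>2"
    using B by (simp add: abs_of_nonneg) (smt (verit) sum_power2_ge_zero)
  moreover have "\<bar>Re (w k)\<bar> \<le> 1 + B + B\<^sup>2" "\<bar>Im (w k)\<bar> \<le> 1 + B + B\<^sup>2"
    using abs_Re_le_cmod[of "w k"] abs_Im_le_cmod[of "w k"] assms[of k] zero_le_power2[of B] by linarith+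
  moreover have "1 \<le> 1 + B + B\<^sup>2" "0 \<le> 1 + B + B\<^sup>2" using B by simp_all
  ultimately show "\<bar>A $ i $ j\<bar> \<le> 1 + B + B\<^sup>2"
    using exhaust_4[of i] exhaust_4[of j] by (auto simp: A par_def)
qed

text \<open>Correcting a power of one isometry by an integral power of another leaves only a
  fractional part; this keeps the infinite families below bounded.\<close>

lemma floor_multiple_bounded: "\<bar>(of_int (- \<lfloor>t\<rfloor>) + t) * c\<bar> \<le> \<bar>c :: real\<bar>"
proof -
  have "\<bar>of_int (- \<lfloor>t\<rfloor>) + t\<bar> \<le> 1" by (simp, linarith)
  then show ?thesis by (simp add: abs_mult mult_left_le_one_le)
qed

text \<open>A discrete group generated by two commuting independent isometries of infinite order
  consists of parabolics: otherwise one of the cyclic or rank two families below is infinite and bounded.\<close>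

lemma discrete_rank_two_parabolic:
  fixes F :: "int \<Rightarrow> nat \<Rightarrow> real ^ 4 ^ 4"
  assumes C: "C \<in> SO31" "C $ 4 $ 4 > 0" and X: "X \<in> SO31" "X $ 4 $ 4 > 0" and comm: "C ** X = X ** C"
    and F: "F 0 0 = mat 1" "\<And>m n. F (m + 1) n = C ** F m n" "\<And>n. F 0 (Suc n) = X ** F 0 n"
    and inj: "\<And>m n m' n'. F m n = F m' n' \<Longrightarrow> m = m' \<and> n = n'"
    and discrete: "\<And>S. S \<subseteq> range (case_prod F) \<Longrightarrow> bounded S \<Longrightarrow> finite S"
  obtains P w w' where "null_frame P" "C ** P = P ** par 1 1 w" "X ** P = P ** par 1 1 w'"
    "Im (w' * cnj w) \<noteq> 0"
proof -
  \<comment> \<open>Every contradiction below takes this form: infinitely many distinct exponents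
    with values in a bounded set.\<close>
  have escape: False if "inj (\<lambda>k. f k)" "bounded (range (\<lambda>k. F (fst (f k)) (snd (f k))))"
    for f :: "nat \<Rightarrow> int \<times> nat"
  proof -
    have "finite (range (\<lambda>k. F (fst (f k)) (snd (f k))))"
      by (rule discrete) (use that in auto)
    moreover have "inj (\<lambda>k. F (fst (f k)) (snd (f k)))"
      using that(1) inj by (auto simp: inj_def prod_eq_iff)
    ultimately show False using finite_imageD infinite_UNIV_nat by blast
  qed
  \<comment> \<open>Negative powers of \<open>C\<close> are reached by cancelling \<open>C\<close>
    in the recursion for \<open>F\<close>.\<close>
  have frame_int: "F m n ** P = P ** Q m"
    if Q: "\<And>m. Q (m + 1) = MC ** Q m" and CP: "C ** P = P ** MC" and base: "F 0 n ** P = P ** Q 0"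
    for P MC :: "real ^ 4 ^ 4" and Q m n
  proof (induction m rule: int_induct[where k = 0])
    case base
    show ?case by (rule that(3))
  next
    case (step1 i)
    have "F (i + 1) n ** P = C ** (F i n ** P)" by (simp add: F matrix_mul_assoc)
    also have "\<dots> = P ** MC ** Q i" by (simp add: step1 CP matrix_mul_assoc)
    finally show ?case by (simp add: Q matrix_mul_assoc)
  next
    case (step2 i)
    have "C ** (F (i - 1) n ** P) = F i n ** P" using F(2)[of "i - 1" n] by (simp add: matrix_mul_assoc)
    also have "\<dots> = P ** Q i" by (rule step2)
    also have "\<dots> = C ** (P ** Q (i - 1))"
      using Q[of "i - 1"] by (simp add: matrix_mul_assoc CP)
    finally show ?case by (rule matrix_left_cancel[OF SO31_inverse(1)[OF C(1)]])
  qed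
  have frame_nat: "F 0 n ** P = P ** Q n"
    if Q: "Q 0 = mat 1" "\<And>n. Q (Suc n) = MX ** Q n" and XP: "X ** P = P ** MX" for P MX :: "real ^ 4 ^ 4" and Q n
  proof (induction n)
    case 0
    show ?case by (simp add: F Q)
  next
    case (Suc n)
    have "F 0 (Suc n) ** P = X ** (F 0 n ** P)" by (simp add: F matrix_mul_assoc)
    also have "\<dots> = P ** MX ** Q n" by (simp add: Suc XP matrix_mul_assoc)
    finally show ?case by (simp add: Q matrix_mul_assoc)
  qed
  obtain y l where y: "y $ 4 = 1" "(y $ 1)\<^sup>2 + (y $ 2)\<^sup>2 + (y $ 3)\<^sup>2 \<le> 1" "l > 0" "C *v y = l *\<^sub>R y"
    using future_eigenvector[OF C] by blast
  \<comment> \<open>A timelike eigenvector would be fixed by \<open>C\<close>, so that the powers of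
    \<open>C\<close> would be bounded.\<close>
  have null: "(y $ 1)\<^sup>2 + (y $ 2)\<^sup>2 + (y $ 3)\<^sup>2 = 1"
  proof (rule ccontr)
    assume neq: "(y $ 1)\<^sup>2 + (y $ 2)\<^sup>2 + (y $ 3)\<^sup>2 \<noteq> 1"
    define r where "r = sqrt ((y $ 1)\<^sup>2 + (y $ 2)\<^sup>2 + (y $ 3)\<^sup>2)"
    have r: "(y $ 1)\<^sup>2 + (y $ 2)\<^sup>2 + (y $ 3)\<^sup>2 = r\<^sup>2" "0 \<le> r" "r < 1"
      using neq y(2) by (simp_all add: r_def real_less_lsqrt)
    have "lorentz_form (C *v y) (C *v y) = lorentz_form y y" using C(1) by (simp add: SO31_def)
    then have "l * l * lorentz_form y y = lorentz_form y y"
      by (simp add: y(4) lorentz_form_def algebra_simps)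
    moreover have "lorentz_form y y \<noteq> 0"
      using neq y(1) by (simp add: lorentz_form_def power2_eq_square)
    ultimately have "l * l = 1" by simp
    then have "l = 1" using y(3) by (simp add: square_eq_1_iff)
    then have Cy: "C *v y = y" using y(4) by simp
    have pow: "F (int k) 0 \<in> SO31 \<and> F (int k) 0 $ 4 $ 4 > 0 \<and> F (int k) 0 *v y = y" for k
    proof (induction k)
      case 0
      then show ?case by (simp add: F mat_1_SO31) (simp add: mat_def)
    next
      case (Suc k)
      have "F (int (Suc k)) 0 = C ** F (int k) 0" using F(2)[of "int k" 0] by (simp add: add.commute)
      then show ?case
        using Suc C Cy by (simp add: SO31_mult SO31_mult_44 matrix_vector_mul_assoc[symmetric])
    qed
    have "bounded (range (\<lambda>k. F (int k) 0))"
      by (rule bounded_entries[where B = "1 / (1 - r)"])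
        (use pow timelike_fixed_bound y(1) r in blast)
    then show False using escape[of "\<lambda>k. (int k, 0)"] by (simp add: inj_def)
  qed
  obtain P where P: "null_frame P" "P *v axis 1 1 = y" using null_frame_exists y(1) null by blast
  define MC where "MC = frame_inverse P ** C ** P"
  note MC = frame_conjugate[OF P(1) C(1), folded MC_def]
  have "MC *v axis 1 1 = frame_inverse P *v (C *v (P *v axis 1 1))"
    by (simp add: MC_def matrix_vector_mul_assoc matrix_mul_assoc)
  also have "\<dots> = l *\<^sub>R (frame_inverse P *v (P *v axis 1 1))"
    by (simp only: P(2) y(4) matrix_vector_mult_scaleR)
  also have "\<dots> = l *\<^sub>R axis 1 1" by (simp add: matrix_vector_mul_assoc frame_inverse[OF P(1)])
  finally have col: "MC *v axis 1 1 = l *\<^sub>R axis 1 1" .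
  have "MC $ i $ 1 = (l *\<^sub>R axis 1 1) $ i" for i
    unfolding col[symmetric] by (simp add: matrix_vector_mult_def axis_def if_distrib[of "\<lambda>x. _ * x"] cong: if_cong)
  then have "MC $ 1 $ 1 = l" "MC $ 2 $ 1 = 0" "MC $ 3 $ 1 = 0" "MC $ 4 $ 1 = 0"
    by (simp_all add: axis_def)
  then obtain z w where zw: "cmod z = 1" "MC = par l z w" using stabilizer_par[OF MC(2,3)] by metis
  \<comment> \<open>Otherwise \<open>C\<close> is elliptic or loxodromic, and moving the frame
    removes its translation part. Elliptic powers are bounded, which leaves the loxodromic
    case.\<close>
  have lz: "l = 1 \<and> z = 1"
  proof (rule ccontr)
    assume neq: "\<not> (l = 1 \<and> z = 1)"
    have "z \<noteq> 1 / of_real l"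
    proof
      assume z: "z = 1 / of_real l"
      then have "cmod z = 1 / l" using y(3) by (simp add: norm_divide)
      then have "l = 1" using zw(1) y(3) by simp
      then show False using neq z by simp
    qed
    \<comment> \<open>The fixed point of \<zeta> \<mapsto> l (z \<zeta> + w); moving it to the
      origin conjugates \<open>par l z w\<close> to \<open>par l z 0\<close>.\<close>
    define h where "h = w / (1 / of_real l - z)"
    have h: "z * h + w = h / of_real l"
      using \<open>z \<noteq> 1 / of_real l\<close> y(3) unfolding h_def by (simp add: divide_simps) (simp add: algebra_simps)
    define P' where "P' = P ** par 1 1 h"
    have P': "null_frame P'" unfolding P'_def by (rule null_frame_translate[OF P(1)])
    have "par l z w ** par 1 1 h = par 1 1 h ** par l z 0"
      using y(3) zw(1) h by (simp add: par_mult)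
    moreover have "C ** P' = P ** (par l z w ** par 1 1 h)"
      by (simp add: P'_def matrix_mul_assoc MC(1) zw(2)[symmetric])
    ultimately have CP': "C ** P' = P' ** par l z 0" by (simp only: P'_def matrix_mul_assoc)
    have powC: "par (l powi (m + 1) * c) (z powi (m + 1) * d) 0 = par l z 0 ** par (l powi m * c) (z powi m * d) 0"
      if "c \<noteq> 0" for m c d
    proof -
      have "z \<noteq> 0" using zw(1) by auto
      then show ?thesis
        using y(3) zw(1) that by (simp add: par_mult power_int_add mult.assoc mult.left_commute)
    qed
    have normz: "cmod (z powi m) = 1" for m using zw(1) by (simp add: norm_power_int)
    show False
    proof (cases "l = 1")
      case True
      have "F (int k) 0 ** P' = P' ** par (l powi int k * 1) (z powi int k * 1) 0" for k
        by (rule frame_int[where Q = "\<lambda>m. par (l powi m * 1) (z powi m * 1) 0" and MC = "par l z 0"])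
          (use powC[of 1 _ 1] CP' in \<open>simp_all add: F par_1\<close>)
      moreover have "bounded (range (\<lambda>k. par (l powi int k * 1) (z powi int k * 1) 0))"
        by (rule bounded_split_par[where B = 0]) (use True zw(1) in \<open>simp_all add: norm_power\<close>)
      ultimately have "bounded (range (\<lambda>k. F (int k) 0))" by (rule bounded_frame[OF P', rotated])
      then show False using escape[of "\<lambda>k. (int k, 0)"] by (simp add: inj_def)
    next
      case False
      \<comment> \<open>A loxodromic \<open>C\<close> forces the commuting \<open>X\<close> to
        preserve the same axis, so that only dilations and rotations remain.\<close>
      define MX where "MX = frame_inverse P' ** X ** P'"
      note MX = frame_conjugate[OF P' X(1), folded MX_def]
      have "P' ** (par l z 0 ** MX) = C ** (P' ** MX)" by (simp only: matrix_mul_assoc CP')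
      also have "\<dots> = X ** (C ** P')" by (simp only: matrix_mul_assoc MX(1)[symmetric] comm[symmetric])
      also have "\<dots> = P' ** (MX ** par l z 0)" by (simp only: matrix_mul_assoc CP' MX(1))
      finally have "par l z 0 ** MX = MX ** par l z 0"
        by (rule matrix_left_cancel[OF frame_inverse(1)[OF P']])
      then obtain u z' where u: "u \<noteq> 0" "cmod z' = 1" "MX = par u z' 0"
        using commute_split_par[OF MX(2,3) y(3) False zw(1)] by metis
      have powX: "F 0 n ** P' = P' ** par (u ^ n) (z' ^ n) 0" for n
        by (rule frame_nat[where MX = MX]) (use u MX(1) in \<open>simp_all add: par_1 par_mult\<close>)
      have pow: "F m n ** P' = P' ** par (l powi m * u ^ n) (z powi m * z' ^ n) 0" for m n
        by (rule frame_int[where MC = "par l z 0"])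
          (use powC[of "u ^ n" _ "z' ^ n"] CP' powX u(1) in simp_all)
      \<comment> \<open>The real number of powers of \<open>C\<close> whose dilation equals that of
        the n-th power of \<open>X\<close>; rounding it leaves a bounded dilation.\<close>
      define t where "t n = of_nat n * ln \<bar>u\<bar> / ln l" for n
      have lnp: "ln (l powi m) = of_int m * ln l" for m
        using y(3) powr_real_of_int'[of l m] ln_powr[of l "of_int m"] by simp
      have lnl: "ln l \<noteq> 0" using y(3) False by simp
      have "ln \<bar>l powi (- \<lfloor>t n\<rfloor>) * u ^ n\<bar> = (of_int (- \<lfloor>t n\<rfloor>) + t n) * ln l" for n
      proof -
        have "ln \<bar>l powi (- \<lfloor>t n\<rfloor>) * u ^ n\<bar> = ln (l powi (- \<lfloor>t n\<rfloor>)) + ln (\<bar>u\<bar> ^ n)"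
          using y(3) u(1) by (simp add: abs_mult power_abs ln_mult)
        also have "\<dots> = of_int (- \<lfloor>t n\<rfloor>) * ln l + of_nat n * ln \<bar>u\<bar>"
          using y(3) u(1) by (simp add: ln_realpow lnp del: power_int_minus of_int_minus)
        also have "of_nat n * ln \<bar>u\<bar> = t n * ln l" using lnl by (simp add: t_def)
        finally show ?thesis by (simp add: algebra_simps)
      qed
      then have "bounded (range (\<lambda>n. par (l powi (- \<lfloor>t n\<rfloor>) * u ^ n) (z powi (- \<lfloor>t n\<rfloor>) * z' ^ n) 0))"
        by (intro bounded_split_par[where B = "\<bar>ln l\<bar>"])
          (use y(3) u normz floor_multiple_bounded in \<open>simp_all add: norm_mult norm_power del: of_int_minus power_int_minus\<close>)
      then have "bounded (range (\<lambda>n. F (- \<lfloor>t n\<rfloor>) n))" by (rule bounded_frame[OF P']) (rule pow)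
      then show False using escape[of "\<lambda>n. (- \<lfloor>t n\<rfloor>, n)"] by (simp add: inj_def)
    qed
  qed
  then have CP: "C ** P = P ** par 1 1 w" using MC(1) zw(2) by simp
  have w: "w \<noteq> 0"
  proof
    assume "w = 0"
    then have "C ** (P ** frame_inverse P) = P ** frame_inverse P" using CP by (simp add: par_1 matrix_mul_assoc)
    then have "F (0 + 1) 0 = F 0 0" by (simp only: F frame_inverse[OF P(1)] matrix_mul_rid)
    then show False using inj by fastforce
  qed
  define MX where "MX = frame_inverse P ** X ** P"
  note MX = frame_conjugate[OF P(1) X(1), folded MX_def]
  have "P ** (par 1 1 w ** MX) = C ** (P ** MX)" by (simp only: matrix_mul_assoc CP)
  also have "\<dots> = X ** (C ** P)" by (simp only: matrix_mul_assoc MX(1)[symmetric] comm[symmetric])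
  also have "\<dots> = P ** (MX ** par 1 1 w)" by (simp only: matrix_mul_assoc CP MX(1))
  finally have "par 1 1 w ** MX = MX ** par 1 1 w"
    by (rule matrix_left_cancel[OF frame_inverse(1)[OF P(1)]])
  then obtain u z' w' where u: "z' = of_real u" "u = 1 \<or> u = - 1" "MX = par u z' w'"
    using commute_translation_par[OF MX(2,3) w] by metis
  \<comment> \<open>For u = -1 the matrix \<open>X\<close> would send the future null vector
    \<open>y\<close> to its negative.\<close>
  have "u = 1"
  proof (rule ccontr)
    assume "u \<noteq> 1"
    then have "MX *v axis 1 1 = - axis 1 1"
      using u by (simp add: par_def matrix_vector_mult_def vec_eq_iff forall_4 sum_4 axis_def)
    then have "X *v y = - y"
    proof -
      have "X *v y = X ** P *v axis 1 1" by (simp add: P(2)[symmetric] matrix_vector_mul_assoc)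
      also have "\<dots> = P *v (MX *v axis 1 1)" by (simp add: MX(1) matrix_vector_mul_assoc)
      also have "\<dots> = - y"
        unfolding \<open>MX *v axis 1 1 = - axis 1 1\<close> P(2)[symmetric] by (simp add: vec_eq_iff matrix_vector_mult_def sum_negf)
      finally show ?thesis .
    qed
    moreover have "(X *v y) $ 4 > 0" by (rule SO31_future[OF X]) (use y(1,2) in simp_all)
    ultimately show False using y(1) by simp
  qed
  then have XP: "X ** P = P ** par 1 1 w'" using MX(1) u by simp
  \<comment> \<open>Parallel translations are real multiples of each other, and the same rounding
    produces a bounded infinite family.\<close>
  have "Im (w' * cnj w) \<noteq> 0"
  proof
    assume Im: "Im (w' * cnj w) = 0"
    define s where "s = Re (w' * cnj w) / (cmod w)\<^sup>2"
    have "w' * cnj w = of_real (Re (w' * cnj w))" using Im by (simp add: complex_eq_iff)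
    then have "w' * (w * cnj w) = of_real (Re (w' * cnj w)) * w" by (metis mult.assoc mult.commute)
    then have w's: "w' = of_real s * w"
      using w by (simp add: complex_norm_square[symmetric] s_def field_simps)
    have powX: "F 0 n ** P = P ** par 1 1 (of_nat n * w')" for n
      by (rule frame_nat[where MX = "par 1 1 w'"]) (use XP in \<open>simp_all add: par_1 par_mult algebra_simps\<close>)
    have pow: "F m n ** P = P ** par 1 1 (of_int m * w + of_nat n * w')" for m n
      by (rule frame_int[where MC = "par 1 1 w"]) (use CP powX in \<open>simp_all add: par_mult algebra_simps\<close>)
    define t where "t n = of_nat n * s" for n
    have "cmod (of_int (- \<lfloor>t n\<rfloor>) * w + of_nat n * w') \<le> cmod w" for n
    proof -
      have "of_int (- \<lfloor>t n\<rfloor>) * w + of_nat n * w' = of_real (of_int (- \<lfloor>t n\<rfloor>) + t n) * w"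
        by (simp add: w's t_def algebra_simps)
      then have "cmod (of_int (- \<lfloor>t n\<rfloor>) * w + of_nat n * w') = \<bar>of_int (- \<lfloor>t n\<rfloor>) + t n\<bar> * cmod w"
        by (simp only: norm_mult norm_of_real)
      then show ?thesis
        using floor_multiple_bounded[of "t n" "cmod w"] by (simp only: abs_mult abs_norm_cancel)
    qed
    then have "bounded (range (\<lambda>n. par 1 1 (of_int (- \<lfloor>t n\<rfloor>) * w + of_nat n * w')))"
      by (rule bounded_translation_par)
    then have "bounded (range (\<lambda>n. F (- \<lfloor>t n\<rfloor>) n))" by (rule bounded_frame[OF P(1)]) (rule pow)
    then show False using escape[of "\<lambda>n. (- \<lfloor>t n\<rfloor>, n)"] by (simp add: inj_def)
  qed
  then show thesis using that P(1) CP XP by blast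
qed

section \<open>The commutant of the fiber group\<close>

text \<open>Dilation and rotation define a homomorphism to an abelian group, so commutators become
  translations, which commute; but in the free group there are commutators that do not.\<close>

lemma metabelian_par:
  fixes M :: "fiber_gen free_group \<Rightarrow> real ^ 4 ^ 4"
  assumes hom: "\<And>u v. M (u + v) = M u ** M v" and inj: "inj M"
    and par: "\<And>u. \<exists>l z w. l \<noteq> 0 \<and> cmod z = 1 \<and> M u = par l z w"
  shows False
proof -
  obtain l z w where M: "\<And>u. l u \<noteq> 0" "\<And>u. cmod (z u) = 1" "\<And>u. M u = par (l u) (z u) (w u)"
    using par by metis
  have mult: "par (l (u + v)) (z (u + v)) (w (u + v)) =
      par (l u * l v) (z u * z v) (z u * w v + w u / of_real (l v))" for u v
    using hom[of u v] M by (simp add: par_mult)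
  note lz = par_inject(1,2)[OF mult]
  have z0: "z u \<noteq> 0" for u using M(2)[of u] by auto
  define a b where "a = gen Gen_a" and "b = gen Gen_b"
  define p q where "p = a + b - a - b" and "q = - a - b + a + b"
  have "p + (b + a) = a + b" "(b + a) + q = a + b"
    by (simp_all only: p_def q_def diff_conv_add_uminus add.assoc minus_add_cancel add_minus_cancel
        left_minus right_minus add.right_neutral)
  then have "l p * l (b + a) = l (a + b)" "z p * z (b + a) = z (a + b)"
    "l (b + a) * l q = l (a + b)" "z (b + a) * z q = z (a + b)"
    by (metis lz)+
  moreover have "l (b + a) = l (a + b)" "z (b + a) = z (a + b)" by (simp_all add: lz mult.commute)
  ultimately have "l p = 1" "z p = 1" "l q = 1" "z q = 1" using M(1) z0 by (metis mult_cancel_right1 mult_cancel_left1)+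
  then have "M p = par 1 1 (w p)" "M q = par 1 1 (w q)" using M(3) by simp_all
  then have "M (p + q) = M (q + p)" unfolding hom by (simp add: par_mult add.commute)
  then have "p + q = q + p" using inj by (simp add: inj_eq)
  then show False using commutators_not_commuting by (simp add: p_def q_def a_def b_def)
qed

text \<open>Commuting with the translation at \<open>c\<close> makes the fixed null vector an
  eigenvector of \<open>N\<close>, with the same eigenvalue along its orbit under the fiber group.
  The orbit spans: its orthogonal space is invariant under two independent translations, and the
  fiber group moves the null line.\<close>

lemma commutant_scalar_frame:
  fixes M :: "fiber_gen free_group \<Rightarrow> real ^ 4 ^ 4"
  assumes gram: "\<And>u. transpose (M u) ** null_gram ** M u = null_gram" and det: "\<And>u. det (M u) = 1"
    and hom: "\<And>u v. M (u + v) = M u ** M v" and inj: "inj M"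
    and c: "M c = par 1 1 w" and x: "\<And>u. par 1 1 w' ** M u = M (\<phi> u) ** par 1 1 w'" and surj: "surj \<phi>"
    and indep: "Im (w' * cnj w) \<noteq> 0" and comm: "\<And>u. N ** M u = M u ** N"
  shows "N = mat (N $ 1 $ 1)"
proof -
  define e1 :: "real ^ 4" where "e1 = axis 1 1"
  define form where "form n y = n $ 1 * y $ 4 + n $ 2 * y $ 2 + n $ 3 * y $ 3 + n $ 4 * y $ 1"
    for n y :: "real ^ 4"
  have form: "form (A *v n) (A *v y) = form n y" if "transpose A ** null_gram ** A = null_gram" for A n y
  proof -
    have f: "form n y = n \<bullet> (null_gram *v y)" for n y
      by (simp add: form_def null_gram_def inner_vec_def matrix_4_simps)
    have t: "(A *v n) \<bullet> y = n \<bullet> (transpose A *v y)" for n y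
      by (metis dot_lmul_matrix inner_commute transpose_matrix_vector)
    show ?thesis by (simp add: f t matrix_vector_mul_assoc that matrix_mul_assoc)
  qed
  have M0: "M 0 = mat 1"
  proof -
    have "M 0 ** M 0 = M 0 ** mat 1" using hom[of 0 0] by simp
    moreover have "(null_gram ** transpose (M 0) ** null_gram) ** M 0 = mat 1"
      using gram[of 0] by (simp add: matrix_mul_assoc[symmetric] null_gram_square)
    ultimately show ?thesis by (rule matrix_left_cancel[rotated])
  qed
  \<comment> \<open>If no element moved the null line, the whole fiber group would lie in its
    stabilizer, contradicting \<open>metabelian_par\<close>.\<close>
  obtain u0 where u0: "M u0 $ 4 $ 1 \<noteq> 0"
  proof (rule ccontr)
    assume "\<not> thesis"
    then have 4: "M u $ 4 $ 1 = 0" for u using that by blast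
    have "M u $ 2 $ 1 = 0 \<and> M u $ 3 $ 1 = 0" for u
    proof -
      have "(transpose (M u) ** null_gram ** M u) $ 1 $ 1 = null_gram $ 1 $ 1" by (simp only: gram)
      then have "(M u $ 2 $ 1)\<^sup>2 + (M u $ 3 $ 1)\<^sup>2 = 0"
        using 4[of u] by (simp add: matrix_4_simps null_gram_def power2_eq_square)
      then show ?thesis by (simp add: sum_power2_eq_zero_iff)
    qed
    then have "\<exists>l z w. l \<noteq> 0 \<and> cmod z = 1 \<and> M u = par l z w" for u
      using stabilizer_par[OF gram det, of u] 4 by metis
    then show False using metabelian_par[OF hom inj] by blast
  qed
  have Me1: "(M u *v e1) $ i = M u $ i $ 1" for u i
    by (simp add: e1_def matrix_vector_mult_def axis_def if_distrib[of "\<lambda>x. _ * x"] cong: if_cong)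
  have nondegenerate: "n = 0" if n: "\<And>u. form n (M u *v e1) = 0" for n
  proof (rule ccontr)
    assume "n \<noteq> 0"
    have n4: "n $ 4 = 0" using n[of 0] by (simp add: M0 form_def e1_def axis_def)
    have C: "form (par 1 1 w *v n) (M u *v e1) = 0" for u
    proof -
      have "M u *v e1 = par 1 1 w *v (M (- c + u) *v e1)"
        using hom[of c "- c + u"] by (simp add: c matrix_vector_mul_assoc add.assoc[symmetric])
      then show ?thesis using n by (simp add: form par_gram)
    qed
    \<comment> \<open>The meridian fixes the null vector and normalizes the fiber group, so it
      permutes the orbit; surjectivity of \<open>\<phi>\<close> ensures that every orbit point is
      reached.\<close>
    have X: "form (par 1 1 w' *v n) (M u *v e1) = 0" for u
    proof -
      obtain v where v: "u = \<phi> v" using surj by blast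
      have "par 1 1 w' *v e1 = e1" by (simp add: par_def e1_def vec_eq_iff forall_4 matrix_vector_mult_def sum_4 axis_def)
      then have "M u *v e1 = par 1 1 w' *v (M v *v e1)"
        using x[of v] by (metis v matrix_vector_mul_assoc)
      then show ?thesis using n by (simp add: form par_gram)
    qed
    \<comment> \<open>When \<open>n\<close> is orthogonal to the null vector, a translation changes
      \<open>n\<close> only by a multiple of that vector.\<close>
    have t: "form (par 1 1 s *v n) y = form n y - (Re s * n $ 2 + Im s * n $ 3) * y $ 4" for s y
      using n4 by (simp add: form_def par_def matrix_vector_mult_def sum_4 algebra_simps)
    have 1: "Re w * n $ 2 + Im w * n $ 3 = 0" "Re w' * n $ 2 + Im w' * n $ 3 = 0"
      using C[of u0] X[of u0] u0 by (simp_all add: t n Me1)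
    have "(Im w' * Re w - Re w' * Im w) * n $ 2 = 0" "(Im w' * Re w - Re w' * Im w) * n $ 3 = 0"
      using 1 by algebra+
    moreover have "Im w' * Re w - Re w' * Im w \<noteq> 0" using indep by simp
    ultimately have 23: "n $ 2 = 0" "n $ 3 = 0" by auto
    then have "n $ 1 = 0" using n[of u0] n4 u0 by (simp add: form_def Me1)
    then show False using 23 n4 \<open>n \<noteq> 0\<close> by (simp add: vec_eq_iff forall_4)
  qed
  \<comment> \<open>The last column of the commutation relation is quadratic in the translation.
    Comparing w with 2w isolates the quadratic term, whose coefficient is an entry of the first
    column of \<open>N\<close>.\<close>
  have N1: "N $ 2 $ 1 = 0" "N $ 3 $ 1 = 0" "N $ 4 $ 1 = 0"
  proof -
    have w: "(Re w)\<^sup>2 + (Im w)\<^sup>2 \<noteq> 0" using indep by (auto simp: sum_power2_eq_zero_iff)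
    have "N ** par 1 1 w = par 1 1 w ** N" using comm[of c] by (simp add: c)
    moreover have "par 1 1 (w + w) = par 1 1 w ** par 1 1 w" by (simp add: par_mult)
    moreover have "M (c + c) = par 1 1 w ** par 1 1 w" by (simp add: hom c)
    ultimately have e: "(N ** par 1 1 w) $ i $ 4 = (par 1 1 w ** N) $ i $ 4"
      "(N ** par 1 1 (w + w)) $ i $ 4 = (par 1 1 (w + w) ** N) $ i $ 4" for i
      using comm[of "c + c"] by simp_all
    have k: "t * s = 0" if "l - s * t / 2 = r" "2 * l - 2 * (s * t) = 2 * r" for s t l r :: real
    proof -
      have "s * t = 0" using that by linarith
      then show ?thesis by (simp only: mult.commute)
    qed
    have "((Re w)\<^sup>2 + (Im w)\<^sup>2) * N $ 2 $ 1 = 0"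
      by (rule k[where l = "N $ 2 $ 2 * Re w + N $ 2 $ 3 * Im w" and r = "N $ 4 $ 4 * Re w"])
        (use e[of 2] in \<open>simp_all add: par_def matrix_4_simps power_mult_distrib field_simps\<close>)
    moreover have "((Re w)\<^sup>2 + (Im w)\<^sup>2) * N $ 3 $ 1 = 0"
      by (rule k[where l = "N $ 3 $ 2 * Re w + N $ 3 $ 3 * Im w" and r = "N $ 4 $ 4 * Im w"])
        (use e[of 3] in \<open>simp_all add: par_def matrix_4_simps power_mult_distrib field_simps\<close>)
    moreover have "((Re w)\<^sup>2 + (Im w)\<^sup>2) * N $ 4 $ 1 = 0"
      by (rule k[where l = "N $ 4 $ 2 * Re w + N $ 4 $ 3 * Im w" and r = "0"])
        (use e[of 4] in \<open>simp_all add: par_def matrix_4_simps power_mult_distrib field_simps\<close>)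
    ultimately show "N $ 2 $ 1 = 0" "N $ 3 $ 1 = 0" "N $ 4 $ 1 = 0" using w by auto
  qed
  have "N *v e1 = (N $ 1 $ 1) *\<^sub>R e1"
    using N1 by (simp add: vec_eq_iff forall_4 matrix_vector_mult_def sum_4 e1_def axis_def)
  then have N: "N *v (M u *v e1) = (N $ 1 $ 1) *\<^sub>R (M u *v e1)" for u
    by (simp add: matrix_vector_mul_assoc comm) (simp add: matrix_vector_mul_assoc[symmetric] matrix_vector_mult_scaleR)
  have "N $ i $ j = mat (N $ 1 $ 1) $ i $ j" for i j
  proof -
    let ?r = "\<lambda>j. N $ i $ j - mat (N $ 1 $ 1) $ i $ j"
    have "(\<Sum>j\<in>UNIV. ?r j * y $ j) = (N *v y) $ i - ((N $ 1 $ 1) *\<^sub>R y) $ i" for y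
      by (simp add: left_diff_distrib sum_subtractf matrix_vector_mult_def mat_def if_distrib[of "\<lambda>x. x * _"]
          sum.delta' cong: if_cong)
    then have "(\<Sum>j\<in>UNIV. ?r j * (M u *v e1) $ j) = 0" for u by (simp add: N)
    \<comment> \<open>Swapping the coordinates 1 and 4 turns the dot product into the form.\<close>
    then have "form (vector [?r 4, ?r 2, ?r 3, ?r 1]) (M u *v e1) = 0" for u
      by (simp add: form_def sum_4 algebra_simps)
    then have "vector [?r 4, ?r 2, ?r 3, ?r 1] = (0 :: real ^ 4)" by (rule nondegenerate)
    then have "?r 1 = 0" "?r 2 = 0" "?r 3 = 0" "?r 4 = 0" by (simp_all add: vec_eq_iff forall_4)
    then show ?thesis using exhaust_4[of j] by auto
  qed
  then show ?thesis unfolding vec_eq_iff by blast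
qed

lemma commutant_scalar:
  fixes R :: "fiber_gen free_group \<Rightarrow> real ^ 4 ^ 4"
  assumes P: "null_frame P" and R: "\<And>u. R u \<in> SO31" "\<And>u v. R (u + v) = R u ** R v" "inj R"
    and c: "R c ** P = P ** par 1 1 w" and X: "X ** P = P ** par 1 1 w'"
    and x: "\<And>u. X ** R u = R (\<phi> u) ** X" and surj: "surj \<phi>"
    and indep: "Im (w' * cnj w) \<noteq> 0" and comm: "\<And>u. Y ** R u = R u ** Y"
  shows "\<exists>y. Y = mat y"
proof -
  let ?Q = "frame_inverse P"
  note Q = frame_inverse[OF P]
  define M where "M u = ?Q ** R u ** P" for u
  have PM: "R u ** P = P ** M u" for u using frame_conjugate(1)[OF P R(1)] by (simp add: M_def)
  note cancel = matrix_left_cancel[OF Q(1)]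
  have "?Q ** Y ** P = mat ((?Q ** Y ** P) $ 1 $ 1)"
  proof (rule commutant_scalar_frame[where M = M, OF _ _ _ _ _ _ surj indep])
    show "transpose (M u) ** null_gram ** M u = null_gram" "det (M u) = 1" for u
      unfolding M_def by (rule frame_conjugate(2,3)[OF P R(1)])+
    show "M (u + v) = M u ** M v" for u v
    proof (rule cancel)
      have "P ** M (u + v) = R u ** (R v ** P)" by (simp only: PM[symmetric] R(2) matrix_mul_assoc)
      also have "\<dots> = P ** (M u ** M v)" by (simp only: PM matrix_mul_assoc)
      finally show "P ** M (u + v) = P ** (M u ** M v)" .
    qed
    show "inj M"
    proof (rule injI)
      fix u v assume "M u = M v"
      then have "R u ** P ** ?Q = R v ** P ** ?Q" by (simp add: PM)
      then show "u = v" using R(3) by (simp add: matrix_mul_assoc[symmetric] Q inj_eq)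
    qed
    show "M c = par 1 1 w" by (rule cancel) (simp add: PM[symmetric] c)
    show "par 1 1 w' ** M u = M (\<phi> u) ** par 1 1 w'" for u
    proof (rule cancel)
      have "P ** (par 1 1 w' ** M u) = X ** (P ** M u)" by (simp only: X matrix_mul_assoc)
      also have "\<dots> = R (\<phi> u) ** (X ** P)" by (simp only: PM[symmetric] matrix_mul_assoc x)
      also have "\<dots> = P ** (M (\<phi> u) ** par 1 1 w')" by (simp only: X matrix_mul_assoc PM)
      finally show "P ** (par 1 1 w' ** M u) = P ** (M (\<phi> u) ** par 1 1 w')" .
    qed
    show "(?Q ** Y ** P) ** M u = M u ** (?Q ** Y ** P)" for u
    proof -
      have "(?Q ** Y ** P) ** M u = ?Q ** (Y ** R u) ** P"
        by (simp add: matrix_mul_assoc[symmetric] PM)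
      also have "\<dots> = ?Q ** R u ** (P ** ?Q) ** Y ** P" by (simp add: comm matrix_mul_assoc Q)
      also have "\<dots> = M u ** (?Q ** Y ** P)" by (simp only: M_def matrix_mul_assoc)
      finally show ?thesis .
    qed
  qed
  then obtain y where y: "?Q ** Y ** P = mat y" by blast
  have "(P ** ?Q) ** Y ** (P ** ?Q) = P ** (?Q ** Y ** P) ** ?Q" by (simp only: matrix_mul_assoc)
  then have "Y = P ** mat y ** ?Q" by (simp add: y Q)
  also have "\<dots> = mat y" by (simp add: mat_matrix_mult scaleR_matrix_mult Q)
    (simp add: vec_eq_iff mat_def)
  finally show ?thesis by blast
qed

text \<open>Unipotent matrices with Jordan blocks of sizes 3 and 1 have a centralizer of dimension
  6. In \<open>T\<close>, the parameter \<open>x1\<close> gives the scalars, \<open>x2\<close> the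
  logarithm of the translation, \<open>x3\<close> the corner entry, and \<open>x6\<close> a multiple
  of the projection to the direction across the translation.\<close>

lemma dim_centralizer_translation:
  assumes P: "null_frame P" and C: "C ** P = P ** par 1 1 w" and w: "w \<noteq> 0"
  shows "6 \<le> dim {Z. C ** Z = Z ** C}"
proof -
  define p q where "p = Re w" and "q = Im w"
  have pq: "p \<noteq> 0 \<or> q \<noteq> 0" using w by (auto simp: p_def q_def complex_eq_iff)
  define T :: "real \<times> real \<times> real \<times> real \<times> real \<times> real \<Rightarrow> real ^ 4 ^ 4" where
    "T = (\<lambda>(x1, x2, x3, x4, x5, x6). vector
      [vector [x1, - p * x2 - q * x4, - q * x2 + p * x4, x3],
       vector [0, x1 + q * q * x6, - p * q * x6, p * x2 - q * x5],
       vector [0, - p * q * x6, x1 + p * p * x6, q * x2 + p * x5],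
       vector [0, 0, 0, x1]])"
  let ?Q = "frame_inverse P"
  note Q = frame_inverse[OF P]
  let ?f = "\<lambda>x. P ** T x ** ?Q"
  have T: "linear T"
    by (rule linearI) (auto simp: T_def vec_eq_iff forall_4 algebra_simps)
  have lin: "linear ?f"
    by (rule linearI) (simp_all add: linear_add[OF T] linear_scale[OF T] matrix_add_ldistrib matrix_add_rdistrib
        matrix_mult_scaleR scaleR_matrix_mult)
  have commT: "par 1 1 w ** T x = T x ** par 1 1 w" for x
    by (cases x) (simp add: T_def par_def matrix_4_simps p_def[symmetric] q_def[symmetric], simp add: algebra_simps)
  have sub: "range ?f \<subseteq> {Z. C ** Z = Z ** C}"
  proof clarsimp
    fix x
    have QC: "?Q ** C = par 1 1 w ** ?Q"
    proof -
      have "?Q ** C ** (P ** ?Q) = ?Q ** (C ** P) ** ?Q" by (simp only: matrix_mul_assoc)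
      also have "\<dots> = (?Q ** P) ** par 1 1 w ** ?Q" by (simp only: matrix_mul_assoc C)
      finally show ?thesis by (simp add: Q)
    qed
    have "C ** (P ** T x ** ?Q) = P ** (par 1 1 w ** T x) ** ?Q" by (simp only: matrix_mul_assoc C)
    also have "\<dots> = P ** T x ** (?Q ** C)" by (simp only: commT QC matrix_mul_assoc)
    finally show "C ** (P ** T x ** ?Q) = P ** T x ** ?Q ** C" by (simp only: matrix_mul_assoc)
  qed
  have T0: "x = 0" if "T x = 0" for x
  proof -
    obtain x1 x2 x3 x4 x5 x6 where x: "x = (x1, x2, x3, x4, x5, x6)" by (metis prod_cases6)
    have "x1 = 0" using that by (simp add: x T_def vec_eq_iff forall_4)
    then have 1: "x1 = 0" "x3 = 0" "p * x2 + q * x4 = 0" "p * x4 - q * x2 = 0" "p * x2 - q * x5 = 0" "q * x2 + p * x5 = 0"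
      "q * q * x6 = 0" "p * p * x6 = 0"
      using that by (simp_all add: x T_def vec_eq_iff forall_4)
    have "(p * p + q * q) * x2 = 0" "(p * p + q * q) * x4 = 0" "(p * p + q * q) * x5 = 0"
      using 1 by algebra+
    moreover have "p * p + q * q \<noteq> 0" using pq by (simp add: sum_squares_eq_zero_iff)
    ultimately show ?thesis using 1 pq by (auto simp: x zero_prod_def)
  qed
  have "x = 0" if "?f x = 0" for x
  proof -
    have "(?Q ** P) ** T x ** (?Q ** P) = ?Q ** (P ** T x ** ?Q) ** P" by (simp only: matrix_mul_assoc)
    then show ?thesis using that T0 by (simp add: Q)
  qed
  then have "{x \<in> UNIV. ?f x = 0} = {0}" using linear_0[OF lin] by blast
  then have "dim (range ?f) = 6"
    using rank_nullity[OF lin subspace_UNIV] by simp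
  then show ?thesis using dim_subset[OF sub] by simp
qed

text \<open>The grading of the null frame: the fixed null vector has degree 0, the plane of e and f
  degree 1, the other null vector degree 2. The matrix unit at (i, j) then has degree
  \<open>weight j - weight i\<close>.\<close>

definition weight :: "4 \<Rightarrow> int" where
  "weight i = (if i = 1 then 0 else if i = 4 then 2 else 1)"

definition weight_ge :: "int \<Rightarrow> real ^ 4 ^ 4 \<Rightarrow> bool" where
  "weight_ge d Z \<longleftrightarrow> (\<forall>i j. Z $ i $ j \<noteq> 0 \<longrightarrow> d \<le> weight j - weight i)"

lemma weight_ge_mult:
  assumes "weight_ge d A" "weight_ge e B"
  shows "weight_ge (d + e) (A ** B)"
  unfolding weight_ge_def
proof (intro allI impI)
  fix i j assume "(A ** B) $ i $ j \<noteq> 0"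
  then obtain k where "A $ i $ k * B $ k $ j \<noteq> 0"
    unfolding matrix_matrix_mult_def by (auto elim: sum.not_neutral_contains_not_neutral)
  then have "d \<le> weight k - weight i" "e \<le> weight j - weight k"
    using assms by (auto simp: weight_ge_def)
  then show "d + e \<le> weight j - weight i" by simp
qed

lemma weight_ge_add: "weight_ge d A \<Longrightarrow> weight_ge d B \<Longrightarrow> weight_ge d (A + B)"
  unfolding weight_ge_def by (metis add.right_neutral vector_add_component)

lemma weight_ge_mono: "weight_ge d A \<Longrightarrow> e \<le> d \<Longrightarrow> weight_ge e A"
  unfolding weight_ge_def by force

text \<open>Conjugation by a translation is unipotent, since it raises the weight filtration.\<close>

lemma conjugation_translation_nilpotent:
  "((\<lambda>Z. par 1 1 (- w) ** Z ** par 1 1 w - Z) ^^ 8) Z = 0"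
proof -
  let ?D = "\<lambda>Z. par 1 1 (- w) ** Z ** par 1 1 w - Z"
  have step: "weight_ge (d + 1) (?D Z)" if Z: "weight_ge d Z" for d Z
  proof -
    define N where "N w = par 1 1 w - mat 1" for w
    have N: "weight_ge 1 (N w)" for w
    proof -
      have "N w $ i $ j \<noteq> 0 \<longrightarrow> 1 \<le> weight j - weight i" for i j
        using exhaust_4[of i] exhaust_4[of j] by (auto simp: N_def par_def mat_def weight_def)
      then show ?thesis by (simp add: weight_ge_def)
    qed
    have "?D Z = N (- w) ** Z + Z ** N w + N (- w) ** Z ** N w"
      by (simp add: N_def matrix_diff_ldistrib matrix_diff_rdistrib algebra_simps)
    moreover have "weight_ge (d + 1) (N (- w) ** Z)" "weight_ge (d + 1) (Z ** N w)"
      using weight_ge_mult[OF N Z] weight_ge_mult[OF Z N] by (simp_all add: add.commute)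
    moreover have "weight_ge (d + 1) (N (- w) ** Z ** N w)"
      using weight_ge_mult[OF weight_ge_mult[OF N Z] N] by (rule weight_ge_mono) simp
    ultimately show ?thesis by (simp add: weight_ge_add)
  qed
  \<comment> \<open>Degrees run from -2 to 2, so every power from the fifth on vanishes; 8 is a
    power of two, to fit the repeated squaring of \<open>shift\<close>.\<close>
  have "weight_ge (int k - 2) ((?D ^^ k) Z)" for k
  proof (induction k)
    case 0
    show ?case by (auto simp: weight_ge_def weight_def)
  next
    case (Suc k)
    then show ?case using step[OF Suc] by simp
  qed
  from this[of 8] show ?thesis by (auto simp: weight_ge_def weight_def vec_eq_iff split: if_splits)
qed

section \<open>Fox calculus and rational functions\<close>

definition linear_extension :: "('a \<Rightarrow> 'b::comm_ring_1) \<Rightarrow> ('a \<Rightarrow>\<^sub>0 int) \<Rightarrow> 'b" where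
  "linear_extension f c = (\<Sum>g\<in>Poly_Mapping.keys c. of_int (Poly_Mapping.lookup c g) * f g)"

lemma linear_extension_superset:
  assumes "finite S" "Poly_Mapping.keys c \<subseteq> S"
  shows "linear_extension f c = (\<Sum>g\<in>S. of_int (Poly_Mapping.lookup c g) * f g)"
  unfolding linear_extension_def by (rule sum.mono_neutral_left) (use assms in \<open>auto simp: in_keys_iff\<close>)

lemma linear_extension_add: "linear_extension f (c + d) = linear_extension f c + linear_extension f d"
proof -
  let ?S = "Poly_Mapping.keys c \<union> Poly_Mapping.keys d"
  have "Poly_Mapping.keys (c + d) \<subseteq> ?S" by (rule Poly_Mapping.keys_add)
  then show ?thesis
    by (simp add: linear_extension_superset[of ?S] lookup_add distrib_right sum.distrib)
qed

lemmas linear_extension_simps = linear_extension_add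
  additive_group_add[of "linear_extension f" for f, OF linear_extension_add]

lemma linear_extension_single: "linear_extension f (Poly_Mapping.single g n) = of_int n * f g"
  by (simp add: linear_extension_def keys_single)

lemma linear_extension_sum: "linear_extension f (sum h S) = (\<Sum>x\<in>S. linear_extension f (h x))"
  by (induction S rule: infinite_finite_induct) (simp_all add: linear_extension_simps)

lemma linear_extension_translate:
  "linear_extension f (Poly_Mapping.single u 1 * c) = linear_extension (\<lambda>g. f (u + g)) c"
proof -
  have "c = (\<Sum>k\<in>Poly_Mapping.keys c. Poly_Mapping.single k (Poly_Mapping.lookup c k))"
    by (rule poly_mapping_eqI)
      (simp add: lookup_sum lookup_single when_def in_keys_iff sum.delta' if_distrib cong: if_cong)
  then have "Poly_Mapping.single u 1 * c =
      (\<Sum>k\<in>Poly_Mapping.keys c. Poly_Mapping.single (u + k) (Poly_Mapping.lookup c k))"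
    by (metis (no_types, lifting) mult_1 mult_single sum.cong sum_distrib_left)
  then show ?thesis by (simp add: linear_extension_sum linear_extension_single) (simp add: linear_extension_def)
qed

text \<open>The Fox derivative under the linear extension of \<open>S\<close> to the group ring. For
  a representation \<open>S\<close> it is a derivation twisted by \<open>S\<close>, which turns
  vectors chosen at the generators into cocycles.\<close>

definition fox_matrix :: "('g free_group \<Rightarrow> 'b::comm_ring_1 ^ 'l ^ 'l) \<Rightarrow> 'g \<Rightarrow> 'g free_group \<Rightarrow> 'b ^ 'l ^ 'l" where
  "fox_matrix S j u = (\<chi> a b. linear_extension (\<lambda>g. S g $ a $ b) (fox j u))"

lemma fox_matrix_add:
  fixes S :: "'g free_group \<Rightarrow> 'b::comm_ring_1 ^ 'l ^ 'l"
  assumes "\<And>u v. S (u + v) = S u ** S v"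
  shows "fox_matrix S j (u + v) = fox_matrix S j u + S u ** fox_matrix S j v"
proof -
  have lin: "linear_extension (\<lambda>g. \<Sum>k\<in>UNIV. a k * f k g) c = (\<Sum>k\<in>UNIV. a k * linear_extension (f k) c)"
    for a :: "'l \<Rightarrow> 'b" and f :: "'l \<Rightarrow> 'g free_group \<Rightarrow> 'b" and c
    unfolding linear_extension_def
    by (simp add: sum_distrib_left mult.left_commute) (rule sum.swap)
  show ?thesis
    by (simp add: fox_matrix_def vec_eq_iff fox_add linear_extension_simps linear_extension_translate assms
        matrix_matrix_mult_def lin)
qed

lemma fox_matrix_gen:
  assumes "S 0 = mat 1"
  shows "fox_matrix S j (gen g) = (if g = j then mat 1 else 0)"
proof -
  have "linear_extension (\<lambda>g. S g $ a $ b) 1 = mat 1 $ a $ b" for a b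
    by (simp add: assms[symmetric] single_one[symmetric] linear_extension_single del: single_one)
  then show ?thesis by (simp add: fox_matrix_def vec_eq_iff fox_gen linear_extension_simps)
qed

lemma derivation_unique:
  fixes D E :: "'g free_group \<Rightarrow> 'b::comm_ring_1 ^ 'l ^ 'l"
  assumes D: "\<And>u v. D (u + v) = D u + S u ** D v" and E: "\<And>u v. E (u + v) = E u + S u ** E v"
    and S: "S 0 = mat 1" and gen: "\<And>g. D (gen g) = E (gen g)"
  shows "D u = E u"
proof -
  have 0: "D 0 = 0" "E 0 = 0" using D[of 0 0] E[of 0 0] by (simp_all add: S)
  have neg: "D (- gen g) = E (- gen g)" for g
    using D[of "- gen g" "gen g"] E[of "- gen g" "gen g"] 0 gen[of g]
    by (metis add_right_cancel left_minus)
  show ?thesis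
    by (induction u rule: free_group_induct) (simp_all add: 0 D E gen neg)
qed

section \<open>Rational functions and the multiplicity of the root 1\<close>

definition poly_fract :: "real poly \<Rightarrow> real poly fract" where
  "poly_fract p = Fract p 1"

lemma poly_fract_simps:
  "poly_fract (p + q) = poly_fract p + poly_fract q"
  "poly_fract (p - q) = poly_fract p - poly_fract q"
  "poly_fract (- p) = - poly_fract p"
  "poly_fract (p * q) = poly_fract p * poly_fract q"
  "poly_fract 0 = 0" "poly_fract 1 = 1" "poly_fract [:c:] = const c" "poly_fract [:0, 1:] = tvar"
  by (simp_all add: poly_fract_def const_def tvar_def Zero_fract_def One_fract_def)

lemma poly_fract_eq_iff: "poly_fract p = poly_fract q \<longleftrightarrow> p = q"
  by (simp add: poly_fract_def eq_fract)

lemma poly_fract_power: "poly_fract (p ^ n) = poly_fract p ^ n"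
  by (induction n) (simp_all add: poly_fract_simps)

lemma const_simps: "const 0 = (0 :: real poly fract)" "const 1 = (1 :: real poly fract)"
  "const (a + b) = const a + const b" "const (a * b :: real) = const a * const b"
  by (simp_all add: poly_fract_simps(7)[symmetric] poly_fract_simps(1,4)[symmetric])
    (simp_all add: poly_fract_def Zero_fract_def One_fract_def one_pCons mult.commute)

lemma const_sum: "const (sum f S) = (\<Sum>x\<in>S. const (f x :: real))"
  by (induction S rule: infinite_finite_induct) (simp_all add: const_simps)

lemma degree_det_le:
  fixes A :: "real poly ^ 'n ^ 'n"
  assumes "\<And>i j. degree (A $ i $ j) \<le> 1"
  shows "degree (det A) \<le> CARD('n)"
  unfolding det_def
proof (rule degree_sum_le)
  fix p :: "'n \<Rightarrow> 'n" assume "p \<in> {p. p permutes UNIV}"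
  have "degree (\<Prod>i\<in>UNIV. A $ i $ p i) \<le> (\<Sum>i\<in>(UNIV :: 'n set). 1)"
    using degree_prod_sum_le[of UNIV "\<lambda>i. A $ i $ p i"] sum_mono[of UNIV "\<lambda>i. degree (A $ i $ p i)" "\<lambda>i. 1"] assms
    by (simp add: o_def)
  moreover have "degree (of_int (sign p) * q) \<le> degree q" for q :: "real poly"
    by (simp add: sign_def)
  ultimately show "degree (of_int (sign p) * (\<Prod>i\<in>UNIV. A $ i $ p i)) \<le> CARD('n)"
    by (simp, meson order.trans)
qed (simp add: finite_permutations)

text \<open>Powers of t have neither zero nor pole at 1, so the ambiguity of the twisted Alexander
  polynomial does not affect the multiplicity there.\<close>

lemma tvar_powi_fraction:
  obtains A B where "poly A 1 \<noteq> 0" "poly B 1 \<noteq> 0" "poly_fract B * tvar powi n = poly_fract A"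
proof (cases "n \<ge> 0")
  case True
  then show thesis
    by (intro that[of "[:0, 1:] ^ nat n" 1]) (simp_all add: poly_fract_power poly_fract_simps power_int_def)
next
  case False
  have "tvar \<noteq> (0 :: real poly fract)"
    using poly_fract_eq_iff[of "[:0, 1:]" 0] by (simp add: poly_fract_simps)
  then show thesis
    using False by (intro that[of 1 "[:0, 1:] ^ nat (- n)"])
      (simp_all add: poly_fract_power poly_fract_simps power_int_def power_mult_distrib[symmetric])
qed

text \<open>Clearing denominators leaves a polynomial identity in which only \<open>N\<close>,
  \<open>d\<close> and the given power of t - 1 can vanish at 1.\<close>

lemma order_alexander_numerator:
  fixes N d :: "real poly"
  assumes mult: "root_with_multiplicity \<Delta> 1 m" and d: "poly_fract d \<noteq> 0" and u: "u \<noteq> 0"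
    and \<Delta>: "\<Delta> = const u * tvar powi n * (poly_fract N / poly_fract d)"
  shows "N \<noteq> 0" "Polynomial.order 1 N = m + Polynomial.order 1 d"
proof -
  obtain p q where pq: "poly p 1 \<noteq> 0" "poly q 1 \<noteq> 0" "\<Delta> = Fract ([:- 1, 1:] ^ m * p) q"
    using mult by (auto simp: root_with_multiplicity_def)
  have nz: "r \<noteq> 0" if "poly r 1 \<noteq> 0" for r :: "real poly" using that by auto
  obtain A B where AB: "poly A 1 \<noteq> 0" "poly B 1 \<noteq> 0" "poly_fract B * tvar powi n = poly_fract A"
    by (rule tvar_powi_fraction)
  have "Fract ([:- 1, 1:] ^ m * p) q * poly_fract q = poly_fract ([:- 1, 1:] ^ m * p)"
    using nz[OF pq(2)] by (simp add: poly_fract_def eq_fract)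
  then have "poly_fract B * \<Delta> * poly_fract q * poly_fract d = poly_fract (B * ([:- 1, 1:] ^ m * p) * d)"
    by (simp add: pq(3) poly_fract_simps mult.assoc)
  moreover have "poly_fract B * \<Delta> * poly_fract q * poly_fract d = poly_fract ([:u:] * A * q * N)"
  proof -
    have "poly_fract B * \<Delta> * poly_fract q * poly_fract d =
        const u * (poly_fract B * tvar powi n) * poly_fract q * (poly_fract N / poly_fract d * poly_fract d)"
      by (simp only: \<Delta> mult_ac)
    also have "\<dots> = const u * poly_fract A * poly_fract q * poly_fract N" using d by (simp add: AB(3))
    finally show ?thesis by (simp only: poly_fract_simps)
  qed
  ultimately have eq: "[:u:] * A * q * N = [:- 1, 1:] ^ m * (B * p * d)"
    by (simp add: poly_fract_eq_iff mult.assoc mult.left_commute mult.commute)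
  have d0: "d \<noteq> 0" using d by (auto simp: poly_fract_simps)
  have R: "[:- 1, 1:] ^ m * (B * p * d) \<noteq> 0" using nz AB(2) pq(1) d0 by simp
  then show N: "N \<noteq> 0" using eq by auto
  have "Polynomial.order 1 ([:u:] * A * q * N) = Polynomial.order 1 N"
    using N u nz AB(1) pq(2) by (subst order_mult) (auto simp: order_0I)
  moreover have "Polynomial.order 1 ([:- 1, 1:] ^ m * (B * p * d)) = m + Polynomial.order 1 d"
    using R order_power_n_n[of "1 :: real" m] AB(2) pq(1)
    by (subst order_mult; simp)+ (simp add: order_0I order_mult)
  ultimately show "Polynomial.order 1 N = m + Polynomial.order 1 d" using eq by simp
qed

lemma const_uminus: "const (- a) = - const a" for a :: real
  by (simp add: poly_fract_simps(7)[symmetric] poly_fract_simps(3)[symmetric])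

lemma const_diff: "const (a - b) = const a - const b" for a b :: real
  by (simp add: poly_fract_simps(7)[symmetric] poly_fract_simps(2)[symmetric])

lemma sum_prod_UNIV: "(\<Sum>p\<in>UNIV. f (p :: 'a::finite \<times> 'b::finite)) = (\<Sum>i\<in>UNIV. \<Sum>j\<in>UNIV. f (i, j))"
  by (simp add: sum.cartesian_product UNIV_Times_UNIV[symmetric] del: UNIV_Times_UNIV)

lemma kron_mult: "kron A B ** kron C D = kron (A ** C) (B ** D)"
  for A C :: "'a::comm_semiring_1 ^ 'm ^ 'm" and B D :: "'a ^ 'n ^ 'n"
  by (simp add: vec_eq_iff kron_def matrix_matrix_mult_def sum_prod_UNIV sum_product mult_ac)

lemma kron_mat_1: "kron (mat 1) (mat 1) = (mat 1 :: 'a::comm_semiring_1 ^ ('m::finite \<times> 'n::finite) ^ ('m \<times> 'n))"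
  by (auto simp: vec_eq_iff kron_def mat_def)

text \<open>The derivative of a relator by a fiber generator is minus the derivative of the image
  under \<open>\<phi>\<close>, which is free of t, with t times the matrix of the meridian added on
  the diagonal blocks. So the numerator is det(t X - Jacobian) and the denominator det(1 - t
  X).\<close>

lemma twisted_alexander_bundle:
  fixes \<sigma> :: "bundle_elem \<Rightarrow> real ^ 'l ^ 'l"
  assumes hom: "\<And>u v. \<sigma> (bundle_cls \<phi> (u + v)) = \<sigma> (bundle_cls \<phi> u) ** \<sigma> (bundle_cls \<phi> v)"
    and one: "\<sigma> (bundle_cls \<phi> 0) = mat 1"
    and \<alpha>_add: "\<And>u v. \<alpha> (bundle_cls \<phi> (u + v)) = \<alpha> (bundle_cls \<phi> u) + \<alpha> (bundle_cls \<phi> v)"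
    and \<alpha>_fiber: "\<And>u. \<alpha> (bundle_cls \<phi> (fiber_incl u)) = 0" and \<alpha>_x: "\<alpha> (bundle_cls \<phi> gen_x) = 1"
    and singular: "\<And>g. det (mat 1 - \<sigma> (bundle_cls \<phi> (gen (Some g)))) = 0"
    and alexander: "is_twisted_alexander_polynomial (bundle_relator \<phi>) \<sigma> \<alpha> \<Delta>"
  obtains n u N d where "\<Delta> = const u * tvar powi n * (poly_fract N / poly_fract d)" "u \<noteq> 0" "poly_fract d \<noteq> 0"
    "degree d \<le> CARD('l)"
    "\<And>s. poly N s = det (\<chi> p q. (if fst p = fst q then s * \<sigma> (bundle_cls \<phi> gen_x) $ snd p $ snd q else 0) -
        fox_matrix (\<lambda>v. \<sigma> (bundle_cls \<phi> (fiber_incl v))) (fst q) (\<phi> (gen (fst p))) $ snd p $ snd q)"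
proof -
  let ?rel = "bundle_relator \<phi>" and ?cls = "bundle_cls \<phi>"
  let ?X = "\<sigma> (?cls gen_x)" and ?D = "fox_matrix (\<lambda>v. \<sigma> (?cls (fiber_incl v)))"
  let ?A = "alexander_hom ?rel \<sigma> \<alpha>"
  define S :: "fiber_gen option free_group \<Rightarrow> real poly fract ^ 'l ^ 'l" where
    "S g = (\<chi> i j. tvar powi \<alpha> (?cls g) * const (\<sigma> (?cls g) $ i $ j))" for g
  have A: "?A c $ i $ j = linear_extension (\<lambda>g. S g $ i $ j) c" for c i j
    by (simp add: alexander_hom_def linear_extension_def S_def mult.assoc)
  have t0: "tvar \<noteq> (0 :: real poly fract)"
    using poly_fract_eq_iff[of "[:0, 1:]" 0] by (simp add: poly_fract_simps)
  have S_add: "S (u + v) = S u ** S v" for u v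
    using t0 by (simp add: vec_eq_iff S_def \<alpha>_add hom matrix_matrix_mult_def const_sum const_simps power_int_add
        sum_distrib_left mult_ac)
  have \<alpha>0: "\<alpha> (?cls 0) = 0" using \<alpha>_add[of 0 0] by simp
  have S0: "S 0 = mat 1"
    by (simp add: vec_eq_iff S_def \<alpha>0 one mat_def const_simps)
  have S_fiber: "S (fiber_incl v) = (\<chi> i j. const (\<sigma> (?cls (fiber_incl v)) $ i $ j))" for v
    by (simp add: S_def \<alpha>_fiber)
  have S_x: "S gen_x = (\<chi> i j. tvar * const (?X $ i $ j))" by (simp add: S_def \<alpha>_x)
  have rel_one: "S (?rel g) = mat 1" for g
  proof -
    have "?cls (?rel g) = ?cls 0" by (simp add: cls_relator cls_zero)
    then have "S (?rel g) = S 0" by (simp add: S_def)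
    then show ?thesis by (simp add: S0)
  qed
  note fox_S = fox_matrix_add[of S, OF S_add] fox_matrix_gen[of S, OF S0]
  have fiber_fox: "fox_matrix S (Some g) (fiber_incl v) = (\<chi> i j. const (?D g v $ i $ j))" for g v
  proof (rule derivation_unique[where S = "\<lambda>v. S (fiber_incl v)"])
    show "fox_matrix S (Some g) (fiber_incl (u + v)) =
        fox_matrix S (Some g) (fiber_incl u) + S (fiber_incl u) ** fox_matrix S (Some g) (fiber_incl v)" for u v
      by (simp add: fiber_incl_add fox_S)
    have D: "?D g (u + v) = ?D g u + \<sigma> (?cls (fiber_incl u)) ** ?D g v" for u v
      by (rule fox_matrix_add) (simp add: fiber_incl_add hom)
    show "(\<chi> i j. const (?D g (u + v) $ i $ j)) =
        (\<chi> i j. const (?D g u $ i $ j)) + S (fiber_incl u) ** (\<chi> i j. const (?D g v $ i $ j))" for u v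
      unfolding D by (simp add: vec_eq_iff S_fiber matrix_matrix_mult_def const_sum const_simps)
    show "S (fiber_incl 0) = mat 1" by (simp add: fiber_incl_simps S0)
    have "(\<lambda>v. \<sigma> (?cls (fiber_incl v))) 0 = mat 1" by (simp add: fiber_incl_simps one)
    then have "?D g (gen h) = (if h = g then mat 1 else 0)" for h by (rule fox_matrix_gen)
    then show "fox_matrix S (Some g) (fiber_incl (gen h)) = (\<chi> i j. const (?D g (gen h) $ i $ j))" for h
      by (simp add: fox_S vec_eq_iff mat_def const_simps)
  qed
  have entry: "?A (fox (Some g) (?rel h)) $ i $ j =
      (if h = g then tvar * const (?X $ i $ j) else 0) - const (?D g (\<phi> (gen h)) $ i $ j)" for g h i j
  proof -
    \<comment> \<open>The relator acts as the identity, so moving its inverses to the other side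
      expresses its derivative as a difference of simpler ones.\<close>
    have "?rel h + (fiber_incl (\<phi> (gen h)) + gen_x) = gen_x + gen (Some h)"
      by (simp add: bundle_relator_def diff_conv_add_uminus add.assoc del: add_uminus_conv_diff)
    then have "fox_matrix S (Some g) (?rel h) + S (?rel h) ** fox_matrix S (Some g) (fiber_incl (\<phi> (gen h)) + gen_x)
        = fox_matrix S (Some g) (gen_x + gen (Some h))"
      by (simp add: fox_S(1)[symmetric])
    then have "fox_matrix S (Some g) (?rel h) =
        S gen_x ** (if h = g then mat 1 else 0) - fox_matrix S (Some g) (fiber_incl (\<phi> (gen h)))"
      by (simp add: fox_S rel_one algebra_simps split: if_splits)
    then have "fox_matrix S (Some g) (?rel h) $ i $ j =
        (S gen_x ** (if h = g then mat 1 else 0) - fox_matrix S (Some g) (fiber_incl (\<phi> (gen h)))) $ i $ j" by simp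
    moreover have "?A (fox (Some g) (?rel h)) $ i $ j = fox_matrix S (Some g) (?rel h) $ i $ j"
      by (simp add: A fox_matrix_def)
    ultimately show ?thesis by (simp add: fiber_fox S_x split: if_splits)
  qed
  have denominator: "?A (1 - group_ring_elem u) $ i $ j = mat 1 $ i $ j - S u $ i $ j" for u i j
  proof -
    have "linear_extension (\<lambda>g. S g $ i $ j) 1 = S 0 $ i $ j"
      by (simp add: single_one[symmetric] linear_extension_single del: single_one)
    then show ?thesis by (simp add: A linear_extension_simps linear_extension_single S0)
  qed
  obtain k c u s where k: "bij_betw c UNIV (UNIV - {k})" "det (?A (1 - group_ring_elem (gen k))) \<noteq> 0" "u \<noteq> 0"
    and \<Delta>: "\<Delta> = const u * tvar powi (int CARD('l) * s) *
        (det (twisted_alexander_matrix ?rel \<sigma> \<alpha> c) / det (?A (1 - group_ring_elem (gen k))))"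
    using alexander unfolding is_twisted_alexander_polynomial_def by blast
  \<comment> \<open>By \<open>singular\<close> no fiber generator has a nonzero denominator, so the
    removed column is that of the stable letter.\<close>
  have "k = None"
  proof (rule ccontr)
    assume "k \<noteq> None"
    then obtain g where g: "k = Some g" by blast
    have "?A (1 - group_ring_elem (gen k)) = (\<chi> i j. const ((mat 1 - \<sigma> (?cls (gen (Some g)))) $ i $ j))"
      using S_fiber[of "gen g"]
      by (simp add: vec_eq_iff denominator g mat_def const_diff const_simps const_uminus)
    then have "det (?A (1 - group_ring_elem (gen k))) = const (det (mat 1 - \<sigma> (?cls (gen (Some g)))))"
      by (simp add: det_hom[of const, OF const_simps(3,4,2)])
    then show False using k(2) singular by (simp add: const_simps)
  qed
  define \<pi> where "\<pi> r = the (c r)" for r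
  have c\<pi>: "c r = Some (\<pi> r)" for r
    using bij_betwE[OF k(1)] \<open>k = None\<close> by (auto simp: \<pi>_def)
  have "inj \<pi>"
    using bij_betw_imp_inj_on[OF k(1)] c\<pi> by (auto simp: inj_def)
  then have "bij \<pi>" by (simp add: finite_UNIV_inj_surj bij_def)
  define N0 where "N0 = det (\<chi> p q. [:- ?D (fst q) (\<phi> (gen (fst p))) $ snd p $ snd q,
      if fst p = fst q then ?X $ snd p $ snd q else 0:])"
  \<comment> \<open>The remaining columns may be listed in either order; the sign goes into the
    unit.\<close>
  define perm :: "fiber_gen \<times> 'l \<Rightarrow> fiber_gen \<times> 'l" where "perm = map_prod \<pi> id"
  have "bij perm"
    using \<open>bij \<pi>\<close> unfolding perm_def by (metis bij_betw_map_prod bij_id UNIV_Times_UNIV)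
  then have perm: "perm permutes UNIV" by (rule bij_imp_permutes) simp
  have ent: "poly_fract [:a, b:] = const a + tvar * const b" for a b
  proof -
    have "[:a, b:] = [:a:] + [:0, 1:] * [:b:]" by simp
    then show ?thesis by (simp only: poly_fract_simps)
  qed
  define Q where "Q = (\<chi> p q. poly_fract ([:- ?D (fst q) (\<phi> (gen (fst p))) $ snd p $ snd q,
      if fst p = fst q then ?X $ snd p $ snd q else 0:]))"
  have Q: "det Q = poly_fract N0"
    unfolding Q_def N0_def by (simp add: det_hom[of poly_fract, OF poly_fract_simps(1,4,6)])
  have "twisted_alexander_matrix ?rel \<sigma> \<alpha> c = (\<chi> p q. Q $ p $ perm q)"
  proof -
    show ?thesis
      by (simp add: vec_eq_iff twisted_alexander_matrix_def c\<pi> entry perm_def Q_def ent const_uminus const_simps)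
  qed
  then have num: "det (twisted_alexander_matrix ?rel \<sigma> \<alpha> c) = of_int (sign perm) * poly_fract N0"
    by (simp add: det_permute_columns[OF perm] Q)
  define d where "d = det (\<chi> i j. [:mat 1 $ i $ j, - ?X $ i $ j:])"
  have "?A (1 - group_ring_elem (gen k)) = (\<chi> i j. poly_fract [:mat 1 $ i $ j, - ?X $ i $ j:])"
  proof -
    show ?thesis
      by (simp add: vec_eq_iff denominator \<open>k = None\<close> S_x ent const_uminus mat_def const_simps)
  qed
  then have den: "det (?A (1 - group_ring_elem (gen k))) = poly_fract d"
    unfolding d_def by (simp add: det_hom[of poly_fract, OF poly_fract_simps(1,4,6)])
  show thesis
  proof (rule that)
    show "poly_fract d \<noteq> 0" using k(2) den by simp
    show "degree d \<le> CARD('l)" unfolding d_def by (rule degree_det_le) simp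
    show "of_int (sign perm) * u \<noteq> 0" using k(3) by (simp add: sign_def)
    show "\<Delta> = const (of_int (sign perm) * u) * tvar powi (int CARD('l) * s) * (poly_fract N0 / poly_fract d)"
    proof -
      show ?thesis by (simp add: \<Delta> num den const_simps sign_def const_uminus)
    qed
    show "poly N0 s = det (\<chi> p q. (if fst p = fst q then s * ?X $ snd p $ snd q else 0) -
        ?D (fst q) (\<phi> (gen (fst p))) $ snd p $ snd q)" for s
    proof -
      have "poly (det M) s = det (\<chi> p q. poly (M $ p $ q) s)" for M :: "real poly ^ (fiber_gen \<times> 'l) ^ (fiber_gen \<times> 'l)"
        by (rule det_hom) simp_all
      then show ?thesis
        unfolding N0_def by (simp only:) (rule arg_cong[where f = det], simp add: vec_eq_iff)
    qed
  qed
qed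

section \<open>Cocycles of the fiber group\<close>

lemma order_pcompose_shift:
  fixes p :: "real poly"
  assumes "p \<noteq> 0"
  shows "Polynomial.order 1 (p \<circ>\<^sub>p [:- 1, 1:]) = Polynomial.order 0 p"
proof -
  obtain q where q: "p = [:0, 1:] ^ Polynomial.order 0 p * q" "\<not> [:0, 1:] dvd q"
    using order_decomp[OF assms, of 0] by auto
  have q0: "poly q 0 \<noteq> 0" using q(2) poly_eq_0_iff_dvd[of q 0] by simp
  have eq: "p \<circ>\<^sub>p [:- 1, 1:] = [:- 1, 1:] ^ Polynomial.order 0 p * (q \<circ>\<^sub>p [:- 1, 1:])"
    by (subst q(1)) (simp add: pcompose_mult pcompose_power pcompose_pCons)
  have nz: "poly (q \<circ>\<^sub>p [:- 1, 1:]) 1 \<noteq> 0" using q0 by (simp add: poly_pcompose)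
  then have "q \<circ>\<^sub>p [:- 1, 1:] \<noteq> 0" by auto
  then show ?thesis
    unfolding eq using order_power_n_n[of "1 :: real" "Polynomial.order 0 p"]
    by (subst order_mult) (auto simp: order_0I nz)
qed

section \<open>The adjoint representation as a tensor square\<close>

definition lorentz_inverse :: "real ^ 4 ^ 4 \<Rightarrow> real ^ 4 ^ 4" where
  "lorentz_inverse A = lorentz_matrix ** transpose A ** lorentz_matrix"

lemma lorentz_inverse_involution: "lorentz_inverse (lorentz_inverse A) = A"
proof -
  have "lorentz_inverse (lorentz_inverse A) = (lorentz_matrix ** lorentz_matrix) ** A ** (lorentz_matrix ** lorentz_matrix)"
    by (simp add: lorentz_inverse_def matrix_transpose_mul lorentz_matrix_transpose matrix_mul_assoc)
  then show ?thesis by (simp add: lorentz_matrix_square)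
qed

text \<open>The form identifies the tensor square of the standard representation with the adjoint one.\<close>

definition tensor_matrix :: "real ^ (4 \<times> 4) \<Rightarrow> real ^ 4 ^ 4" where
  "tensor_matrix y = (\<chi> i j. y $ (i, j)) ** lorentz_matrix"

definition matrix_tensor :: "real ^ 4 ^ 4 \<Rightarrow> real ^ (4 \<times> 4)" where
  "matrix_tensor Z = (\<chi> p. (Z ** lorentz_matrix) $ fst p $ snd p)"

lemma tensor_matrix_inverse: "tensor_matrix (matrix_tensor Z) = Z" "matrix_tensor (tensor_matrix y) = y"
proof -
  have "tensor_matrix (matrix_tensor Z) = Z ** lorentz_matrix ** lorentz_matrix"
    by (simp add: tensor_matrix_def matrix_tensor_def)
  then show "tensor_matrix (matrix_tensor Z) = Z" by (simp add: matrix_mul_assoc[symmetric] lorentz_matrix_square)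
  have "matrix_tensor (tensor_matrix y) = (\<chi> p. (\<chi> i j. y $ (i, j)) $ fst p $ snd p)"
    by (simp add: tensor_matrix_def matrix_tensor_def matrix_mul_assoc[symmetric] lorentz_matrix_square)
  then show "matrix_tensor (tensor_matrix y) = y" by (simp add: vec_eq_iff)
qed

lemma linear_tensor_matrix: "linear tensor_matrix"
proof (rule linearI)
  fix x y :: "real ^ (4 \<times> 4)" and r :: real
  have "(\<chi> i j. (x + y) $ (i, j)) = (\<chi> i j. x $ (i, j)) + ((\<chi> i j. y $ (i, j)) :: real ^ 4 ^ 4)"
    "(\<chi> i j. (r *\<^sub>R x) $ (i, j)) = r *\<^sub>R ((\<chi> i j. x $ (i, j)) :: real ^ 4 ^ 4)"
    by (simp_all add: vec_eq_iff)
  then show "tensor_matrix (x + y) = tensor_matrix x + tensor_matrix y"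
    "tensor_matrix (r *\<^sub>R x) = r *\<^sub>R tensor_matrix x"
    by (simp_all add: tensor_matrix_def matrix_add_rdistrib scaleR_matrix_mult)
qed

text \<open>For Y the matrix of \<open>y\<close> and J that of the form, A Y A^T J = A (Y J) (J A^T
  J), because J squares to the identity.\<close>

lemma tensor_matrix_kron: "tensor_matrix (kron A A *v y) = A ** tensor_matrix y ** lorentz_inverse A"
proof -
  have "(\<chi> i j. (kron A A *v y) $ (i, j)) = A ** (\<chi> i j. y $ (i, j)) ** transpose A"
    unfolding vec_eq_iff
  proof (intro allI)
    fix i j
    have "(\<Sum>k\<in>UNIV. \<Sum>l\<in>UNIV. A $ i $ k * A $ j $ l * y $ (k, l)) =
        (\<Sum>l\<in>UNIV. \<Sum>k\<in>UNIV. A $ i $ k * y $ (k, l) * A $ j $ l)"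
      by (subst sum.swap) (simp only: mult_ac)
    then show "(\<chi> i j. (kron A A *v y) $ (i, j)) $ i $ j = (A ** (\<chi> i j. y $ (i, j)) ** transpose A) $ i $ j"
      by (simp add: kron_def matrix_vector_mult_def matrix_matrix_mult_def transpose_def sum_prod_UNIV sum_distrib_right)
  qed
  then have "tensor_matrix (kron A A *v y) = A ** (\<chi> i j. y $ (i, j)) ** (lorentz_matrix ** lorentz_matrix) ** transpose A ** lorentz_matrix"
    by (simp add: tensor_matrix_def lorentz_matrix_square)
  then show ?thesis by (simp add: tensor_matrix_def lorentz_inverse_def matrix_mul_assoc)
qed

text \<open>The eigenvector is the tensor of the form.\<close>

lemma det_kron_minus_1:
  assumes "A \<in> SO31"
  shows "det (mat 1 - kron A A) = 0"
proof -
  let ?y = "matrix_tensor (mat 1)"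
  have "tensor_matrix (kron A A *v ?y) = tensor_matrix ?y"
    using SO31_inverse(2)[OF assms] by (simp add: tensor_matrix_kron tensor_matrix_inverse lorentz_inverse_def)
  then have "kron A A *v ?y = ?y" by (metis tensor_matrix_inverse(2))
  then have 1: "(mat 1 - kron A A) *v ?y = 0" by (simp add: matrix_vector_mult_diff_rdistrib)
  have "?y \<noteq> 0"
  proof
    assume "?y = 0"
    then have "mat 1 = tensor_matrix 0" using tensor_matrix_inverse(1)[of "mat 1"] by simp
    then have "(mat 1 :: real ^ 4 ^ 4) = 0" by (simp add: linear_0[OF linear_tensor_matrix])
    then have "(mat 1 :: real ^ 4 ^ 4) $ 1 $ 1 = 0" by simp
    then show False by (simp add: mat_def)
  qed
  then have "\<not> invertible (mat 1 - kron A A)"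
    using 1 by (metis invertible_def matrix_vector_mul_assoc matrix_vector_mul_lid matrix_vector_mult_0_right)
  then show ?thesis by (simp add: invertible_det_nz)
qed

definition block_diagonal :: "real ^ 'l::finite ^ 'l \<Rightarrow> real ^ ('g::finite \<times> 'l) ^ ('g \<times> 'l)" where
  "block_diagonal M = (\<chi> p q. if fst p = fst q then M $ snd p $ snd q else 0)"

definition block :: "real ^ ('g::finite \<times> 'l::finite) \<Rightarrow> 'g \<Rightarrow> real ^ 'l" where
  "block z g = (\<chi> i. z $ (g, i))"

lemma block_block_diagonal: "block (block_diagonal M *v z) g = M *v block z g"
  for z :: "real ^ ('g::finite \<times> 'l::finite)"
proof -
  have "(\<Sum>h\<in>UNIV. \<Sum>j\<in>UNIV. (if g = h then M $ i $ j else 0) * z $ (h, j)) =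
      (\<Sum>h\<in>UNIV. if g = h then \<Sum>j\<in>UNIV. M $ i $ j * z $ (h, j) else 0)" for i
    by (rule sum.cong) auto
  then show ?thesis
    by (simp add: vec_eq_iff block_def block_diagonal_def matrix_vector_mult_def sum_prod_UNIV cong: if_cong)
qed

lemma block_inject: "(\<And>g. block y g = block z g) \<Longrightarrow> y = z"
  by (auto simp: vec_eq_iff block_def)

lemma block_diagonal_inverse:
  fixes A B :: "real ^ 'l::finite ^ 'l"
  assumes "A ** B = mat 1"
  shows "block_diagonal A ** block_diagonal B = (mat 1 :: real ^ ('g::finite \<times> 'l) ^ ('g \<times> 'l))"
proof -
  have "(block_diagonal A ** block_diagonal B) *v z = z" for z :: "real ^ ('g \<times> 'l)"
    by (rule block_inject) (simp add: matrix_vector_mul_assoc[symmetric] block_block_diagonal,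
      simp add: matrix_vector_mul_assoc assms)
  then show ?thesis by (simp add: matrix_eq)
qed

text \<open>The matrix data extracted from the holonomy: \<open>R\<close> on the fiber group,
  \<open>X\<close> for the meridian, and a null frame \<open>P\<close> in which the loop
  \<open>c\<close> and the meridian become the translations \<open>t\<close> and
  \<open>t'\<close>.\<close>

locale parabolic_fiber =
  fixes P X :: "real ^ 4 ^ 4" and R :: "fiber_gen free_group \<Rightarrow> real ^ 4 ^ 4"
    and \<phi> :: "fiber_gen free_group \<Rightarrow> fiber_gen free_group" and c loop :: "fiber_gen free_group" and t t' :: complex
  assumes frame: "null_frame P"
    and R_SO31: "\<And>u. R u \<in> SO31" and R_add: "\<And>u v. R (u + v) = R u ** R v" and R_inj: "inj R"
    and c_frame: "R c ** P = P ** par 1 1 t"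
    and X_SO31: "X \<in> SO31" and X_frame: "X ** P = P ** par 1 1 t'"
    and X_R: "\<And>u. X ** R u = R (\<phi> u) ** X"
    and \<phi>_add: "\<And>u v. \<phi> (u + v) = \<phi> u + \<phi> v" and \<phi>_surj: "surj \<phi>" and \<phi>_c: "\<phi> c = c"
    and independent_translations: "Im (t' * cnj t) \<noteq> 0"
    and c_loop: "c = puncture_loop loop"
begin

lemma R_0: "R 0 = mat 1"
proof (rule matrix_left_cancel)
  show "lorentz_matrix ** transpose (R 0) ** lorentz_matrix ** R 0 = mat 1" by (rule SO31_inverse(1)[OF R_SO31])
  show "R 0 ** R 0 = R 0 ** mat 1" using R_add[of 0 0] by simp
qed

lemma R_inverse: "R (- u) ** R u = mat 1" "R u ** R (- u) = mat 1"
  by (simp_all add: R_add[symmetric] R_0)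

lemma lorentz_inverse_R: "lorentz_inverse (R u) = R (- u)"
  by (rule matrix_left_cancel[OF R_inverse(1)[of u]])
    (simp only: R_inverse lorentz_inverse_def SO31_inverse(2)[OF R_SO31])

lemma X_inverse: "lorentz_inverse X ** X = mat 1" "X ** lorentz_inverse X = mat 1"
  unfolding lorentz_inverse_def by (rule SO31_inverse[OF X_SO31])+

lemma commutant: "(\<And>u. Y ** R u = R u ** Y) \<Longrightarrow> \<exists>y. Y = mat y"
  by (rule commutant_scalar[OF frame R_SO31 R_add R_inj c_frame X_frame X_R \<phi>_surj independent_translations])

definition \<sigma> :: "fiber_gen free_group \<Rightarrow> real ^ (4 \<times> 4) ^ (4 \<times> 4)" where
  "\<sigma> u = kron (R u) (R u)"

lemma \<sigma>_add: "\<sigma> (u + v) = \<sigma> u ** \<sigma> v"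
  by (simp add: \<sigma>_def R_add kron_mult)

lemma \<sigma>_0: "\<sigma> 0 = mat 1"
  by (simp add: \<sigma>_def R_0 kron_mat_1)

text \<open>The cocycle with prescribed values on the generators.\<close>

definition coc :: "real ^ (fiber_gen \<times> (4 \<times> 4)) \<Rightarrow> fiber_gen free_group \<Rightarrow> real ^ 4 ^ 4" where
  "coc z u = tensor_matrix (\<Sum>g\<in>UNIV. fox_matrix \<sigma> g u *v block z g)"

definition cocycle :: "(fiber_gen free_group \<Rightarrow> real ^ 4 ^ 4) \<Rightarrow> bool" where
  "cocycle f \<longleftrightarrow> (\<forall>u v. f (u + v) = f u + R u ** f v ** R (- u))"

lemma cocycleD: "cocycle f \<Longrightarrow> f (u + v) = f u + R u ** f v ** R (- u)"
  by (simp add: cocycle_def)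

lemma cocycle_coc: "cocycle (coc z)"
  unfolding cocycle_def
proof (intro allI)
  fix u v
  have "(\<Sum>g\<in>UNIV. fox_matrix \<sigma> g (u + v) *v block z g) =
      (\<Sum>g\<in>UNIV. fox_matrix \<sigma> g u *v block z g) + \<sigma> u *v (\<Sum>g\<in>UNIV. fox_matrix \<sigma> g v *v block z g)"
    by (simp add: fox_matrix_add[of \<sigma>, OF \<sigma>_add] matrix_vector_mult_add_rdistrib sum.distrib
        linear_sum[OF matrix_vector_mul_linear] matrix_vector_mul_assoc)
  then show "coc z (u + v) = coc z u + R u ** coc z v ** R (- u)"
    by (simp add: coc_def linear_add[OF linear_tensor_matrix] \<sigma>_def tensor_matrix_kron lorentz_inverse_R)
qed

lemma coc_gen: "coc z (gen g) = tensor_matrix (block z g)"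
proof -
  have "(\<Sum>h\<in>UNIV. fox_matrix \<sigma> h (gen g) *v block z h) = (\<Sum>h\<in>UNIV. if g = h then block z h else 0)"
    by (rule sum.cong) (auto simp: fox_matrix_gen[of \<sigma>, OF \<sigma>_0])
  then show ?thesis by (simp add: coc_def)
qed

lemma cocycle_unique:
  assumes f: "cocycle f" and h: "cocycle h" and gen: "\<And>g. f (gen g) = h (gen g)"
  shows "f u = h u"
proof -
  have 0: "k 0 = 0" if "cocycle k" for k
    using cocycleD[OF that, of 0 0] by (simp add: R_0)
  have neg: "k (- gen g) = - (R (- gen g) ** k (gen g) ** R (gen g))" if "cocycle k" for k g
    using cocycleD[OF that, of "- gen g" "gen g"] 0[OF that] by (simp add: eq_neg_iff_add_eq_0)
  show ?thesis
    by (induction u rule: free_group_induct)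
      (simp_all add: 0[OF f] 0[OF h] cocycleD[OF f] cocycleD[OF h] gen neg[OF f] neg[OF h])
qed

text \<open>With \<open>coc_inject\<close>, this identifies the cocycles with a coordinate space of
  dimension 2 * 16, on which the Fox Jacobian acts as a matrix.\<close>

lemma coc_surj:
  assumes "cocycle f"
  obtains z where "coc z = f"
proof
  have "block (\<chi> q. matrix_tensor (f (gen (fst q))) $ snd q) g = matrix_tensor (f (gen g))" for g
    by (simp add: block_def vec_eq_iff)
  then show "coc (\<chi> q. matrix_tensor (f (gen (fst q))) $ snd q) = f"
    using cocycle_unique[OF cocycle_coc assms] by (simp add: coc_gen tensor_matrix_inverse fun_eq_iff)
qed

lemma coc_inject:
  assumes "coc y = coc z"
  shows "y = z"
proof (rule block_inject)
  fix g
  have "tensor_matrix (block y g) = tensor_matrix (block z g)"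
    using fun_cong[OF assms, of "gen g"] by (simp add: coc_gen)
  then have "matrix_tensor (tensor_matrix (block y g)) = matrix_tensor (tensor_matrix (block z g))" by simp
  then show "block y g = block z g" by (simp only: tensor_matrix_inverse)
qed

lemma linear_coc: "linear (\<lambda>z. coc z u)"
proof -
  have "linear (\<lambda>z. \<Sum>g\<in>UNIV. fox_matrix \<sigma> g u *v block z g)"
  proof (rule linearI)
    fix y z :: "real ^ (fiber_gen \<times> (4 \<times> 4))" and r :: real
    have "block (y + z) g = block y g + block z g" "block (r *\<^sub>R z) g = r *\<^sub>R block z g" for g
      by (simp_all add: block_def vec_eq_iff)
    then show "(\<Sum>g\<in>UNIV. fox_matrix \<sigma> g u *v block (y + z) g) =
        (\<Sum>g\<in>UNIV. fox_matrix \<sigma> g u *v block y g) + (\<Sum>g\<in>UNIV. fox_matrix \<sigma> g u *v block z g)"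
      "(\<Sum>g\<in>UNIV. fox_matrix \<sigma> g u *v block (r *\<^sub>R z) g) = r *\<^sub>R (\<Sum>g\<in>UNIV. fox_matrix \<sigma> g u *v block z g)"
      by (simp_all add: matrix_vector_right_distrib sum.distrib matrix_vector_mult_scaleR scaleR_sum_right)
  qed
  then show ?thesis unfolding coc_def using linear_compose[OF _ linear_tensor_matrix] by (simp add: o_def)
qed

lemma cocycle_coboundary: "cocycle (\<lambda>u. R u ** Z ** R (- u) - Z)"
  unfolding cocycle_def
  by (simp only: R_add minus_add) (simp add: matrix_diff_ldistrib matrix_diff_rdistrib matrix_mul_assoc)

end

lemma CARD_fiber_gen: "CARD(fiber_gen) = 2"
proof -
  have "card (UNIV :: fiber_gen set) = card {Gen_a, Gen_b}"
    by (rule arg_cong[where f = card]) (use fiber_gen.exhaust in auto)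
  then show ?thesis by simp
qed

section \<open>The meridian acting on cocycles\<close>

context parabolic_fiber
begin

text \<open>The inverse is what precomposition with \<open>\<phi>\<close> has to be paired with:
  \<open>Ad_X_inverse (f (\<phi> u))\<close> is again a cocycle in \<open>u\<close>.\<close>

definition Ad_X_inverse :: "real ^ 4 ^ 4 \<Rightarrow> real ^ 4 ^ 4" where
  "Ad_X_inverse Z = lorentz_inverse X ** Z ** X"

lemma Ad_X_inverse_R: "Ad_X_inverse (R (\<phi> u) ** Z ** R (- \<phi> u)) = R u ** Ad_X_inverse Z ** R (- u)"
proof -
  have 1: "lorentz_inverse X ** R (\<phi> u) = R u ** lorentz_inverse X" for u
  proof -
    have "lorentz_inverse X ** R (\<phi> u) = lorentz_inverse X ** (R (\<phi> u) ** X) ** lorentz_inverse X"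
      by (simp add: matrix_mul_assoc[symmetric] X_inverse)
    also have "\<dots> = (lorentz_inverse X ** X) ** R u ** lorentz_inverse X"
      by (simp only: X_R[symmetric] matrix_mul_assoc)
    finally show ?thesis by (simp add: X_inverse)
  qed
  have "\<phi> (- u) = - \<phi> u" by (rule additive_group_add(2)[of \<phi>, OF \<phi>_add])
  then have 2: "R (- \<phi> u) ** X = X ** R (- u)" using X_R[of "- u"] by simp
  have "Ad_X_inverse (R (\<phi> u) ** Z ** R (- \<phi> u)) = (lorentz_inverse X ** R (\<phi> u)) ** Z ** (R (- \<phi> u) ** X)"
    by (simp only: Ad_X_inverse_def matrix_mul_assoc)
  then show ?thesis by (simp only: 1 2 Ad_X_inverse_def matrix_mul_assoc)
qed

lemma linear_Ad_X_inverse: "linear Ad_X_inverse"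
  by (rule linearI) (simp_all add: Ad_X_inverse_def matrix_add_ldistrib matrix_add_rdistrib matrix_mult_scaleR scaleR_matrix_mult)

text \<open>In the frame \<open>P\<close> the operator becomes conjugation by a translation minus
  the identity.\<close>

lemma Ad_X_inverse_nilpotent: "((\<lambda>Z. Ad_X_inverse Z - Z) ^^ 8) Z = 0"
proof -
  let ?Q = "frame_inverse P"
  note Q = frame_inverse[OF frame]
  let ?D = "\<lambda>Z. Ad_X_inverse Z - Z" and ?U = "\<lambda>Z. par 1 1 (- t') ** Z ** par 1 1 t' - Z"
  have "lorentz_inverse X ** P = P ** par 1 1 (- t')"
  proof (rule matrix_left_cancel[OF X_inverse(1)])
    have "X ** (P ** par 1 1 (- t')) = P ** (par 1 1 t' ** par 1 1 (- t'))"
      by (simp only: matrix_mul_assoc X_frame)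
    then show "X ** (lorentz_inverse X ** P) = X ** (P ** par 1 1 (- t'))"
      by (simp add: matrix_mul_assoc X_inverse par_mult par_1)
  qed
  then have "?Q ** (lorentz_inverse X ** P) ** ?Q = ?Q ** (P ** par 1 1 (- t')) ** ?Q" by simp
  then have QX: "?Q ** lorentz_inverse X = par 1 1 (- t') ** ?Q"
    by (simp add: matrix_mul_assoc Q) (simp add: matrix_mul_assoc[symmetric] Q)
  have conj: "?Q ** ?D Z ** P = ?U (?Q ** Z ** P)" for Z
  proof -
    have "?Q ** Ad_X_inverse Z ** P = (?Q ** lorentz_inverse X) ** Z ** (X ** P)"
      by (simp only: Ad_X_inverse_def matrix_mul_assoc)
    also have "\<dots> = par 1 1 (- t') ** (?Q ** Z ** P) ** par 1 1 t'" by (simp only: QX X_frame matrix_mul_assoc)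
    finally show ?thesis by (simp add: matrix_diff_ldistrib matrix_diff_rdistrib)
  qed
  have "?Q ** (?D ^^ k) Z ** P = (?U ^^ k) (?Q ** Z ** P)" for k
    by (induction k) (simp_all add: conj)
  from this[of 8] have "?Q ** (?D ^^ 8) Z ** P = 0" by (simp only: conjugation_translation_nilpotent)
  then have "P ** (?Q ** (?D ^^ 8) Z ** P) ** ?Q = 0" by simp
  moreover have "P ** (?Q ** (?D ^^ 8) Z ** P) ** ?Q = (P ** ?Q) ** (?D ^^ 8) Z ** (P ** ?Q)"
    by (simp only: matrix_mul_assoc)
  ultimately show ?thesis by (simp only: Q matrix_mul_lid matrix_mul_rid)
qed

text \<open>Takes the values of a cocycle on the generators to its values on their images under
  \<open>\<phi>\<close>.\<close>

definition fox_jacobian :: "real ^ (fiber_gen \<times> (4 \<times> 4)) ^ (fiber_gen \<times> (4 \<times> 4))" where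
  "fox_jacobian = (\<chi> p q. fox_matrix \<sigma> (fst q) (\<phi> (gen (fst p))) $ snd p $ snd q)"

text \<open>Minus the identity, this is the action of the stable letter on cocycles.\<close>

definition shift :: "real ^ (fiber_gen \<times> (4 \<times> 4)) ^ (fiber_gen \<times> (4 \<times> 4))" where
  "shift = block_diagonal (kron (lorentz_inverse X) (lorentz_inverse X)) ** fox_jacobian - mat 1"

lemma coc_shift: "coc (shift *v z) u = Ad_X_inverse (coc z (\<phi> u)) - coc z u"
proof (rule cocycle_unique[OF cocycle_coc])
  show "cocycle (\<lambda>u. Ad_X_inverse (coc z (\<phi> u)) - coc z u)"
    unfolding cocycle_def
    by (simp add: \<phi>_add cocycleD[OF cocycle_coc] linear_add[OF linear_Ad_X_inverse] Ad_X_inverse_R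
        matrix_diff_ldistrib matrix_diff_rdistrib)
  fix g
  have "block (fox_jacobian *v z) g = (\<Sum>h\<in>UNIV. fox_matrix \<sigma> h (\<phi> (gen g)) *v block z h)"
    by (simp add: vec_eq_iff block_def fox_jacobian_def matrix_vector_mult_def sum_prod_UNIV)
  then have "tensor_matrix (block (fox_jacobian *v z) g) = coc z (\<phi> (gen g))" by (simp add: coc_def)
  moreover have "block (y - z) g = block y g - block z g" for y z :: "real ^ (fiber_gen \<times> (4 \<times> 4))"
    by (simp add: block_def vec_eq_iff)
  ultimately show "coc (shift *v z) (gen g) = Ad_X_inverse (coc z (\<phi> (gen g))) - coc z (gen g)"
    by (simp add: coc_gen shift_def matrix_vector_mult_diff_rdistrib matrix_vector_mul_assoc[symmetric]
        block_block_diagonal linear_diff[OF linear_tensor_matrix] tensor_matrix_kron lorentz_inverse_involution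
        Ad_X_inverse_def)
qed

text \<open>Because \<open>\<phi>\<close> fixes \<open>c\<close>, evaluation at \<open>c\<close>
  intertwines \<open>shift\<close> with a nilpotent operator; the eighth power of
  \<open>shift\<close> therefore takes all cocycles into the kernel of the evaluation.\<close>

lemma coc_shift_power_c: "coc (((*v) shift ^^ k) z) c = ((\<lambda>Z. Ad_X_inverse Z - Z) ^^ k) (coc z c)"
  by (induction k) (simp_all add: coc_shift \<phi>_c)

definition coboundary :: "real ^ 4 ^ 4 \<Rightarrow> real ^ (fiber_gen \<times> (4 \<times> 4))" where
  "coboundary Z = (SOME z. coc z = (\<lambda>u. R u ** Z ** R (- u) - Z))"

lemma coc_coboundary: "coc (coboundary Z) u = R u ** Z ** R (- u) - Z"
proof -
  obtain z where "coc z = (\<lambda>u. R u ** Z ** R (- u) - Z)" by (rule coc_surj[OF cocycle_coboundary])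
  then have "coc (coboundary Z) = (\<lambda>u. R u ** Z ** R (- u) - Z)"
    unfolding coboundary_def by (rule someI)
  then show ?thesis by (rule fun_cong)
qed

lemma linear_coboundary: "linear coboundary"
  by (rule linearI; rule coc_inject)
    (simp_all add: fun_eq_iff coc_coboundary linear_add[OF linear_coc] linear_scale[OF linear_coc]
      matrix_add_ldistrib matrix_add_rdistrib matrix_mult_scaleR scaleR_matrix_mult algebra_simps)

lemma shift_coboundary: "shift *v coboundary Z = coboundary (Ad_X_inverse Z - Z)"
  by (rule coc_inject) (simp add: fun_eq_iff coc_coboundary coc_shift linear_diff[OF linear_Ad_X_inverse]
      Ad_X_inverse_R matrix_diff_ldistrib matrix_diff_rdistrib)

lemma shift_power_coboundary: "((*v) shift ^^ k) (coboundary Z) = coboundary (((\<lambda>Z. Ad_X_inverse Z - Z) ^^ k) Z)"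
  by (induction k) (simp_all add: shift_coboundary)

lemma dim_scalar_matrices: "dim (range mat :: (real ^ 4 ^ 4) set) \<le> 1"
proof -
  have "range mat \<subseteq> span {mat 1 :: real ^ 4 ^ 4}"
  proof clarify
    fix y :: real
    have "mat y = y *\<^sub>R (mat 1 :: real ^ 4 ^ 4)" by (simp add: vec_eq_iff mat_def)
    then show "mat y \<in> span {mat 1 :: real ^ 4 ^ 4}" by (simp add: span_base span_scale)
  qed
  then have "dim (range mat :: (real ^ 4 ^ 4) set) \<le> dim {mat 1 :: real ^ 4 ^ 4}" by (metis dim_span dim_subset)
  also have "\<dots> \<le> card {mat 1 :: real ^ 4 ^ 4}" by (rule dim_le_card') simp
  finally show ?thesis by simp
qed

text \<open>The kernel of \<open>coboundary\<close> consists of matrices commuting with the fiber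
  group, that is, of scalars, so at least 6 - 1 dimensions survive.\<close>

lemma dim_coboundary_centralizer: "5 \<le> dim (coboundary ` {Z. R c ** Z = Z ** R c})"
proof -
  let ?V = "{Z. R c ** Z = Z ** R c}"
  have V: "subspace ?V"
    by (auto simp: subspace_def matrix_add_ldistrib matrix_add_rdistrib matrix_mult_scaleR scaleR_matrix_mult)
  have "t \<noteq> 0" using independent_translations by auto
  then have "6 \<le> dim ?V" using dim_centralizer_translation[OF frame c_frame] by blast
  moreover have "dim (coboundary ` ?V) + dim {Z \<in> ?V. coboundary Z = 0} = dim ?V"
    by (rule rank_nullity[OF linear_coboundary V])
  moreover have "dim {Z \<in> ?V. coboundary Z = 0} \<le> 1"
  proof -
    have "{Z \<in> ?V. coboundary Z = 0} \<subseteq> range mat"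
    proof clarify
      fix Z assume "coboundary Z = 0"
      then have "coc (coboundary Z) u = 0" for u by (simp add: linear_0[OF linear_coc])
      then have Z: "R u ** Z ** R (- u) = Z" for u by (simp add: coc_coboundary)
      have "Z ** R u = R u ** Z" for u
      proof -
        have "Z ** R u = R u ** Z ** (R (- u) ** R u)" by (subst (1) Z[of u, symmetric]) (simp only: matrix_mul_assoc)
        then show ?thesis by (simp add: R_inverse)
      qed
      then show "Z \<in> range mat" using commutant by blast
    qed
    then show ?thesis using dim_subset dim_scalar_matrices order.trans by blast
  qed
  ultimately show ?thesis by linarith
qed

text \<open>Cyclic invariance of the trace isolates the free matrix \<open>Z\<close>, and the trace
  form is nondegenerate.\<close>

lemma matrix_eq_of_trace_eq:
  fixes L A B :: "real ^ 4 ^ 4"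
  assumes "\<And>Z. trace (L ** (A ** Z ** B)) = trace (L ** (A' ** Z ** B'))"
  shows "B ** L ** A = B' ** L ** A'"
proof -
  have "trace ((B ** L ** A) ** Z) = trace ((B' ** L ** A') ** Z)" for Z
  proof -
    have "trace ((B ** L ** A) ** Z) = trace (B ** (L ** A ** Z))" for A B by (simp only: matrix_mul_assoc)
    also have "trace (B ** (L ** A ** Z)) = trace (L ** (A ** Z ** B))" for A B
      by (subst trace_mul_sym) (simp only: matrix_mul_assoc)
    finally show ?thesis using assms[of Z] by metis
  qed
  moreover have "M = N" if "\<And>Z. trace (M ** Z) = trace (N ** Z)" for M N :: "real ^ 4 ^ 4"
  proof -
    have "M $ i $ j = trace (M ** (\<chi> k l. if k = j \<and> l = i then 1 else 0))" for M :: "real ^ 4 ^ 4" and i j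
      using exhaust_4[of i] exhaust_4[of j] by (auto simp: trace_def matrix_matrix_mult_def sum_4)
    then show ?thesis using that by (simp add: vec_eq_iff)
  qed
  ultimately show ?thesis by blast
qed

text \<open>Such a functional is invariant under both conjugated generators, hence under the fiber group.\<close>

lemma functional_vanishing_on_loop:
  assumes L: "\<And>z. trace (L ** coc z c) = 0"
  shows "\<exists>y. L = mat y"
proof -
  \<comment> \<open>Conjugated generators whose commutator is \<open>c\<close> itself.\<close>
  define a b where "a = loop + gen Gen_a - loop" and "b = loop + gen Gen_b - loop"
  have c: "c = a + b - a - b"
    by (simp add: c_loop puncture_loop_def a_def b_def diff_conv_add_uminus minus_add add.assoc del: add_uminus_conv_diff)
  \<comment> \<open>Conjugation by \<open>loop\<close> is an automorphism taking the generators to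
    \<open>a\<close> and \<open>b\<close>, so cocycle values are as free on these as on the
    generators.\<close>
  have prescribed: "\<exists>z. coc z a = Y \<and> coc z b = Z" for Y Z
  proof -
    obtain k where k: "cocycle k" "k (gen Gen_a) = R (- loop) ** Y ** R loop" "k (gen Gen_b) = R (- loop) ** Z ** R loop"
    proof -
      let ?y = "\<lambda>g. matrix_tensor (R (- loop) ** (if g = Gen_a then Y else Z) ** R loop)"
      have "block (\<chi> q. ?y (fst q) $ snd q) g = ?y g" for g by (simp add: block_def vec_eq_iff)
      then show thesis using that[OF cocycle_coc[of "\<chi> q. ?y (fst q) $ snd q"]] by (simp add: coc_gen tensor_matrix_inverse)
    qed
    let ?f = "\<lambda>u. R loop ** k (- loop + u + loop) ** R (- loop)"
    have "cocycle ?f"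
      unfolding cocycle_def
    proof (intro allI)
      fix u v
      have e: "- loop + (u + v) + loop = (- loop + u + loop) + (- loop + v + loop)"
        by (simp add: add.assoc)
      have "?f (u + v) = ?f u + R loop ** R (- loop + u + loop) ** k (- loop + v + loop) ** R (- (- loop + u + loop)) ** R (- loop)"
        unfolding e cocycleD[OF k(1)] by (simp add: matrix_add_ldistrib matrix_add_rdistrib matrix_mul_assoc)
      also have "R loop ** R (- loop + u + loop) = R u ** R loop"
        by (simp add: R_add[symmetric] add.assoc)
      also have "R u ** R loop ** k (- loop + v + loop) ** R (- (- loop + u + loop)) ** R (- loop) =
          R u ** R loop ** k (- loop + v + loop) ** (R (- (- loop + u + loop)) ** R (- loop))"
        by (simp only: matrix_mul_assoc)
      also have "R (- (- loop + u + loop)) ** R (- loop) = R (- loop) ** R (- u)"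
        unfolding R_add[symmetric] by (rule arg_cong[where f = R]) (simp only: minus_add minus_minus add.assoc right_minus add.right_neutral)
      finally show "?f (u + v) = ?f u + R u ** ?f v ** R (- u)" by (simp only: matrix_mul_assoc)
    qed
    then obtain z where z: "coc z = ?f" using coc_surj by blast
    have "- loop + a + loop = gen Gen_a" "- loop + b + loop = gen Gen_b"
      by (simp_all add: a_def b_def diff_conv_add_uminus add.assoc del: add_uminus_conv_diff)
    then have "coc z a = R loop ** (R (- loop) ** Y ** R loop) ** R (- loop)"
      "coc z b = R loop ** (R (- loop) ** Z ** R loop) ** R (- loop)"
      by (simp_all add: z k)
    moreover have "R loop ** (R (- loop) ** M ** R loop) ** R (- loop) = (R loop ** R (- loop)) ** M ** (R loop ** R (- loop))" for M
      by (simp only: matrix_mul_assoc)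
    ultimately have "coc z a = Y" "coc z b = Z" by (simp_all only: R_inverse matrix_mul_lid matrix_mul_rid)
    then show ?thesis by blast
  qed
  \<comment> \<open>Reading a + b also as c + (b + a) ties the value at \<open>c\<close> to those at
    \<open>a\<close> and \<open>b\<close>.\<close>
  have at_c: "coc z c + R c ** (coc z b + R b ** coc z a ** R (- b)) ** R (- c) = coc z a + R a ** coc z b ** R (- a)" for z
  proof -
    have "c + (b + a) = a + b" by (simp add: c diff_conv_add_uminus add.assoc del: add_uminus_conv_diff)
    then show ?thesis using cocycleD[OF cocycle_coc, of z c "b + a"] cocycleD[OF cocycle_coc, of z b a]
        cocycleD[OF cocycle_coc, of z a b] by simp
  qed
  have tr: "trace (L ** (coc z a + R a ** coc z b ** R (- a))) = trace (L ** (R c ** (coc z b + R b ** coc z a ** R (- b)) ** R (- c)))" for z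
    unfolding at_c[symmetric] using L[of z] by (simp add: matrix_add_ldistrib trace_add)
  \<comment> \<open>Varying only the value at \<open>a\<close> makes \<open>L\<close> invariant
    under c + b; varying only the value at \<open>b\<close>, below, shows that \<open>a\<close> and
    \<open>c\<close> conjugate \<open>L\<close> to the same matrix.\<close>
  have "trace (L ** (mat 1 ** Z ** mat 1)) = trace (L ** (R (c + b) ** Z ** R (- (c + b))))" for Z
  proof -
    obtain z where "coc z a = Z" "coc z b = 0" using prescribed by blast
    then show ?thesis using tr[of z] by (simp only: minus_add R_add) (simp add: matrix_mul_assoc)
  qed
  then have "mat 1 ** L ** mat 1 = R (- (c + b)) ** L ** R (c + b)" by (rule matrix_eq_of_trace_eq)
  then have 1: "R (- (c + b)) ** L ** R (c + b) = L" by simp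
  have "trace (L ** (R a ** Z ** R (- a))) = trace (L ** (R c ** Z ** R (- c)))" for Z
  proof -
    obtain z where "coc z a = 0" "coc z b = Z" using prescribed by blast
    then show ?thesis using tr[of z] by simp
  qed
  then have 2: "R (- a) ** L ** R a = R (- c) ** L ** R c" by (rule matrix_eq_of_trace_eq)
  define invariant where "invariant u \<longleftrightarrow> R (- u) ** L ** R u = L" for u
  have mult: "R (- (u + v)) ** L ** R (u + v) = R (- v) ** (R (- u) ** L ** R u) ** R v" for u v
    by (simp only: minus_add R_add matrix_mul_assoc)
  have fixes_add: "invariant (u + v)" if "invariant u" "invariant v" for u v
    using that mult[of u v] by (simp only: invariant_def)
  have fixes_minus: "invariant (- u)" if "invariant u" for u
    using that mult[of u "- u"] by (simp add: invariant_def R_0)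
  have translate: "R (- (u + v)) ** L ** R (u + v) = R (- (u' + v)) ** L ** R (u' + v)"
    if "R (- u) ** L ** R u = R (- u') ** L ** R u'" for u u' v
    using that by (simp only: mult)
  \<comment> \<open>The elements leaving \<open>L\<close> invariant form a subgroup. It contains c +
    b = a + b - a and a - c, hence (a - c) + (a + b - a) = a + b, and from these \<open>a\<close>
    and \<open>b\<close>.\<close>
  have "invariant (c + b)" using 1 by (simp only: invariant_def)
  then have aba: "invariant (a + b - a)"
    by (simp add: c diff_conv_add_uminus add.assoc del: add_uminus_conv_diff)
  have "invariant (a - c)"
    using translate[OF 2, of "- c"] by (simp add: invariant_def R_0 del: minus_diff_eq)
  moreover have "a - c = a + b + a - b - a"
    by (simp add: c diff_conv_add_uminus minus_add add.assoc del: add_uminus_conv_diff)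
  ultimately have "invariant (a + b + a - b - a)" by simp
  moreover have "(a + b + a - b - a) + (a + b - a) = a + b"
    by (simp add: diff_conv_add_uminus add.assoc del: add_uminus_conv_diff)
  ultimately have ab: "invariant (a + b)" using fixes_add aba by metis
  have "- (a + b - a) + (a + b) = a"
    by (simp add: diff_conv_add_uminus minus_add add.assoc del: add_uminus_conv_diff)
  then have a: "invariant a" using fixes_add[OF fixes_minus[OF aba] ab] by simp
  have "- a + (a + b) = b" by (simp add: add.assoc[symmetric])
  then have b: "invariant b" using fixes_add[OF fixes_minus[OF a] ab] by simp
  have conj: "invariant (loop + u - loop)" for u
  proof (induction u rule: free_group_induct)
    case zero
    show ?case by (simp add: invariant_def R_0)
  next
    case (pos g u)
    have "loop + (gen g + u) - loop = (loop + gen g - loop) + (loop + u - loop)"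
      by (simp add: diff_conv_add_uminus add.assoc del: add_uminus_conv_diff)
    moreover have "invariant (loop + gen g - loop)" using a b by (cases g) (simp_all add: a_def b_def)
    ultimately show ?case using fixes_add pos by metis
  next
    case (neg g u)
    have "loop + (- gen g + u) - loop = - (loop + gen g - loop) + (loop + u - loop)"
      by (simp add: diff_conv_add_uminus minus_add add.assoc del: add_uminus_conv_diff)
    moreover have "invariant (loop + gen g - loop)" using a b by (cases g) (simp_all add: a_def b_def)
    ultimately show ?case using fixes_add fixes_minus neg by metis
  qed
  have "L ** R u = R u ** L" for u
  proof -
    have "loop + (- loop + u + loop) - loop = u"
      by (simp add: diff_conv_add_uminus add.assoc del: add_uminus_conv_diff)
    then have "R (- u) ** L ** R u = L" using conj[of "- loop + u + loop"] by (simp add: invariant_def)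
    then have "R u ** (R (- u) ** L ** R u) = R u ** L" by simp
    then show ?thesis by (simp add: matrix_mul_assoc R_inverse)
  qed
  then show ?thesis by (rule commutant)
qed

text \<open>Matrices orthogonal to all values at \<open>c\<close> are scalar by
  \<open>functional_vanishing_on_loop\<close>, so the values fill at least 16 - 1 of the 16
  dimensions, and the kernel has dimension at most 32 - 15.\<close>

lemma dim_vanishing_at_c: "dim {z. coc z c = 0} \<le> 17"
proof -
  let ?W = "range (\<lambda>z. coc z c)"
  have W: "subspace ?W" by (rule linear_subspace_image[OF linear_coc subspace_UNIV])
  have "dim {Y \<in> UNIV. \<forall>W\<in>?W. orthogonal W Y} + dim ?W = dim (UNIV :: (real ^ 4 ^ 4) set)"
    by (rule dim_subspace_orthogonal_to_vectors[OF W subspace_UNIV]) simp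
  moreover have "dim {Y \<in> UNIV. \<forall>W\<in>?W. orthogonal W Y} \<le> 1"
  proof -
    have "{Y \<in> UNIV. \<forall>W\<in>?W. orthogonal W Y} \<subseteq> range mat"
    proof clarsimp
      fix Y assume Y: "\<forall>z. orthogonal (coc z c) Y"
      have "trace (transpose Y ** Z) = Z \<bullet> Y" for Z
        by (simp add: trace_def matrix_matrix_mult_def transpose_def inner_vec_def mult.commute) (rule sum.swap)
      then have "trace (transpose Y ** coc z c) = 0" for z using Y by (simp add: orthogonal_def)
      then obtain y where "transpose Y = mat y" using functional_vanishing_on_loop by blast
      then have "Y = mat y" by (metis transpose_mat transpose_transpose)
      then show "Y \<in> range mat" by blast
    qed
    then show ?thesis using dim_subset dim_scalar_matrices order.trans by blast
  qed
  moreover have "dim (UNIV :: (real ^ 4 ^ 4) set) = 16" by simp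
  moreover have "dim ?W + dim {z \<in> UNIV. coc z c = 0} = dim (UNIV :: (real ^ (fiber_gen \<times> (4 \<times> 4))) set)"
    by (rule rank_nullity[OF linear_coc subspace_UNIV])
  moreover have "dim (UNIV :: (real ^ (fiber_gen \<times> (4 \<times> 4))) set) = 32" by (simp add: CARD_fiber_gen)
  ultimately show ?thesis by simp
qed

end

section \<open>The dimension count and its equality case\<close>

context parabolic_fiber
begin

lemma invariant_cocycle_coboundary:
  assumes N: "N \<noteq> 0" "Polynomial.order 1 N \<le> 20"
    and poly_N: "\<And>s. poly N s = det (\<chi> p q. (if fst p = fst q then s * kron X X $ snd p $ snd q else 0) -
      fox_matrix \<sigma> (fst q) (\<phi> (gen (fst p))) $ snd p $ snd q)"
    and f: "cocycle f" "f c = 0" "\<And>u. f (\<phi> u) ** X = X ** f u"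
  shows "\<exists>Z. \<forall>u. f u = R u ** Z ** R (- u) - Z"
proof -
  let ?X = "block_diagonal (kron X X) :: real ^ (fiber_gen \<times> (4 \<times> 4)) ^ (fiber_gen \<times> (4 \<times> 4))"
  let ?Y = "block_diagonal (kron (lorentz_inverse X) (lorentz_inverse X)) :: real ^ (fiber_gen \<times> (4 \<times> 4)) ^ (fiber_gen \<times> (4 \<times> 4))"
  have XY: "?X ** ?Y = mat 1"
    by (rule block_diagonal_inverse) (simp add: kron_mult X_inverse kron_mat_1)
  then have "det ?X * det ?Y = 1" by (metis det_I det_mul)
  then have detX: "det ?X \<noteq> 0" by auto
  \<comment> \<open>Taking the block matrix of the meridian out of the determinant leaves the
    characteristic polynomial of \<open>shift\<close> at s - 1, so the root 1 of \<open>N\<close> is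
    the eigenvalue zero of \<open>shift\<close>.\<close>
  have "poly N s = poly (smult (det ?X) (charpoly shift \<circ>\<^sub>p [:- 1, 1:])) s" for s
  proof -
    have "(\<chi> p q. (if fst p = fst q then s * kron X X $ snd p $ snd q else 0) -
        fox_matrix \<sigma> (fst q) (\<phi> (gen (fst p))) $ snd p $ snd q) = s *\<^sub>R ?X - fox_jacobian"
      by (simp add: vec_eq_iff block_diagonal_def fox_jacobian_def)
    also have "\<dots> = s *\<^sub>R ?X - (?X ** ?Y) ** fox_jacobian" by (simp add: XY)
    also have "\<dots> = ?X ** (mat s - ?Y ** fox_jacobian)"
      by (simp add: matrix_diff_ldistrib mat_matrix_mult matrix_mul_assoc)
    also have "mat s - ?Y ** fox_jacobian = mat (s - 1) - shift"
      by (simp add: shift_def vec_eq_iff mat_def)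
    finally show ?thesis by (simp add: poly_N det_mul poly_charpoly poly_pcompose)
  qed
  then have eq: "N = smult (det ?X) (charpoly shift \<circ>\<^sub>p [:- 1, 1:])" by (rule poly_ext)
  have nz: "charpoly shift \<noteq> 0" using N(1) unfolding eq by auto
  have "Polynomial.order 0 (charpoly shift) \<le> 20"
    using N(2) detX unfolding eq by (simp add: order_smult order_pcompose_shift[OF nz])
  \<comment> \<open>The exponent 16 is 8 + 8: the inner eighth power lands in \<open>K\<close>, and
    the outer one is then applied to \<open>K\<close>.\<close>
  define S2 S4 S8 S16 where "S2 = shift ** shift" and "S4 = S2 ** S2" and "S8 = S4 ** S4" and "S16 = S8 ** S8"
  note sq = order_charpoly_square
  have "charpoly S16 \<noteq> 0 \<and> Polynomial.order 0 (charpoly S16) = Polynomial.order 0 (charpoly shift)"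
    unfolding S16_def S8_def S4_def S2_def using nz by (simp add: sq)
  then have ker16: "dim {z. S16 *v z = 0} \<le> 20"
    using dim_kernel_le_order[of S16] \<open>Polynomial.order 0 (charpoly shift) \<le> 20\<close> by linarith
  have S8: "S8 *v z = ((*v) shift ^^ 8) z" for z
    by (simp add: S8_def S4_def S2_def matrix_vector_mul_assoc[symmetric] eval_nat_numeral)
  define K where "K = {z. coc z c = 0}"
  have K: "subspace K"
    by (auto simp: K_def subspace_def linear_0[OF linear_coc] linear_add[OF linear_coc] linear_scale[OF linear_coc])
  have S8_K: "S8 *v z \<in> K" for z
    by (simp add: K_def S8 coc_shift_power_c Ad_X_inverse_nilpotent)
  have lin: "linear ((*v) M)" for M :: "real ^ (fiber_gen \<times> (4 \<times> 4)) ^ (fiber_gen \<times> (4 \<times> 4))"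
    by (rule matrix_vector_mul_linear)
  have "dim (range ((*v) S16)) + dim {z \<in> UNIV. S16 *v z = 0} = dim (UNIV :: (real ^ (fiber_gen \<times> (4 \<times> 4))) set)"
    by (rule rank_nullity[OF lin subspace_UNIV])
  \<comment> \<open>12 = 32 - 20. As \<open>K\<close> has dimension at most 17, \<open>S8\<close>
    kills at most 5 dimensions of it.\<close>
  then have "12 \<le> dim (range ((*v) S16))" using ker16 by (simp add: CARD_fiber_gen)
  also have "range ((*v) S16) \<subseteq> (*v) S8 ` K"
    using S8_K by (auto simp: S16_def matrix_vector_mul_assoc[symmetric])
  then have "dim (range ((*v) S16)) \<le> dim ((*v) S8 ` K)" by (rule dim_subset)
  finally have "12 \<le> dim ((*v) S8 ` K)" .
  moreover have "dim ((*v) S8 ` K) + dim {z \<in> K. S8 *v z = 0} = dim K" by (rule rank_nullity[OF lin K])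
  moreover have "dim K \<le> 17" unfolding K_def by (rule dim_vanishing_at_c)
  ultimately have upper: "dim {z \<in> K. S8 *v z = 0} \<le> 5" by linarith
  let ?V = "{Z. R c ** Z = Z ** R c}"
  have V: "subspace ?V"
    by (auto simp: subspace_def matrix_add_ldistrib matrix_add_rdistrib matrix_mult_scaleR scaleR_matrix_mult)
  have sub: "coboundary ` ?V \<subseteq> {z \<in> K. S8 *v z = 0}"
  proof clarsimp
    fix Z assume Z: "R c ** Z = Z ** R c"
    have "coc (coboundary Z) c = Z ** (R c ** R (- c)) - Z" by (simp add: coc_coboundary Z matrix_mul_assoc)
    then have "coboundary Z \<in> K" by (simp add: K_def R_inverse)
    moreover have "S8 *v coboundary Z = 0"
      by (simp add: S8 shift_power_coboundary Ad_X_inverse_nilpotent linear_0[OF linear_coboundary])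
    ultimately show "coboundary Z \<in> K \<and> S8 *v coboundary Z = 0" by blast
  qed
  have sV: "subspace (coboundary ` ?V)" by (rule linear_subspace_image[OF linear_coboundary V])
  have sK: "subspace {z \<in> K. S8 *v z = 0}"
    using K by (auto simp: subspace_def matrix_vector_right_distrib matrix_vector_mult_scaleR)
  \<comment> \<open>The upper and lower bounds meet, so the coboundaries of the centralizer exhaust
    this kernel.\<close>
  have "dim {z \<in> K. S8 *v z = 0} \<le> dim (coboundary ` ?V)"
    using upper dim_coboundary_centralizer by linarith
  then have cob: "coboundary ` ?V = {z \<in> K. S8 *v z = 0}" by (rule subspace_dim_equal[OF sV sK sub])
  obtain z where z: "coc z = f" by (rule coc_surj[OF f(1)])
  \<comment> \<open>The equivariance in \<open>f(3)\<close> says that the meridian fixes the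
    cocycle.\<close>
  have "shift *v z = 0"
  proof (rule coc_inject, rule ext)
    fix u
    have "Ad_X_inverse (f (\<phi> u)) = lorentz_inverse X ** (X ** f u)"
      by (simp only: Ad_X_inverse_def f(3)[symmetric] matrix_mul_assoc)
    also have "\<dots> = f u" by (simp add: matrix_mul_assoc X_inverse)
    finally show "coc (shift *v z) u = coc 0 u"
      by (simp add: coc_shift z linear_0[OF linear_coc])
  qed
  then have "S8 *v z = 0" by (simp add: S8 eval_nat_numeral)
  then have "z \<in> {z \<in> K. S8 *v z = 0}" using f(2) by (simp add: K_def z)
  then obtain Z where "z = coboundary Z" unfolding cob[symmetric] by blast
  then have "f u = R u ** Z ** R (- u) - Z" for u using z coc_coboundary[of Z u] by simp
  then show ?thesis by blast
qed

end

section \<open>Cocycles of the bundle group\<close>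

lemma trace_conjugate: "B ** A = mat 1 \<Longrightarrow> trace (A ** Z ** B) = trace Z" for A B Z :: "real ^ 4 ^ 4"
proof -
  assume "B ** A = mat 1"
  moreover have "trace (A ** Z ** B) = trace (B ** A ** Z)"
    by (subst trace_mul_sym) (simp only: matrix_mul_assoc)
  ultimately show ?thesis by simp
qed

text \<open>Subtracting the coboundary of \<open>V\<close> makes the cocycle vanish at the meridian
  and the loop, and the dimension count makes its restriction to the fiber a coboundary. Once that
  is subtracted too, the value at the meridian commutes with the fiber group and has trace zero, so
  it vanishes.\<close>

lemma (in parabolic_fiber) bundle_cocycle_coboundary:
  assumes N: "N \<noteq> 0" "Polynomial.order 1 N \<le> 20"
    "\<And>s. poly N s = det (\<chi> p q. (if fst p = fst q then s * kron X X $ snd p $ snd q else 0) -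
      fox_matrix \<sigma> (fst q) (\<phi> (gen (fst p))) $ snd p $ snd q)"
    and G: "\<And>u v. G (u + v) = G u ** G v" "G 0 = mat 1" "\<And>u. G (fiber_incl u) = R u" "G gen_x = X"
    and d: "\<And>u v. d (u + v) = d u + G u ** d v ** G (- u)" "\<And>u. trace (d u) = 0"
      "\<And>u. d (gen_x + fiber_incl u) = d (fiber_incl (\<phi> u) + gen_x)"
    and V: "trace V = 0" "d gen_x = G gen_x ** V ** G (- gen_x) - V"
      "d (fiber_incl c) = G (fiber_incl c) ** V ** G (- fiber_incl c) - V"
  shows "\<exists>U. trace U = 0 \<and> (\<forall>u. d u = G u ** U ** G (- u) - U)"
proof -
  let ?\<delta> = "\<lambda>Z u. G u ** Z ** G (- u) - Z"
  have G_inv: "G (- u) ** G u = mat 1" "G u ** G (- u) = mat 1" for u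
    by (simp_all add: G(1)[symmetric] G(2))
  have fiber_minus: "- fiber_incl u = fiber_incl (- u)" for u by (simp add: fiber_incl_simps)
  have \<delta>: "?\<delta> Z (u + v) = ?\<delta> Z u + G u ** ?\<delta> Z v ** G (- u)" for Z u v
    by (simp only: minus_add G(1)) (simp add: matrix_diff_ldistrib matrix_diff_rdistrib matrix_mul_assoc)
  have \<delta>_conj: "?\<delta> Z (gen_x + fiber_incl u) = ?\<delta> Z (fiber_incl (\<phi> u) + gen_x)" for Z u
  proof -
    have eq: "G (gen_x + fiber_incl u) = G (fiber_incl (\<phi> u) + gen_x)" by (simp add: G X_R)
    have "G (- (gen_x + fiber_incl u)) = G (- (fiber_incl (\<phi> u) + gen_x))"
    proof (rule matrix_left_cancel[OF G_inv(1)[of "gen_x + fiber_incl u"]])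
      show "G (gen_x + fiber_incl u) ** G (- (gen_x + fiber_incl u)) =
          G (gen_x + fiber_incl u) ** G (- (fiber_incl (\<phi> u) + gen_x))"
        by (rule trans[OF G_inv(2)]) (simp only: eq G_inv(2))
    qed
    then show ?thesis by (simp only: eq)
  qed
  have tr_\<delta>: "trace (?\<delta> Z u) = 0" for Z u by (simp add: trace_sub trace_conjugate G_inv)
  define d1 where "d1 u = d u - ?\<delta> V u" for u
  have d1: "d1 (u + v) = d1 u + G u ** d1 v ** G (- u)" for u v
    unfolding d1_def d(1) \<delta> by (simp add: matrix_diff_ldistrib matrix_diff_rdistrib)
  have d1_conj: "d1 (gen_x + fiber_incl u) = d1 (fiber_incl (\<phi> u) + gen_x)" for u
    by (simp only: d1_def d(3) \<delta>_conj)
  have d1_x: "d1 gen_x = 0" by (simp add: d1_def V)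
  have "\<exists>Z. \<forall>u. d1 (fiber_incl u) = R u ** Z ** R (- u) - Z"
  proof (rule invariant_cocycle_coboundary[OF N])
    show "cocycle (\<lambda>u. d1 (fiber_incl u))"
      unfolding cocycle_def by (simp add: fiber_incl_add d1 G fiber_minus)
    show "d1 (fiber_incl c) = 0" by (simp add: d1_def V)
    show "d1 (fiber_incl (\<phi> u)) ** X = X ** d1 (fiber_incl u)" for u
    proof -
      have "d1 (fiber_incl (\<phi> u)) = X ** d1 (fiber_incl u) ** G (- gen_x)"
        using d1_conj[of u] by (simp add: d1 d1_x G)
      then have "d1 (fiber_incl (\<phi> u)) ** X = X ** d1 (fiber_incl u) ** (G (- gen_x) ** G gen_x)"
        by (simp only: matrix_mul_assoc G(4))
      then show ?thesis by (simp add: G_inv)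
    qed
  qed
  then obtain Z where Z: "\<And>u. d1 (fiber_incl u) = R u ** Z ** R (- u) - Z" by blast
  \<comment> \<open>Removing the scalar part leaves the coboundary unchanged; 4 is the trace of the
    identity.\<close>
  define Z0 where "Z0 = Z - mat (trace Z / 4)"
  have tr_mat: "trace (mat y :: real ^ 4 ^ 4) = 4 * y" for y by (simp add: trace_def mat_def sum_4)
  have Z0: "trace Z0 = 0" by (simp add: Z0_def trace_sub tr_mat)
  have "A ** mat y ** B = mat y" if "A ** B = mat 1" for A B :: "real ^ 4 ^ 4" and y
    using that by (simp add: mat_matrix_mult scaleR_matrix_mult) (simp add: vec_eq_iff mat_def)
  then have Z': "d1 (fiber_incl u) = ?\<delta> Z0 (fiber_incl u)" for u
    by (simp add: Z Z0_def G fiber_minus matrix_diff_ldistrib matrix_diff_rdistrib R_inverse)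
  define d2 where "d2 u = d1 u - ?\<delta> Z0 u" for u
  have d2: "d2 (u + v) = d2 u + G u ** d2 v ** G (- u)" for u v
    unfolding d2_def d1 \<delta> by (simp add: matrix_diff_ldistrib matrix_diff_rdistrib)
  have d2_fiber: "d2 (fiber_incl u) = 0" for u by (simp add: d2_def Z')
  have d2_conj: "d2 (gen_x + fiber_incl u) = d2 (fiber_incl (\<phi> u) + gen_x)" for u
    by (simp only: d2_def d1_conj \<delta>_conj)
  \<comment> \<open>For a cocycle vanishing on the fiber, the defining relation of the bundle says
    that its value at the meridian is invariant under the fiber group.\<close>
  have d2_x: "d2 gen_x ** R u = R u ** d2 gen_x" for u
  proof -
    obtain v where v: "u = \<phi> v" using \<phi>_surj by blast
    have "d2 gen_x = R u ** d2 gen_x ** R (- u)"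
      using d2_conj[of v] by (simp add: d2 d2_fiber v[symmetric] G fiber_minus)
    then have "d2 gen_x ** R u = R u ** d2 gen_x ** (R (- u) ** R u)" by (metis matrix_mul_assoc)
    then show ?thesis by (simp add: R_inverse)
  qed
  obtain y where y: "d2 gen_x = mat y" using commutant[OF d2_x] by blast
  have "trace (d2 gen_x) = trace (d gen_x) - trace (?\<delta> V gen_x) - trace (?\<delta> Z0 gen_x)"
    by (simp only: d2_def d1_def trace_sub)
  also have "\<dots> = 0" by (simp only: d(2) tr_\<delta>)
  finally have "trace (d2 gen_x) = 0" .
  then have x0: "d2 gen_x = 0" unfolding y tr_mat by (simp add: vec_eq_iff mat_def)
  have gen0: "d2 (gen g) = 0" for g
    using x0 d2_fiber[of "gen (the g)"] by (cases g) simp_all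
  have "d2 u = 0" for u
  proof (induction u rule: free_group_induct)
    case zero
    show ?case using d2_fiber[of 0] by (simp add: fiber_incl_simps)
  next
    case (pos g u)
    then show ?case by (simp add: d2 gen0)
  next
    case (neg g u)
    have "d2 (- gen g) = 0"
      using d2[of "- gen g" "gen g"] gen0[of g] d2_fiber[of 0] by (simp add: fiber_incl_simps)
    with neg show ?case by (simp add: d2)
  qed
  then have "d u = ?\<delta> (V + Z0) u" for u
    using d2_def[of u] d1_def[of u] by (simp add: matrix_add_ldistrib matrix_add_rdistrib algebra_simps)
  moreover have "trace (V + Z0) = 0" by (simp add: trace_add V Z0)
  ultimately show ?thesis by blast
qed

text \<open>Both signs occur, because the exponents of the loop are negated integer parts of
  arbitrary reals.\<close>

definition zmul :: "int \<Rightarrow> 'a::group_add \<Rightarrow> 'a" where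
  "zmul m u = (if m \<ge> 0 then nmul (nat m) u else nmul (nat (- m)) (- u))"

lemma zmul_0: "zmul 0 u = 0"
  by (simp add: zmul_def)

lemma zmul_succ: "zmul (m + 1) u = u + zmul m u"
proof (cases "m \<ge> 0")
  case True
  then have "nat (m + 1) = Suc (nat m)" by simp
  then show ?thesis using True by (simp add: zmul_def)
next
  case False
  then have "nat (- m) = Suc (nat (- (m + 1)))" by simp
  then have "u + zmul m u = nmul (nat (- (m + 1))) (- u)"
    using False by (simp add: zmul_def add.assoc[symmetric])
  then show ?thesis using False by (cases "m = - 1") (simp_all add: zmul_def)
qed

lemma zmul_inject:
  assumes "\<And>n. n > 0 \<Longrightarrow> nmul n u \<noteq> 0" "zmul m u = zmul m' u"
  shows "m = m'"
proof -
  have add: "zmul (m + int k) u = nmul k u + zmul m u" for m k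
  proof (induction k)
    case (Suc k)
    have "zmul (m + int (Suc k)) u = u + zmul (m + int k) u"
      using zmul_succ[of "m + int k" u] by (simp add: ac_simps)
    then show ?case by (simp add: Suc add.assoc)
  qed simp
  have le: "m \<ge> m'" if "zmul m u = zmul m' u" for m m'
  proof (rule ccontr)
    assume "\<not> m \<ge> m'"
    then have "nat (m' - m) > 0" "m' = m + int (nat (m' - m))" by simp_all
    then have "nmul (nat (m' - m)) u = 0" using add[of m "nat (m' - m)"] that
      by (metis add.left_neutral add_right_cancel)
    then show False using assms(1) \<open>nat (m' - m) > 0\<close> by blast
  qed
  show ?thesis using le[of m m'] le[of m' m] assms(2) by simp
qed

lemma nmul_puncture_loop_nonzero:
  assumes "n > 0"
  shows "nmul n (puncture_loop w) \<noteq> 0"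
proof
  assume "nmul n (puncture_loop w) = 0"
  then have "w + nmul n (gen Gen_a + gen Gen_b - gen Gen_a - gen Gen_b) - w = 0"
    unfolding puncture_loop_def nmul_conj .
  then have "nmul n (gen Gen_a + gen Gen_b - gen Gen_a - gen Gen_b) = 0"
    by (metis add.right_neutral add_left_cancel eq_iff_diff_eq_0)
  then show False using nmul_commutator_nonzero[OF assms] by blast
qed

text \<open>Preserving the form forces the scalar relating the two matrices to square to one; the
  sign of the entry at (4,4) decides between the two lifts.\<close>

lemma proj_SO31_future:
  assumes "A \<in> SO31" "A $ 4 $ 4 > 0" "B \<in> SO31" "proj A = proj B"
  shows "A = (if B $ 4 $ 4 > 0 then B else - B)"
proof -
  have "A \<in> proj A" unfolding proj_eq by (auto intro!: exI[of _ 1])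
  then have "A \<in> proj B" by (simp only: assms(4))
  then obtain k where k: "A = k *\<^sub>R B" by (auto simp: proj_eq)
  have t: "transpose (k *\<^sub>R B) = k *\<^sub>R transpose B" by (simp add: transpose_def vec_eq_iff)
  have "lorentz_matrix = (k * k) *\<^sub>R lorentz_matrix"
    using assms(1,3) by (simp add: SO31_iff k t scaleR_matrix_mult matrix_mult_scaleR)
  then have "lorentz_matrix $ 1 $ 1 = ((k * k) *\<^sub>R lorentz_matrix) $ 1 $ 1" by simp
  then have "k * k = 1" by (simp add: lorentz_matrix_def)
  then have "k = 1 \<or> k = - 1" by (simp add: square_eq_1_iff)
  then show ?thesis using assms(2) k by auto
qed

theorem theorem3p4:
  fixes \<phi> :: "fiber_gen free_group \<Rightarrow> fiber_gen free_group"
    and w :: "fiber_gen free_group"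
    and \<rho> :: "bundle_elem \<Rightarrow> (real ^ 4 ^ 4) set"
    and \<rho>t :: "bundle_elem \<Rightarrow> real ^ 4 ^ 4"
    and \<alpha> :: "bundle_elem \<Rightarrow> int"
    and \<Delta> :: "real poly fract"
  assumes monodromy: "hyperbolic_monodromy \<phi>"
    and meridian: "\<phi> (puncture_loop w) = puncture_loop w"
    and holonomy: "holonomy \<phi> \<rho>"
    and lift: "lifts_to_SO31 \<phi> \<rho> \<rho>t"
    and fibration: "fibration_class \<phi> \<alpha>"
    and alexander: "is_twisted_alexander_polynomial (bundle_relator \<phi>)
                      (\<lambda>g. kron (\<rho>t g) (\<rho>t g)) \<alpha> \<Delta>"
    and multiplicity: "root_with_multiplicity \<Delta> 1 4"
  shows "infinitesimally_projectively_rigid_rel_cusp \<phi> w \<rho>"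

proof -
  let ?cls = "bundle_cls \<phi>" and ?\<Gamma> = "bundle_group \<phi>"
  have iso: "\<phi> \<in> iso Free Free" using monodromy by (simp add: hyperbolic_monodromy_def)
  have \<phi>_add: "\<phi> (u + v) = \<phi> u + \<phi> v" for u v using iso by (auto simp: iso_def hom_def)
  have \<phi>_surj: "surj \<phi>" using iso by (simp add: iso_def bij_betw_def)
  define c where "c = puncture_loop w"
  have \<phi>_c: "\<phi> c = c" using meridian by (simp add: c_def)
  have carrier: "carrier ?\<Gamma> = range ?cls" by (simp add: bundle_group_def carrier_presented_group)
  have mult: "?cls u \<otimes>\<^bsub>?\<Gamma>\<^esub> ?cls v = ?cls (u + v)" for u v by (simp add: bundle_group_def cls_mult)
  define r where "r u = \<rho>t (?cls u)" for u
  have r_SO: "r u \<in> SO31" and r_add: "r (u + v) = r u ** r v" and r_proj: "proj (r u) = \<rho> (?cls u)" for u v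
    using lift by (auto simp: lifts_to_SO31_def r_def hom_def carrier mult[symmetric] GL4_def)
  have \<rho>: "\<rho> (?cls u) \<in> PSO31" "inj_on \<rho> (range ?cls)" for u
    using holonomy by (auto simp: holonomy_def carrier)
  \<comment> \<open>The given lift may reverse time. Up to sign it lies in the identity component,
    and since products keep the entry at (4,4) positive, the corrected lift is
    multiplicative.\<close>
  define G where "G u = (if r u $ 4 $ 4 > 0 then r u else - r u)" for u
  have G_SO0: "G u \<in> SO31_0" and G_proj: "proj (G u) = \<rho> (?cls u)" for u
  proof -
    obtain A where A: "A \<in> SO31_0" "\<rho> (?cls u) = proj A" using \<rho>(1)[of u] by (auto simp: PSO31_def)
    have "A = G u"
      unfolding G_def using proj_SO31_future[OF SO31_0_future[OF A(1)] r_SO] A(2) r_proj by metis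
    then show "G u \<in> SO31_0" "proj (G u) = \<rho> (?cls u)" using A by auto
  qed
  note G_future = SO31_0_future[OF G_SO0]
  have G_r: "G u = r u \<or> G u = - r u" for u by (simp add: G_def)
  have minus_mult: "- A ** B = - (A ** B)" "A ** - B = - (A ** B)" for A B :: "real ^ 4 ^ 4"
    by (simp_all add: vec_eq_iff matrix_matrix_mult_def sum_negf)
  have G_add: "G (u + v) = G u ** G v" for u v
  proof -
    have "G u ** G v = r (u + v) \<or> G u ** G v = - r (u + v)"
      using G_r[of u] G_r[of v] by (auto simp: r_add minus_mult)
    moreover have "(G u ** G v) $ 4 $ 4 > 0" by (rule SO31_mult_44[OF G_future G_future])
    ultimately show ?thesis unfolding G_def[of "u + v"] by auto
  qed
  have G_0: "G 0 = mat 1"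
  proof (rule matrix_left_cancel)
    show "lorentz_matrix ** transpose (G 0) ** lorentz_matrix ** G 0 = mat 1"
      by (rule SO31_inverse(1)[OF G_future(1)])
    show "G 0 ** G 0 = G 0 ** mat 1" using G_add[of 0 0] by simp
  qed
  have G_inv: "G (- u) ** G u = mat 1" "G u ** G (- u) = mat 1" for u
    by (simp_all add: G_add[symmetric] G_0)
  have lorentz_inverse_G: "lorentz_matrix ** transpose (G u) ** lorentz_matrix = G (- u)" for u
    by (rule matrix_left_cancel[OF G_inv(1)[of u]]) (simp only: G_inv SO31_inverse(2)[OF G_future(1)])
  \<comment> \<open>By faithfulness, identities between matrices hold already in the bundle
    group.\<close>
  have G_cls: "?cls u = ?cls v" if "G u = G v" for u v
    using that G_proj \<rho>(2) by (metis inj_onD rangeI)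
  have cls_G: "G u = G v" if "?cls u = ?cls v" for u v
    using that by (simp add: G_def r_def)
  define R where "R u = G (fiber_incl u)" for u
  define X where "X = G gen_x"
  have R_SO: "R u \<in> SO31" for u by (simp add: R_def G_future)
  have R_add: "R (u + v) = R u ** R v" for u v by (simp add: R_def fiber_incl_add G_add)
  have R_inj: "inj R"
    by (rule injI) (metis R_def G_cls bundle_fiber_injective[OF iso])
  \<comment> \<open>The relators give this for generators only. The extension to all
    \<open>u\<close> is an induction on matrices, carried back by faithfulness.\<close>
  have x_fiber: "?cls (gen_x + fiber_incl u) = ?cls (fiber_incl (\<phi> u) + gen_x)" for u
  proof -
    have "?cls (gen_x + fiber_incl (gen g)) = ?cls (fiber_incl (\<phi> (gen g)) + gen_x)" for g
    proof -
      have "gen_x + fiber_incl (gen g) = bundle_relator \<phi> g + (fiber_incl (\<phi> (gen g)) + gen_x)"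
        by (simp add: bundle_relator_def diff_conv_add_uminus add.assoc del: add_uminus_conv_diff)
      moreover have "?cls (bundle_relator \<phi> g) = ?cls 0" by (simp add: cls_relator cls_zero)
      ultimately show ?thesis by (metis mult add.left_neutral)
    qed
    then have "X ** R (gen g) = R (\<phi> (gen g)) ** X" for g
      using cls_G[of "gen_x + fiber_incl (gen g)"] by (simp add: X_def R_def G_add)
    note gen = this
    have R_0: "R 0 = mat 1" by (simp add: R_def fiber_incl_simps G_0)
    have \<phi>_minus: "\<phi> (- u) = - \<phi> u" "\<phi> 0 = 0" for u by (rule additive_group_add[of \<phi>, OF \<phi>_add])+
    have neg: "X ** R (- gen g) = R (- \<phi> (gen g)) ** X" for g
    proof -
      have "X ** R (- gen g) = (R (- \<phi> (gen g)) ** R (\<phi> (gen g))) ** X ** R (- gen g)"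
        by (simp add: R_add[symmetric] R_0)
      also have "\<dots> = R (- \<phi> (gen g)) ** (X ** R (gen g)) ** R (- gen g)"
        unfolding gen by (simp only: matrix_mul_assoc)
      also have "\<dots> = R (- \<phi> (gen g)) ** X ** (R (gen g) ** R (- gen g))" by (simp only: matrix_mul_assoc)
      finally show ?thesis by (simp add: R_add[symmetric] R_0)
    qed
    have "X ** R u = R (\<phi> u) ** X"
    proof (induction u rule: free_group_induct)
      case zero
      show ?case by (simp add: R_0 \<phi>_minus)
    next
      case (pos g u)
      have "X ** R (gen g + u) = R (\<phi> (gen g)) ** (X ** R u)" by (simp only: R_add gen matrix_mul_assoc)
      then show ?case by (simp only: pos R_add \<phi>_add matrix_mul_assoc)
    next
      case (neg g u)
      have "X ** R (- gen g + u) = R (- \<phi> (gen g)) ** (X ** R u)"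
        by (simp only: R_add \<open>\<And>g. X ** R (- gen g) = R (- \<phi> (gen g)) ** X\<close> matrix_mul_assoc)
      then show ?case by (simp only: neg R_add \<phi>_add \<phi>_minus matrix_mul_assoc)
    qed
    then have "G (gen_x + fiber_incl u) = G (fiber_incl (\<phi> u) + gen_x)" by (simp add: X_def R_def G_add)
    then show ?thesis by (rule G_cls)
  qed
  have X_R: "X ** R u = R (\<phi> u) ** X" for u
    using cls_G[OF x_fiber[of u]] by (simp add: X_def R_def G_add)
  have \<alpha>_add: "\<alpha> (?cls (u + v)) = \<alpha> (?cls u) + \<alpha> (?cls v)" for u v
    using fibration by (auto simp: fibration_class_def hom_def carrier mult[symmetric] integer_group_def)
  have \<alpha>_fiber: "\<alpha> (?cls (fiber_incl u)) = 0" and \<alpha>_x: "\<alpha> (?cls gen_x) = 1" for u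
    using fibration by (auto simp: fibration_class_def)
  have \<alpha>_nmul: "\<alpha> (?cls (nmul n gen_x)) = int n" for n
    by (induction n) (use \<alpha>_fiber[of 0] in \<open>simp_all add: \<alpha>_add \<alpha>_x fiber_incl_simps\<close>)
  \<comment> \<open>Elements of the peripheral group as words c^m x^n, with m an integer and n a
    natural number.\<close>
  define F where "F m n = G (fiber_incl (zmul m c) + nmul n gen_x)" for m n
  obtain P t t' where frame: "null_frame P" "R c ** P = P ** par 1 1 t" "X ** P = P ** par 1 1 t'"
    "Im (t' * cnj t) \<noteq> 0"
  proof (rule discrete_rank_two_parabolic[of "R c" X F])
    show "R c \<in> SO31" "R c $ 4 $ 4 > 0" "X \<in> SO31" "X $ 4 $ 4 > 0"
      by (simp_all add: R_def X_def G_future)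
    show "R c ** X = X ** R c" by (simp add: X_R \<phi>_c)
    show "F 0 0 = mat 1" by (simp add: F_def zmul_0 fiber_incl_simps G_0)
    show "F (m + 1) n = R c ** F m n" for m n
      by (simp add: F_def R_def zmul_succ fiber_incl_add G_add matrix_mul_assoc)
    show "F 0 (Suc n) = X ** F 0 n" for n
      by (simp add: F_def X_def zmul_0 fiber_incl_simps G_add)
    show "m = m' \<and> n = n'" if "F m n = F m' n'" for m n m' n'
    proof -
      have "?cls (fiber_incl (zmul m c) + nmul n gen_x) = ?cls (fiber_incl (zmul m' c) + nmul n' gen_x)"
        using that unfolding F_def by (rule G_cls)
      then have "\<alpha> (?cls (fiber_incl (zmul m c) + nmul n gen_x)) = \<alpha> (?cls (fiber_incl (zmul m' c) + nmul n' gen_x))"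
        by simp
      \<comment> \<open>The fibration class recovers the exponent of the meridian; cancelling it
        leaves powers of the loop in the free fiber group.\<close>
      then have n: "n = n'" by (simp add: \<alpha>_add \<alpha>_fiber \<alpha>_nmul)
      then have "R (zmul m c) ** G (nmul n gen_x) = R (zmul m' c) ** G (nmul n gen_x)"
        using that by (simp add: F_def R_def G_add)
      then have "R (zmul m c) ** (G (nmul n gen_x) ** G (- nmul n gen_x)) =
          R (zmul m' c) ** (G (nmul n gen_x) ** G (- nmul n gen_x))"
        by (simp only: matrix_mul_assoc)
      then have "zmul m c = zmul m' c" using R_inj by (simp add: G_inv inj_eq)
      then have "m = m'" using zmul_inject nmul_puncture_loop_nonzero unfolding c_def by blast
      then show ?thesis using n by simp
    qed
    show "finite S" if S: "S \<subseteq> range (case_prod F)" "bounded S" for S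
    proof (rule discrete_bounded_finite[of "range G"])
      show "range G \<subseteq> SO31" using G_future by blast
      have "discrete {A \<in> SO31_0. proj A \<in> \<rho> ` carrier ?\<Gamma>}" using holonomy by (simp add: holonomy_def)
      moreover have sub: "range G \<subseteq> {A \<in> SO31_0. proj A \<in> \<rho> ` carrier ?\<Gamma>}"
        using G_SO0 G_proj carrier by auto
      moreover have "mat 1 \<in> range G" using G_0 by (metis rangeI)
      ultimately show "mat 1 isolated_in range G" by (meson discreteD discrete_subset)
      show "lorentz_matrix ** transpose A ** lorentz_matrix ** B \<in> range G" if "A \<in> range G" "B \<in> range G" for A B
        using that by (auto simp: lorentz_inverse_G G_add[symmetric])
      show "S \<subseteq> range G" using S(1) by (auto simp: F_def)
      show "bounded S" by (rule S(2))
    qed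
  qed blast
  interpret parabolic_fiber P X R \<phi> c w t t'
    by unfold_locales
      (use frame R_SO R_add R_inj X_R \<phi>_add \<phi>_surj \<phi>_c G_future c_def in \<open>simp_all add: X_def\<close>)
  \<comment> \<open>The sign cancels in the tensor square, so the hypothesis on the given lift is
    one on \<open>G\<close>.\<close>
  have kron_r: "kron (r u) (r u) = kron (G u) (G u)" for u
    by (simp add: G_def kron_def vec_eq_iff)
  let ?\<sigma> = "\<lambda>g. kron (\<rho>t g) (\<rho>t g)"
  have \<sigma>_cls: "?\<sigma> (?cls u) = kron (G u) (G u)" for u by (simp add: r_def[symmetric] kron_r)
  obtain n k N d where N: "\<Delta> = const k * tvar powi n * (poly_fract N / poly_fract d)" "k \<noteq> 0" "poly_fract d \<noteq> 0"
    "degree d \<le> CARD(4 \<times> 4)"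
    "\<And>s. poly N s = det (\<chi> p q. (if fst p = fst q then s * ?\<sigma> (?cls gen_x) $ snd p $ snd q else 0) -
        fox_matrix (\<lambda>v. ?\<sigma> (?cls (fiber_incl v))) (fst q) (\<phi> (gen (fst p))) $ snd p $ snd q)"
  proof (rule twisted_alexander_bundle[of ?\<sigma> \<phi> \<alpha> \<Delta>])
    show "?\<sigma> (?cls (u + v)) = ?\<sigma> (?cls u) ** ?\<sigma> (?cls v)" for u v
      by (simp only: \<sigma>_cls kron_mult G_add)
    show "?\<sigma> (?cls 0) = mat 1" by (simp only: \<sigma>_cls G_0 kron_mat_1)
    show "det (mat 1 - ?\<sigma> (?cls (gen (Some g)))) = 0" for g
      by (simp only: \<sigma>_cls) (rule det_kron_minus_1[OF G_future(1)])
  qed (use \<alpha>_add \<alpha>_fiber \<alpha>_x alexander in blast)+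
  have ord: "N \<noteq> 0" "Polynomial.order 1 N = 4 + Polynomial.order 1 d"
    by (rule order_alexander_numerator[OF multiplicity N(3,2,1)])+
  have "d \<noteq> 0" using N(3) by (auto simp: poly_fract_simps)
  \<comment> \<open>The order of a root is at most the degree, here bounded by 16 = 4 * 4.\<close>
  then have "Polynomial.order 1 d \<le> 16" using order_degree[of d 1] N(4) by simp
  then have ord20: "Polynomial.order 1 N \<le> 20" using ord(2) by simp
  have poly_N: "poly N s = det (\<chi> p q. (if fst p = fst q then s * kron X X $ snd p $ snd q else 0) -
      fox_matrix \<sigma> (fst q) (\<phi> (gen (fst p))) $ snd p $ snd q)" for s
  proof -
    have "(\<lambda>v. ?\<sigma> (?cls (fiber_incl v))) = \<sigma>" by (simp only: \<sigma>_cls) (simp add: fun_eq_iff \<sigma>_def R_def)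
    then show ?thesis unfolding N(5) by (simp only: \<sigma>_cls X_def)
  qed
  let ?act = "\<lambda>g. Ad (\<rho> g)" and ?P = "boundary_group \<phi> w"
  have act: "?act (?cls u) Z = G u ** Z ** G (- u)" for u Z
  proof -
    have "invertible (G u)" unfolding invertible_def using G_inv by blast
    moreover have "matrix_inv (G u) = G (- u)" using G_inv by (rule matrix_inv_eqI[rotated])
    ultimately show ?thesis by (simp add: G_proj[symmetric] Ad_proj)
  qed
  have in_P: "?cls gen_x \<in> carrier ?P" "?cls (fiber_incl c) \<in> carrier ?P"
    unfolding boundary_group_def c_def carrier_subgroup_generated
    by (auto intro!: generate.incl simp: carrier)
  show ?thesis
    unfolding infinitesimally_projectively_rigid_rel_cusp_def
  proof (rule inj_onI)
    fix C1 C2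
    assume C: "C1 \<in> carrier (H1 ?\<Gamma> sl4 ?act)" "C2 \<in> carrier (H1 ?\<Gamma> sl4 ?act)"
      and eq: "H1_restriction ?P sl4 ?act C1 = H1_restriction ?P sl4 ?act C2"
    have carrier_H1: "\<exists>y\<in>cocycles ?\<Gamma> sl4 ?act. D = {\<lambda>g\<in>carrier ?\<Gamma>. (?act g V - V) + y g | V. V \<in> sl4}"
      if "D \<in> carrier (H1 ?\<Gamma> sl4 ?act)" for D
    proof -
      obtain y where y: "y \<in> cocycles ?\<Gamma> sl4 ?act"
        "D = coboundaries ?\<Gamma> sl4 ?act #>\<^bsub>cocycle_group ?\<Gamma> sl4 ?act\<^esub> y"
      proof -
        have "carrier (cocycle_group ?\<Gamma> sl4 ?act) = cocycles ?\<Gamma> sl4 ?act" by (simp add: cocycle_group_def)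
        then show ?thesis using that \<open>D \<in> _\<close> by (auto simp: H1_def FactGroup_def RCOSETS_def)
      qed
      have "D = {\<lambda>g\<in>carrier ?\<Gamma>. (\<lambda>g\<in>carrier ?\<Gamma>. ?act g V - V) g + y g | V. V \<in> sl4}"
        unfolding y(2) r_coset_def coboundaries_def cocycle_group_def by auto
      also have "\<dots> = {\<lambda>g\<in>carrier ?\<Gamma>. (?act g V - V) + y g | V. V \<in> sl4}"
        by (intro arg_cong[where f = Collect] ext ex_cong1) (auto simp: restrict_def fun_eq_iff)
      finally show ?thesis using y(1) by blast
    qed
    obtain y1 where y1: "y1 \<in> cocycles ?\<Gamma> sl4 ?act" "C1 = {\<lambda>g\<in>carrier ?\<Gamma>. (?act g V - V) + y1 g | V. V \<in> sl4}"
      using carrier_H1[OF C(1)] by blast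
    obtain y2 where y2: "y2 \<in> cocycles ?\<Gamma> sl4 ?act" "C2 = {\<lambda>g\<in>carrier ?\<Gamma>. (?act g V - V) + y2 g | V. V \<in> sl4}"
      using carrier_H1[OF C(2)] by blast
    have restriction: "H1_restriction ?P sl4 ?act D =
        {\<lambda>g\<in>carrier ?P. (\<lambda>g\<in>carrier ?P. ?act g V - V) g + restrict z (carrier ?P) g | z V. z \<in> D \<and> V \<in> sl4}" for D
    proof -
      have "h \<otimes>\<^bsub>cocycle_group ?P sl4 ?act\<^esub> z = (\<lambda>g\<in>carrier ?P. h g + z g)" for h z
        by (simp add: cocycle_group_def)
      then show ?thesis unfolding H1_restriction_def r_coset_def coboundaries_def by (simp only:) blast
    qed
    have sl4_0: "0 \<in> sl4" by (simp add: sl4_def trace_def)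
    \<comment> \<open>The representative \<open>y1\<close> itself; equality of the restricted
      classes then provides a representative of \<open>C2\<close> that agrees with it on the
      boundary group up to the coboundary of some \<open>V\<close>.\<close>
    define z1 where "z1 = (\<lambda>g\<in>carrier ?\<Gamma>. (?act g 0 - 0) + y1 g)"
    have "z1 \<in> C1" unfolding y1(2) z1_def using sl4_0 by blast
    then have "(\<lambda>g\<in>carrier ?P. (\<lambda>g\<in>carrier ?P. ?act g 0 - 0) g + restrict z1 (carrier ?P) g) \<in> H1_restriction ?P sl4 ?act C1"
      unfolding restriction using sl4_0 by blast
    then obtain z2 V where zV: "z2 \<in> C2" "V \<in> sl4"
      "(\<lambda>g\<in>carrier ?P. (\<lambda>g\<in>carrier ?P. ?act g 0 - 0) g + restrict z1 (carrier ?P) g) =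
        (\<lambda>g\<in>carrier ?P. (\<lambda>g\<in>carrier ?P. ?act g V - V) g + restrict z2 (carrier ?P) g)"
      unfolding eq unfolding restriction by blast
    obtain V2 where V2: "V2 \<in> sl4" "z2 = (\<lambda>g\<in>carrier ?\<Gamma>. (?act g V2 - V2) + y2 g)"
      using zV(1) unfolding y2(2) by blast
    \<comment> \<open>The classes agree once this difference is a coboundary; on the boundary group
      it is that of \<open>V + V2\<close>.\<close>
    define d where "d u = y1 (?cls u) - y2 (?cls u)" for u
    have on_P: "d u = G u ** (V + V2) ** G (- u) - (V + V2)" if "?cls u \<in> carrier ?P" for u
    proof -
      have "(?act (?cls u) 0 - 0) + z1 (?cls u) = (?act (?cls u) V - V) + z2 (?cls u)"
        using fun_cong[OF zV(3), of "?cls u"] that by simp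
      then show ?thesis
        by (simp add: z1_def V2(2) carrier act d_def matrix_add_ldistrib matrix_add_rdistrib algebra_simps)
    qed
    have y_add: "y (?cls (u + v)) = y (?cls u) + G u ** y (?cls v) ** G (- u)"
      and y_tr: "trace (y (?cls u)) = 0" if "y \<in> cocycles ?\<Gamma> sl4 ?act" for y u v
      using that by (auto simp: cocycles_def carrier mult act sl4_def PiE_iff)
    have "\<exists>U. trace U = 0 \<and> (\<forall>u. d u = G u ** U ** G (- u) - U)"
    proof (rule bundle_cocycle_coboundary[OF ord(1) ord20 poly_N])
      show "G (u + v) = G u ** G v" for u v by (rule G_add)
      show "G 0 = mat 1" by (rule G_0)
      show "G (fiber_incl u) = R u" for u by (simp add: R_def)
      show "G gen_x = X" by (simp add: X_def)
      show "d (u + v) = d u + G u ** d v ** G (- u)" for u v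
        by (simp add: d_def y_add[OF y1(1)] y_add[OF y2(1)] matrix_diff_ldistrib matrix_diff_rdistrib)
      show "trace (d u) = 0" for u by (simp add: d_def trace_sub y_tr[OF y1(1)] y_tr[OF y2(1)])
      show "d (gen_x + fiber_incl u) = d (fiber_incl (\<phi> u) + gen_x)" for u by (simp add: d_def x_fiber)
      show "trace (V + V2) = 0" using zV(2) V2(1) by (simp add: sl4_def trace_add)
      show "d gen_x = G gen_x ** (V + V2) ** G (- gen_x) - (V + V2)" by (rule on_P[OF in_P(1)])
      show "d (fiber_incl c) = G (fiber_incl c) ** (V + V2) ** G (- fiber_incl c) - (V + V2)"
        by (rule on_P[OF in_P(2)])
    qed
    then obtain U where U: "U \<in> sl4" "\<And>u. y1 (?cls u) = (G u ** U ** G (- u) - U) + y2 (?cls u)"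
      by (auto simp: sl4_def d_def algebra_simps)
    \<comment> \<open>Translating the coboundary parameter by \<open>U\<close> matches the elements
      of the two cosets.\<close>
    have shift: "(\<lambda>g\<in>carrier ?\<Gamma>. (?act g W - W) + y1 g) = (\<lambda>g\<in>carrier ?\<Gamma>. (?act g (W + U) - (W + U)) + y2 g)" for W
    proof (rule restrict_ext)
      fix g assume "g \<in> carrier ?\<Gamma>"
      then obtain u where "g = ?cls u" by (auto simp: carrier)
      then show "(?act g W - W) + y1 g = (?act g (W + U) - (W + U)) + y2 g"
        by (simp add: U act matrix_add_ldistrib matrix_add_rdistrib)
    qed
    have sl4: "W + U \<in> sl4" "W - U \<in> sl4" if "W \<in> sl4" for W
      using that U(1) by (simp_all add: sl4_def trace_add trace_sub)
    show "C1 = C2"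
    proof
      show "C1 \<subseteq> C2" unfolding y1(2) y2(2) shift using sl4(1) by blast
      show "C2 \<subseteq> C1"
      proof
        fix z assume "z \<in> C2"
        then obtain W where W: "W \<in> sl4" "z = (\<lambda>g\<in>carrier ?\<Gamma>. (?act g W - W) + y2 g)" unfolding y2(2) by blast
        then have "z = (\<lambda>g\<in>carrier ?\<Gamma>. (?act g (W - U) - (W - U)) + y1 g)" using shift[of "W - U"] by simp
        then show "z \<in> C1" unfolding y1(2) using sl4(2)[OF W(1)] by blast
      qed
    qed
  qed
qed

end
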